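(* Let $B$ be a maximal trigonal curve in a Hirzebruch surface and let $\operatorname{Sk}$ be its skeleton. Then $B$ is reducible if and only if all vertices of $\operatorname{Sk}$ are nonsingular (i.e., have valency $3$) and $\operatorname{Sk}$ admits a marking with the following properties: (1) each hanging edge has index $1$ at the (only) vertex incident to it; (2) any other edge has indices $(1,1)$, $(2,3)$, or $(3,2)$ at its two endpoints.
   Context: The Hirzebruch surface $\Sigma_k$, $k\ge0$, is the rational geometrically ruled surface over $\mathbb{P}^1$ with an exceptional section $E$ of self-intersection $-k$. A trigonal curve $B\subset\Sigma_k$ is a reduced curve disjoint from $E$ and intersecting each generic fiber at three points. It is simplified if all its singular points are double (of type $\mathbf{A}_p$). It has a Weierstrass equation $x^3+g_2x+g_3=0$, where $g_2,g_3$ are sections of $\mathcal{O}_{\mathbb{P}^1}(2k)$, $\mathcal{O}_{\mathbb{P}^1}(3k)$ and $x=\infty$ is $E$. Its $j$-invariant is the meromorphic function $j_B=4g_2^3/(4g_2^3+27g_3^2)\colon\mathbb{P}^1\to\mathbb{P}^1$. A simplified trigonal curve $B$ with $j_B$ non-constant is maximal if $j_B$ has no critical values other than $0,1,\infty$, the ramification index of $j_B$ at each point over $0$ is at most $3$, and the ramification index of $j_B$ at each point over $1$ is at most $2$. The skeleton $\operatorname{Sk}=\operatorname{Sk}(B)\subset\mathbb{P}^1\cong S^2$ of a maximal trigonal curve $B$ is the graph $j_B^{-1}([0,1])$ whose vertices are the points of $j_B^{-1}(0)$, the points of $j_B^{-1}(1)$ being disregarded: a point over $1$ with ramification index $2$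 is just an inner point of an edge, and a point over $1$ with ramification index $1$ is the free end of a hanging edge, i.e., an edge with only one end attached to a vertex. A marking at a trivalent vertex $z$ of $\operatorname{Sk}$ is an ordering $e_1,e_2,e_3$ of the three edge ends incident to $z$ in the counterclockwise direction (so it is determined by choosing which of them is $e_1$); the edge end $e_i$ is said to have index $i$ at $z$. A marking of $\operatorname{Sk}$ is a collection of markings at all its trivalent vertices. (A loop has two ends at the same vertex, each with its own index.) *)

theory Defs
  imports "HOL-Complex_Analysis.Complex_Analysis" "HOL-Computational_Algebra.Polynomial"
begin

section \<open>The projective line\<close>

type_synonym P1 = "complex option"  \<comment> \<open>\<open>None\<close> is the point at infinity\<close>

definition P1_top :: "P1 topology" where
  "P1_top = Alexandroff_compactification euclidean"

definition P1_inverse :: "complex \<Rightarrow> P1" where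
  "P1_inverse c = (if c = 0 then None else Some (1 / c))"

text \<open>Holomorphic coordinate \<open>u\<close> centred at \<open>z\<close>: it is \<open>u = t - a\<close> at \<open>Some a\<close> and \<open>u = 1 / t\<close> at
  infinity.\<close>

definition P1_chart :: "P1 \<Rightarrow> complex \<Rightarrow> P1" where
  "P1_chart z u = (case z of Some a \<Rightarrow> Some (a + u) | None \<Rightarrow> P1_inverse u)"

text \<open>A section of \<open>\<O>(n)\<close> is a polynomial \<open>p\<close> of degree at most \<open>n\<close> in the affine coordinate \<open>t\<close>. Its
  expression in the coordinate \<open>u\<close> centred at \<open>z\<close> is \<open>p (a + u)\<close> at \<open>Some a\<close>, and
  \<open>u ^ n * p (1 / u)\<close> at infinity.\<close>

definition section_at :: "nat \<Rightarrow> complex poly \<Rightarrow> P1 \<Rightarrow> complex poly" where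
  "section_at n p z = (case z of
      Some a \<Rightarrow> pcompose p [:a, 1:]
    | None \<Rightarrow> (\<Sum>i\<le>n. monom (coeff p (n - i)) i))"


section \<open>Curves in the Hirzebruch surface\<close>

text \<open>Points of \<open>\<Sigma>\<^sub>k\<close> are pairs of a point of the base and a fibre coordinate. Over \<open>Some t\<close> the
  fibre coordinate is \<open>x\<close>, over infinity it is \<open>y = x / t ^ k\<close>. The algebraic structure is that
  of the four affine charts with coordinates \<open>(t, x)\<close>, \<open>(t, 1 / x)\<close>, \<open>(s, y)\<close>, \<open>(s, 1 / y)\<close>, where
  \<open>s = 1 / t\<close>. The normal coordinate \<open>1 / x\<close> of the section \<open>x = \<infinity>\<close> changes by
  \<open>1 / y = s powi (- k) * (1 / x)\<close>, so the self-intersection of this section is \<open>- k\<close>.\<close>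

type_synonym hirzebruch_point = "P1 \<times> P1"

definition hirzebruch_charts :: "nat \<Rightarrow> (complex \<times> complex \<Rightarrow> hirzebruch_point) set" where
  "hirzebruch_charts k =
    {\<lambda>(t, x). (Some t, Some x),
     \<lambda>(t, v). (Some t, P1_inverse v),
     \<lambda>(s, y). (P1_inverse s, Some (if s = 0 then y else y / s ^ k)),
     \<lambda>(s, w). (P1_inverse s, P1_inverse (if s = 0 then w else w * s ^ k))}"

definition exceptional_section :: "hirzebruch_point set" where
  "exceptional_section = {(z, None) | z. True}"

text \<open>Reduced algebraic curves, identified with their point sets: on a smooth surface these are the
  sets that are locally the zero set of one nonzero polynomial. An element \<open>F\<close> of
  \<open>complex poly poly\<close> is a polynomial in the second coordinate whose coefficients are polynomials
  in the first one.\<close>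

definition algebraic_curve :: "nat \<Rightarrow> hirzebruch_point set \<Rightarrow> bool" where
  "algebraic_curve k C \<longleftrightarrow>
    (\<forall>\<phi>\<in>hirzebruch_charts k. \<exists>F :: complex poly poly. F \<noteq> 0 \<and>
       (\<forall>a b. \<phi> (a, b) \<in> C \<longleftrightarrow> poly (poly F [:b:]) a = 0))"

definition reducible_curve :: "nat \<Rightarrow> hirzebruch_point set \<Rightarrow> bool" where
  "reducible_curve k C \<longleftrightarrow>
    (\<exists>C1 C2. algebraic_curve k C1 \<and> algebraic_curve k C2 \<and> C = C1 \<union> C2 \<and> C1 \<noteq> C \<and> C2 \<noteq> C)"

definition trigonal_curve :: "nat \<Rightarrow> hirzebruch_point set \<Rightarrow> bool" where
  "trigonal_curve k B \<longleftrightarrow>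
     algebraic_curve k B \<and> B \<inter> exceptional_section = {} \<and>
     finite {z. card {x. (z, x) \<in> B} \<noteq> 3}"


section \<open>Weierstrass equations and the j-invariant\<close>

text \<open>The Weierstrass polynomial \<open>x ^ 3 + g2 * x + g3\<close> in local coordinates over a neighbourhood of \<open>z\<close>.\<close>

definition weierstrass_at :: "nat \<Rightarrow> complex poly \<Rightarrow> complex poly \<Rightarrow> P1 \<Rightarrow> complex poly poly" where
  "weierstrass_at k g2 g3 z = [:section_at (3 * k) g3 z, section_at (2 * k) g2 z, 0, 1:]"

text \<open>The section \<open>a\<close> of \<open>\<O>(k)\<close> accounts for the automorphism \<open>x \<mapsto> x + a\<close> of \<open>\<Sigma>\<^sub>k\<close>
  needed to remove the quadratic term from the equation of a trigonal curve.\<close>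

definition weierstrass_equation ::
    "nat \<Rightarrow> hirzebruch_point set \<Rightarrow> complex poly \<Rightarrow> complex poly \<Rightarrow> bool" where
  "weierstrass_equation k B g2 g3 \<longleftrightarrow>
     degree g2 \<le> 2 * k \<and> degree g3 \<le> 3 * k \<and>
     (\<exists>a. degree a \<le> k \<and>
        B = {(z, Some (b + poly (section_at k a z) 0)) | z b.
               poly (poly (weierstrass_at k g2 g3 z) [:b:]) 0 = 0})"

text \<open>Multiplicity of the plane curve \<open>F = 0\<close> at the point \<open>(0, b)\<close>: the order of the Taylor expansion
  of \<open>F\<close> there.\<close>

definition point_multiplicity :: "complex poly poly \<Rightarrow> complex \<Rightarrow> nat" where
  "point_multiplicity F b =
     (LEAST n. \<exists>i j. i + j = n \<and> coeff (coeff (pcompose F [:[:b:], 1:]) i) j \<noteq> 0)"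

text \<open>A point is singular if its multiplicity is at least 2. A singular point of a reduced curve on a
  smooth surface is of type \<open>A\<^sub>p\<close> for some \<open>p\<close> if and only if it is a double point.\<close>

definition simplified :: "nat \<Rightarrow> complex poly \<Rightarrow> complex poly \<Rightarrow> bool" where
  "simplified k g2 g3 \<longleftrightarrow>
     (\<forall>z b. point_multiplicity (weierstrass_at k g2 g3 z) b \<ge> 2 \<longrightarrow>
            point_multiplicity (weierstrass_at k g2 g3 z) b = 2)"

text \<open>The j-invariant as a function of the local coordinate at \<open>z\<close>. Numerator and denominator may have
  common zeros, so that values are obtained as limits.\<close>

definition j_local :: "nat \<Rightarrow> complex poly \<Rightarrow> complex poly \<Rightarrow> P1 \<Rightarrow> complex \<Rightarrow> complex" where
  "j_local k g2 g3 z u =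
     (let a = poly (section_at (2 * k) g2 z) u; b = poly (section_at (3 * k) g3 z) u
      in 4 * a ^ 3 / (4 * a ^ 3 + 27 * b ^ 2))"

definition j_invariant :: "nat \<Rightarrow> complex poly \<Rightarrow> complex poly \<Rightarrow> P1 \<Rightarrow> P1" where
  "j_invariant k g2 g3 z =
     (if is_pole (j_local k g2 g3 z) 0 then None else Some (Lim (at 0) (j_local k g2 g3 z)))"

definition j_ramification :: "nat \<Rightarrow> complex poly \<Rightarrow> complex poly \<Rightarrow> P1 \<Rightarrow> int" where
  "j_ramification k g2 g3 z =
     (let f = j_local k g2 g3 z in
      if is_pole f 0 then - zorder f 0 else zorder (\<lambda>u. f u - Lim (at 0) f) 0)"

definition maximal_trigonal_curve ::
    "nat \<Rightarrow> hirzebruch_point set \<Rightarrow> complex poly \<Rightarrow> complex poly \<Rightarrow> bool" where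
  "maximal_trigonal_curve k B g2 g3 \<longleftrightarrow>
     trigonal_curve k B \<and> weierstrass_equation k B g2 g3 \<and> simplified k g2 g3 \<and>
     (\<exists>z w. j_invariant k g2 g3 z \<noteq> j_invariant k g2 g3 w) \<and>
     (\<forall>z. j_ramification k g2 g3 z > 1 \<longrightarrow> j_invariant k g2 g3 z \<in> {Some 0, Some 1, None}) \<and>
     (\<forall>z. j_invariant k g2 g3 z = Some 0 \<longrightarrow> j_ramification k g2 g3 z \<le> 3) \<and>
     (\<forall>z. j_invariant k g2 g3 z = Some 1 \<longrightarrow> j_ramification k g2 g3 z \<le> 2)"


section \<open>The skeleton\<close>

text \<open>The skeleton is determined by the map \<open>j\<close>; in this section \<open>j\<close> is an arbitrary self-map of
  the projective line.\<close>

definition skeleton :: "(P1 \<Rightarrow> P1) \<Rightarrow> P1 set" where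
  "skeleton j = {z. \<exists>r :: real. 0 \<le> r \<and> r \<le> 1 \<and> j z = Some (of_real r)}"

definition sk_vertices :: "(P1 \<Rightarrow> P1) \<Rightarrow> P1 set" where
  "sk_vertices j = {z \<in> skeleton j. j z = Some 0}"

text \<open>Edges, without the vertices they are attached to. The free end of a hanging edge belongs to the
  edge.\<close>

definition sk_edges :: "(P1 \<Rightarrow> P1) \<Rightarrow> P1 set set" where
  "sk_edges j = connected_components_of (subtopology P1_top (skeleton j - sk_vertices j))"

text \<open>An edge attached to a vertex at both ends has one point over \<open>1\<close>, which cuts it into two halves;
  a hanging edge loses only its free end and remains in one piece. These pieces, the components of
  the preimage of the open interval \<open>(0, 1)\<close>, represent the edge ends attached to vertices. In
  particular a loop has two of them, attached to the same vertex.\<close>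

definition sk_ends :: "(P1 \<Rightarrow> P1) \<Rightarrow> P1 set set" where
  "sk_ends j = connected_components_of
     (subtopology P1_top (skeleton j - sk_vertices j - {z. j z = Some 1}))"

definition ends_of_edge :: "(P1 \<Rightarrow> P1) \<Rightarrow> P1 set \<Rightarrow> P1 set set" where
  "ends_of_edge j e = {h \<in> sk_ends j. h \<subseteq> e}"

definition hanging_edge :: "(P1 \<Rightarrow> P1) \<Rightarrow> P1 set \<Rightarrow> bool" where
  "hanging_edge j e \<longleftrightarrow> e \<in> sk_edges j \<and> card (ends_of_edge j e) = 1"

definition ends_at :: "(P1 \<Rightarrow> P1) \<Rightarrow> P1 \<Rightarrow> P1 set set" where
  "ends_at j z = {h \<in> sk_ends j. z \<in> P1_top closure_of h}"

definition valency :: "(P1 \<Rightarrow> P1) \<Rightarrow> P1 \<Rightarrow> nat" where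
  "valency j z = card (ends_at j z)"


section \<open>Markings\<close>

text \<open>Unit tangent vector at \<open>z\<close> of an edge end, in the local coordinate at \<open>z\<close>.\<close>

definition end_direction :: "P1 \<Rightarrow> P1 set \<Rightarrow> complex" where
  "end_direction z h = Lim (at 0 within {u. P1_chart z u \<in> h}) sgn"

definition counterclockwise :: "complex \<Rightarrow> complex \<Rightarrow> complex \<Rightarrow> bool" where
  "counterclockwise d1 d2 d3 \<longleftrightarrow> 0 < Arg2pi (d2 / d1) \<and> Arg2pi (d2 / d1) < Arg2pi (d3 / d1)"

text \<open>A marking \<open>m\<close> assigns to a trivalent vertex \<open>z\<close> the edge ends \<open>m z 1\<close>, \<open>m z 2\<close>, \<open>m z 3\<close>. Other
  values of \<open>m\<close> are irrelevant.\<close>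

definition marking_at :: "(P1 \<Rightarrow> P1) \<Rightarrow> P1 \<Rightarrow> (nat \<Rightarrow> P1 set) \<Rightarrow> bool" where
  "marking_at j z e \<longleftrightarrow>
     bij_betw e {1, 2, 3} (ends_at j z) \<and>
     counterclockwise (end_direction z (e 1)) (end_direction z (e 2)) (end_direction z (e 3))"

definition marking :: "(P1 \<Rightarrow> P1) \<Rightarrow> (P1 \<Rightarrow> nat \<Rightarrow> P1 set) \<Rightarrow> bool" where
  "marking j m \<longleftrightarrow> (\<forall>z \<in> sk_vertices j. valency j z = 3 \<longrightarrow> marking_at j z (m z))"

definition end_has_index ::
    "(P1 \<Rightarrow> P1) \<Rightarrow> (P1 \<Rightarrow> nat \<Rightarrow> P1 set) \<Rightarrow> P1 set \<Rightarrow> nat \<Rightarrow> bool" where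
  "end_has_index j m h i \<longleftrightarrow>
     (\<exists>z \<in> sk_vertices j. valency j z = 3 \<and> h \<in> ends_at j z \<and> i \<in> {1, 2, 3} \<and> m z i = h)"

definition hanging_edge_has_index ::
    "(P1 \<Rightarrow> P1) \<Rightarrow> (P1 \<Rightarrow> nat \<Rightarrow> P1 set) \<Rightarrow> P1 set \<Rightarrow> nat \<Rightarrow> bool" where
  "hanging_edge_has_index j m e i \<longleftrightarrow> (\<exists>h. ends_of_edge j e = {h} \<and> end_has_index j m h i)"

definition edge_has_indices ::
    "(P1 \<Rightarrow> P1) \<Rightarrow> (P1 \<Rightarrow> nat \<Rightarrow> P1 set) \<Rightarrow> P1 set \<Rightarrow> nat \<times> nat \<Rightarrow> bool" where
  "edge_has_indices j m e = (\<lambda>(i, i').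
     \<exists>h h'. h \<noteq> h' \<and> ends_of_edge j e = {h, h'} \<and>
            end_has_index j m h i \<and> end_has_index j m h' i')"

end

theory Submission
  imports Defs "HOL-Computational_Algebra.Polynomial_Factorial" "HOL-Computational_Algebra.Field_as_Ring"
begin

text \<open>In the coordinate \<open>y = x * g2 / g3\<close> the Weierstrass equation depends on \<open>j\<close> only: it reads
  \<open>j = 4 * y ^ 3 / ((y - 3) * (2 * y + 3)\<^sup>2)\<close>. Hence the curve is reducible if and only if \<open>j\<close> factors
  through this map of degree 3, whose skeleton has one trivalent vertex \<open>y = 0\<close>, a hanging edge
  ending at \<open>y = - 1\<close> and a loop through \<open>y = \<infinity>\<close>. Number the three branches of \<open>y\<close> over \<open>(0, 1)\<close> so that
  the hanging edge is 1. Turning around \<open>j = 0\<close> permutes them cyclically, and turning around \<open>j = 1\<close>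
  fixes 1 and exchanges 2 and 3. A factorisation labels every edge end of the skeleton by a branch,
  and the compatibility with the turns is the condition on markings; at a vertex of valency 1 or 2
  no label survives a full turn. Conversely, a compatible labelling says which branch of \<open>y\<close> to
  compose with \<open>j\<close> on the preimages of slit planes. The pieces fit together to a holomorphic
  function off a finite set that satisfies the Weierstrass equation; by Riemann's and Liouville's
  theorems it is a polynomial.\<close>

text \<open>The labelling has to carry the whole monodromy of \<open>j\<close> over the plane
  without 0 and 1, and this is organized without loops. That plane is covered by three simply
  connected slit planes: the non-real numbers together with one of the intervals below 0, between 0
  and 1, above 1. Over each of them \<open>j\<close> has a sheet through every point of the
  preimage, and any two slit planes meet in the upper and the lower half plane. Sheets over the
  middle slit plane correspond to edge ends, so a label of an edge end chooses a branch on a sheet,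
  and gluing across the outer intervals is one turn around 0 or 1. The turn around infinity imposes
  nothing more, being composed of the other two.

  The combinatorial part uses only local normal forms of \<open>j\<close> (locale
  \<open>dessin\<close>), and points over 1 are treated as the vertices of \<open>1 - j\<close>. The
  glued \<open>y\<close> can have poles; the polynomial comes from \<open>x\<close>, which satisfies
  a monic equation and is therefore bounded by the coefficients.\<close>

section \<open>Topology and charts of the projective line\<close>

lemma topspace_P1 [simp]: "topspace P1_top = UNIV"
  by (auto simp: P1_top_def) (metis insertCI not_Some_eq rangeI)

lemma compact_space_P1: "compact_space P1_top"
  by (simp add: P1_top_def)

lemma Hausdorff_space_P1: "Hausdorff_space P1_top"
  by (simp add: P1_top_def Hausdorff_space_Alexandroff_compactification
      locally_compact_space_euclidean Hausdorff_space_euclidean)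

text \<open>Neighbourhoods of infinity are complements of compact sets; once the finite part is
  open, this means containing the exterior of a disc. Openness thereby becomes an estimate in the
  coordinate \<open>t\<close>.\<close>

lemma openin_P1:
  "openin P1_top U \<longleftrightarrow>
     open {t. Some t \<in> U} \<and> (None \<in> U \<longrightarrow> (\<exists>R. \<forall>t. norm t > R \<longrightarrow> Some t \<in> U))"
  (is "?L \<longleftrightarrow> ?R")
proof
  assume ?L
  then consider V where "open V" "U = Some ` V"
    | C where "compact C" "U = insert None (Some ` (- C))"
    unfolding P1_top_def openin_Alexandroff_compactification
    by (auto simp: Compl_eq_Diff_UNIV)
  then show ?R
  proof cases
    case 1
    then have "{t. Some t \<in> U} = V" by auto
    with 1 show ?thesis by auto
  next
    case 2
    then have eq: "{t. Some t \<in> U} = - C" by auto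
    obtain R where "\<And>t. t \<in> C \<Longrightarrow> norm t \<le> R"
      using compact_imp_bounded[OF 2(1)] unfolding bounded_iff by auto
    then have "\<forall>t. norm t > R \<longrightarrow> Some t \<in> U"
      using 2 by force
    with 2 show ?thesis
      unfolding eq by (auto simp: open_Compl compact_imp_closed)
  qed
next
  assume R: ?R
  show ?L
  proof (cases "None \<in> U")
    case False
    then have "U = Some ` {t. Some t \<in> U}"
      by (auto simp: image_iff) (metis not_Some_eq)
    with R show ?thesis
      unfolding P1_top_def openin_Alexandroff_compactification by auto
  next
    case True
    then obtain R where R': "\<And>t. norm t > R \<Longrightarrow> Some t \<in> U" using R by auto
    let ?C = "- {t. Some t \<in> U}"
    have "?C \<subseteq> cball 0 R" using R' by force
    then have "compact ?C"
      using R by (metis bounded_cball bounded_subset closed_Compl compact_eq_bounded_closed)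
    moreover have "U = insert None (Some ` (- ?C))"
      using True by (auto simp: image_iff) (metis not_Some_eq)
    ultimately show ?thesis
      unfolding P1_top_def openin_Alexandroff_compactification
      by (intro disjI2 exI[of _ ?C]) (auto simp: compact_imp_closed Compl_eq_Diff_UNIV)
  qed
qed

text \<open>The chart at infinity belonging to the coordinate \<open>t - a\<close>. For
  \<open>a = 0\<close> it is the chart of \<open>None\<close>; a general \<open>a\<close>
  parametrizes the complement of a finite point, which is required when the pole of \<open>j\<close>
  to be deleted is finite.\<close>

definition shifted_inverse :: "complex \<Rightarrow> complex \<Rightarrow> P1" where
  "shifted_inverse a u = (if u = 0 then None else Some (a + 1 / u))"

lemma inj_shifted_inverse: "inj (shifted_inverse a)"
  by (rule injI) (auto simp: shifted_inverse_def split: if_splits)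

lemma range_shifted_inverse: "range (shifted_inverse a) = UNIV - {Some a}"
proof -
  have "z \<in> range (shifted_inverse a)" if "z \<noteq> Some a" for z
  proof (cases z)
    case None
    then show ?thesis by (auto simp: shifted_inverse_def intro!: image_eqI[of _ _ 0])
  next
    case (Some t)
    then have "z = shifted_inverse a (1 / (t - a))" using that by (auto simp: shifted_inverse_def)
    then show ?thesis by blast
  qed
  then show ?thesis by (auto simp: shifted_inverse_def split: if_splits)
qed

lemma open_nonzero_preimage:
  fixes f :: "complex \<Rightarrow> complex"
  assumes "open V" "continuous_on (- {a}) f"
  shows "open {u. u \<noteq> a \<and> f u \<in> V}"
proof -
  have "open (f -` V \<inter> (- {a}))"
    by (rule continuous_open_preimage[OF assms(2) _ assms(1), of, simplified Int_commute]) auto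
  moreover have "f -` V \<inter> (- {a}) = {u. u \<noteq> a \<and> f u \<in> V}" by auto
  ultimately show ?thesis by simp
qed

lemma continuous_shifted_inverse: "continuous_map euclidean P1_top (shifted_inverse a)"
proof (simp add: continuous_map_def, intro allI impI)
  fix U assume U: "openin P1_top U"
  let ?V = "{t. Some t \<in> U}"
  have V: "open ?V" using U by (simp add: openin_P1)
  have 1: "open {u. u \<noteq> 0 \<and> a + 1 / u \<in> ?V}"
    by (rule open_nonzero_preimage[OF V]) (auto intro!: continuous_intros)
  show "open {u. shifted_inverse a u \<in> U}"
  proof (cases "None \<in> U")
    case False
    then have "{u. shifted_inverse a u \<in> U} = {u. u \<noteq> 0 \<and> a + 1 / u \<in> ?V}"
      by (auto simp: shifted_inverse_def split: if_splits)
    with 1 show ?thesis by simp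
  next
    case True
    then obtain R where R: "\<And>t. norm t > R \<Longrightarrow> Some t \<in> U" using U by (auto simp: openin_P1)
    \<comment> \<open>If \<open>norm (1 / u)\<close> exceeds \<open>M\<close>, then
      \<open>a + 1 / u\<close> still has norm above \<open>R\<close>; the absolute value and the
      summand 1 make \<open>M\<close> positive.\<close>
    define M where "M = \<bar>R\<bar> + norm a + 1"
    have M: "M > 0" by (simp add: M_def add_nonneg_pos)
    have B: "shifted_inverse a u \<in> U" if "u \<in> ball 0 (1 / M)" for u
    proof (cases "u = 0")
      case False
      have "norm u < 1 / M" using that by simp
      then have "1 / norm u > M" using M False
        by (simp add: field_simps)
      then have "norm (1 / u) > M" by (simp add: norm_divide)
      moreover have "norm (1/u) \<le> norm (a + 1/u) + norm a"
        by (metis add_diff_cancel_left' add.commute norm_triangle_ineq4)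
      ultimately have "norm (a + 1 / u) > R" by (simp add: M_def)
      then show ?thesis using R False by (simp add: shifted_inverse_def)
    qed (use True in \<open>simp add: shifted_inverse_def\<close>)
    have "u \<in> {u. shifted_inverse a u \<in> U} \<longleftrightarrow>
        u \<in> {u. u \<noteq> 0 \<and> a + 1 / u \<in> ?V} \<union> ball 0 (1 / M)" for u
    proof (cases "u = 0")
      case True
      then show ?thesis using B[of 0] M by simp
    next
      case False
      then show ?thesis using B[of u] by (auto simp: shifted_inverse_def)
    qed
    then have "{u. shifted_inverse a u \<in> U} = {u. u \<noteq> 0 \<and> a + 1 / u \<in> ?V} \<union> ball 0 (1 / M)"
      by blast
    with 1 show ?thesis by auto
  qed
qed

lemma openin_shifted_inverse_image:
  assumes V: "open V"
  shows "openin P1_top (shifted_inverse a ` V)"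
  unfolding openin_P1
proof (intro conjI impI)
  have eq: "{t. Some t \<in> shifted_inverse a ` V} = {t. t \<noteq> a \<and> 1 / (t - a) \<in> V}"
  proof (intro set_eqI iffI)
    fix t assume "t \<in> {t. Some t \<in> shifted_inverse a ` V}"
    then show "t \<in> {t. t \<noteq> a \<and> 1 / (t - a) \<in> V}"
      by (auto simp: shifted_inverse_def split: if_splits)
  next
    fix t assume "t \<in> {t. t \<noteq> a \<and> 1 / (t - a) \<in> V}"
    then show "t \<in> {t. Some t \<in> shifted_inverse a ` V}"
      by (auto simp: shifted_inverse_def intro!: image_eqI[of _ _ "1 / (t - a)"])
  qed
  show "open {t. Some t \<in> shifted_inverse a ` V}"
    unfolding eq by (rule open_nonzero_preimage[OF V]) (auto intro!: continuous_intros)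
  assume "None \<in> shifted_inverse a ` V"
  then have "0 \<in> V" by (auto simp: shifted_inverse_def split: if_splits)
  then obtain e where e: "e > 0" "ball 0 e \<subseteq> V" using V open_contains_ball by blast
  have "Some t \<in> shifted_inverse a ` V" if "norm t > norm a + 1 / e" for t
  proof -
    have "norm (t - a) \<ge> norm t - norm a" by (rule norm_triangle_ineq2)
    then have n: "norm (t - a) > 1 / e" using that by simp
    then have "norm (t - a) > 0" using e(1) by (smt (verit) divide_pos_pos)
    then have ne: "t \<noteq> a" by auto
    have "norm (1 / (t - a)) < e"
      using n e(1) \<open>norm (t - a) > 0\<close> by (simp add: norm_divide field_simps)
    then have "1 / (t - a) \<in> V" using e(2) by auto
    then show ?thesis using ne eq by blast
  qed
  then show "\<exists>R. \<forall>t. norm t > R \<longrightarrow> Some t \<in> shifted_inverse a ` V" by blast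
qed

lemma P1_chart_None: "P1_chart None = shifted_inverse 0"
  by (auto simp: fun_eq_iff P1_chart_def P1_inverse_def shifted_inverse_def)

lemma P1_chart_Some: "P1_chart (Some a) = (\<lambda>u. Some (a + u))"
  by (auto simp: fun_eq_iff P1_chart_def)

lemma P1_chart_0 [simp]: "P1_chart z 0 = z"
  by (cases z) (auto simp: P1_chart_def P1_inverse_def)

lemma inj_P1_chart: "inj (P1_chart z)"
  by (cases z) (use inj_shifted_inverse in \<open>auto simp: P1_chart_None P1_chart_Some inj_def\<close>)

lemma continuous_P1_chart: "continuous_map euclidean P1_top (P1_chart z)"
proof (cases z)
  case (Some a)
  have "continuous_map euclidean P1_top (Some \<circ> (\<lambda>u. a + u))"
    unfolding P1_top_def
    by (rule continuous_map_compose[OF _ continuous_map_Some]) (auto intro!: continuous_intros)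
  then show ?thesis by (simp add: Some P1_chart_Some comp_def)
qed (simp add: P1_chart_None continuous_shifted_inverse)

lemma openin_P1_chart_image:
  assumes "open V"
  shows "openin P1_top (P1_chart z ` V)"
proof (cases z)
  case (Some a)
  have "P1_chart z ` V = Some ` ((+) a ` V)" by (auto simp: Some P1_chart_Some)
  moreover have "open ((+) a ` V)" using assms by (rule open_translation)
  ultimately show ?thesis by (auto simp: P1_top_def)
qed (use assms in \<open>simp add: P1_chart_None openin_shifted_inverse_image\<close>)

text \<open>In a partition into open sets each piece is also closed, so a connected piece cannot be
  a proper part of a component. Both the edges and the edge ends of the skeleton are determined in
  this way.\<close>

lemma connected_components_of_open_partition:
  assumes F: "\<Union>F = topspace X" "pairwise disjnt F"
    and each: "\<And>A. A \<in> F \<Longrightarrow> A \<noteq> {} \<and> connectedin X A \<and> openin X A"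
  shows "connected_components_of X = F"
proof -
  have comp: "connected_component_of_set X x = A" if A: "A \<in> F" and x: "x \<in> A" for A x
  proof
    show "A \<subseteq> connected_component_of_set X x"
      using each[OF A] x by (simp add: connected_component_of_maximal)
    have "B \<inter> A = {}" if "B \<in> F - {A}" for B
      using F(2) A that unfolding pairwise_def disjnt_def by simp
    then have "topspace X - A = \<Union>(F - {A})"
      unfolding F(1)[symmetric] by auto
    moreover have "openin X (\<Union>(F - {A}))" using each by blast
    ultimately have "closedin X A"
      using each[OF A] by (simp add: closedin_def openin_subset)
    then show "connected_component_of_set X x \<subseteq> A"
      using connectedin_clopen_cases[OF connectedin_connected_component_of[of X x], of A]
        each[OF A] x \<open>A \<subseteq> _\<close> by (auto simp: disjnt_def)
  qed
  show ?thesis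
    unfolding connected_components_of_def
  proof safe
    fix x assume "x \<in> topspace X"
    then obtain A where "A \<in> F" "x \<in> A" using F by auto
    then show "connected_component_of_set X x \<in> F" using comp by simp
  next
    fix A assume A: "A \<in> F"
    then obtain x where x: "x \<in> A" using each by blast
    then have "x \<in> topspace X" using A F by blast
    then show "A \<in> connected_component_of_set X ` topspace X"
      using comp[OF A x] by blast
  qed
qed

section \<open>Slit planes\<close>

text \<open>The three slit planes are the non-real numbers with one of the three open intervals cut
  out by 0 and 1 put back. They cover the plane without 0 and 1, and any two of them share only the
  non-real numbers.\<close>

definition slit_mid :: "complex set" where
  "slit_mid = {w. Im w \<noteq> 0 \<or> 0 < Re w \<and> Re w < 1}"

definition slit_neg :: "complex set" where
  "slit_neg = {w. Im w \<noteq> 0 \<or> Re w < 0}"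

definition slit_pos :: "complex set" where
  "slit_pos = {w. Im w \<noteq> 0 \<or> Re w > 1}"

lemmas slit_defs = slit_mid_def slit_neg_def slit_pos_def

text \<open>Along the segment the imaginary part is a multiple of \<open>Im x\<close>: either it
  vanishes only at the real centre, or the segment is real and the convexity of the interval
  applies.\<close>

lemma segment_slit:
  assumes x: "x \<in> {w. Im w \<noteq> 0 \<or> P (Re w)}" and a: "P a" and cv: "convex {r. P r}"
  shows "closed_segment (of_real a) x \<subseteq> {w. Im w \<noteq> 0 \<or> P (Re w)}"
proof
  fix y assume "y \<in> closed_segment (of_real a) x"
  then obtain u where u: "0 \<le> u" "u \<le> 1" "y = (1 - u) *\<^sub>R of_real a + u *\<^sub>R x"
    by (auto simp: closed_segment_def)
  then have Im: "Im y = u * Im x" and Re: "Re y = (1 - u) * a + u * Re x" by auto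
  show "y \<in> {w. Im w \<noteq> 0 \<or> P (Re w)}"
  proof (cases "Im x = 0")
    case True
    then have "P (Re x)" using x by simp
    then have "(1 - u) *\<^sub>R a + u *\<^sub>R Re x \<in> {r. P r}"
      using convexD_alt[OF cv, of a "Re x" u] a u by simp
    then show ?thesis by (simp add: Re)
  next
    case False
    then show ?thesis using Im Re a by (cases "u = 0") auto
  qed
qed

lemma segment_slit_mid: "x \<in> slit_mid \<Longrightarrow> 0 < a \<Longrightarrow> a < 1 \<Longrightarrow> closed_segment (of_real a) x \<subseteq> slit_mid"
  unfolding slit_mid_def
  using segment_slit[of x "\<lambda>r. 0 < r \<and> r < 1" a] convex_real_interval(8)[of 0 1]
  by (simp add: greaterThanLessThan_def greaterThan_def lessThan_def Collect_conj_eq[symmetric])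

lemma segment_slit_neg: "x \<in> slit_neg \<Longrightarrow> a < 0 \<Longrightarrow> closed_segment (of_real a) x \<subseteq> slit_neg"
  unfolding slit_neg_def
  using segment_slit[of x "\<lambda>r. r < 0" a] convex_real_interval(4)[of 0]
  by (simp add: lessThan_def)

lemma segment_slit_pos: "x \<in> slit_pos \<Longrightarrow> 1 < a \<Longrightarrow> closed_segment (of_real a) x \<subseteq> slit_pos"
  unfolding slit_pos_def
  using segment_slit[of x "\<lambda>r. r > 1" a] convex_real_interval(3)[of 1]
  by (simp add: greaterThan_def)

text \<open>The bound \<open>r \<le> 1\<close> keeps the star centre \<open>r / 2\<close> inside the
  interval from 0 to 1.\<close>

lemma connected_slit_mid_ball:
  assumes "0 < r" "r \<le> 1"
  shows "connected (slit_mid \<inter> ball 0 r)"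
proof (rule starlike_imp_connected)
  have h: "of_real (r / 2) \<in> ball (0::complex) r" using assms by simp
  have m: "of_real (r / 2) \<in> slit_mid" using assms by (simp add: slit_mid_def)
  have "closed_segment (of_real (r / 2)) x \<subseteq> slit_mid \<inter> ball 0 r" if "x \<in> slit_mid \<inter> ball 0 r" for x
    using segment_slit_mid[of x "r / 2"] closed_segment_subset[OF h, of x] that assms by auto
  then show "starlike (slit_mid \<inter> ball 0 r)"
    unfolding starlike_def using h m by blast
qed

lemma connected_slit_neg_ball:
  assumes "0 < r"
  shows "connected (slit_neg \<inter> ball 0 r)"
proof (rule starlike_imp_connected)
  have h: "of_real (- r / 2) \<in> ball (0::complex) r" using assms by simp
  have m: "of_real (- r / 2) \<in> slit_neg" using assms by (simp add: slit_neg_def)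
  have "closed_segment (of_real (- r / 2)) x \<subseteq> slit_neg \<inter> ball 0 r" if "x \<in> slit_neg \<inter> ball 0 r" for x
    using segment_slit_neg[of x "- r / 2"] closed_segment_subset[OF h, of x] that assms by auto
  then show "starlike (slit_neg \<inter> ball 0 r)"
    unfolding starlike_def using h m by blast
qed

definition slit_domain :: "complex set \<Rightarrow> bool" where
  "slit_domain \<Omega> \<longleftrightarrow> \<Omega> \<in> {slit_mid, slit_neg, slit_pos}"

lemma slit_domain_simps [simp]:
  "slit_domain slit_mid" "slit_domain slit_neg" "slit_domain slit_pos"
  by (auto simp: slit_domain_def)

lemma starlike_slit: assumes "slit_domain \<Omega>" shows "starlike \<Omega>"
proof -
  have "starlike slit_mid"
    unfolding starlike_def
    by (rule bexI[of _ "of_real (1/2)"]) (use segment_slit_mid[of _ "1/2"] in \<open>auto simp: slit_mid_def\<close>)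
  moreover have "starlike slit_neg"
    unfolding starlike_def
    by (rule bexI[of _ "of_real (-1)"]) (use segment_slit_neg[of _ "-1"] in \<open>auto simp: slit_neg_def\<close>)
  moreover have "starlike slit_pos"
    unfolding starlike_def
    by (rule bexI[of _ "of_real 2"]) (use segment_slit_pos[of _ 2] in \<open>auto simp: slit_pos_def\<close>)
  ultimately show ?thesis using assms by (auto simp: slit_domain_def)
qed

lemma open_slit: assumes "slit_domain \<Omega>" shows "open \<Omega>"
proof -
  have "open slit_mid" "open slit_neg" "open slit_pos" unfolding slit_defs
    by (intro open_Collect_disj open_Collect_conj open_Collect_neq open_Collect_less continuous_intros)+
  then show ?thesis using assms by (auto simp: slit_domain_def)
qed

lemma slit_avoids: assumes "slit_domain \<Omega>" shows "0 \<notin> \<Omega>" "1 \<notin> \<Omega>"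
  using assms by (auto simp: slit_domain_def slit_defs)

definition upper_half :: "complex set" where "upper_half = {w. Im w > 0}"
definition lower_half :: "complex set" where "lower_half = {w. Im w < 0}"

lemma half_plane_props:
  "open upper_half" "open lower_half" "connected upper_half" "connected lower_half"
  unfolding upper_half_def lower_half_def
  by (auto intro!: convex_connected convex_halfspace_Im_gt convex_halfspace_Im_lt
        open_halfspace_Im_gt open_halfspace_Im_lt)

lemma half_plane_slit:
  assumes "slit_domain \<Omega>"
  shows "upper_half \<subseteq> \<Omega>" "lower_half \<subseteq> \<Omega>"
  using assms by (auto simp: slit_domain_def slit_defs upper_half_def lower_half_def)

section \<open>Sections of a branched covering\<close>

definition is_section :: "(P1 \<Rightarrow> P1) \<Rightarrow> complex set \<Rightarrow> (complex \<Rightarrow> P1) \<Rightarrow> bool" where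
  "is_section j \<Omega> s \<longleftrightarrow> continuous_map (top_of_set \<Omega>) P1_top s \<and> (\<forall>w\<in>\<Omega>. j (s w) = Some w)"

lemma is_section_subset: "is_section j \<Omega> s \<Longrightarrow> \<Omega>' \<subseteq> \<Omega> \<Longrightarrow> is_section j \<Omega>' s"
  unfolding is_section_def by (meson continuous_map_from_subtopology_mono subset_iff)

text \<open>\<open>\<eta>\<close> goes from a normal coordinate \<open>x\<close>, in which
  \<open>j - v\<close> is the \<open>n\<close>-th power, to the chart at \<open>z\<close>. In this
  direction branches of the inverse of \<open>j\<close> are obtained by inserting
  \<open>n\<close>-th roots for \<open>x\<close>.\<close>

definition local_param :: "(P1 \<Rightarrow> P1) \<Rightarrow> P1 \<Rightarrow> complex \<Rightarrow> nat \<Rightarrow> real \<Rightarrow> (complex \<Rightarrow> complex) \<Rightarrow> bool" where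
  "local_param j z v n \<rho> \<eta> \<longleftrightarrow> \<rho> > 0 \<and> \<eta> holomorphic_on ball 0 \<rho> \<and> inj_on \<eta> (ball 0 \<rho>) \<and> \<eta> 0 = 0 \<and>
     (\<forall>x\<in>ball 0 \<rho>. j (P1_chart z (\<eta> x)) = Some (v + x ^ n))"

lemma local_param_shrink:
  assumes "local_param j z v n \<rho> \<eta>" "0 < \<rho>'" "\<rho>' \<le> \<rho>"
  shows "local_param j z v n \<rho>' \<eta>"
proof -
  have "ball 0 \<rho>' \<subseteq> ball (0::complex) \<rho>" using assms by auto
  then show ?thesis
    using assms unfolding local_param_def
    by (auto intro: holomorphic_on_subset inj_on_subset)
qed

lemma local_param_continuous:
  assumes "local_param j z v n \<rho> \<eta>"
  shows "continuous_map (top_of_set (ball 0 \<rho>)) P1_top (\<lambda>x. P1_chart z (\<eta> x))"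
proof -
  have "continuous_map (top_of_set (ball 0 \<rho>)) euclidean \<eta>"
    using assms by (simp add: local_param_def holomorphic_on_imp_continuous_on)
  from continuous_map_compose[OF this continuous_P1_chart] show ?thesis by (simp add: comp_def)
qed

lemma local_param_inj:
  assumes "local_param j z v n \<rho> \<eta>" "x \<in> ball 0 \<rho>" "y \<in> ball 0 \<rho>"
    "P1_chart z (\<eta> x) = P1_chart z (\<eta> y)"
  shows "x = y"
  using assms inj_P1_chart[of z] unfolding local_param_def by (metis injD inj_onD)

lemma local_param_open:
  assumes "local_param j z v n \<rho> \<eta>" "open V" "V \<subseteq> ball 0 \<rho>"
  shows "openin P1_top ((\<lambda>x. P1_chart z (\<eta> x)) ` V)"
proof -
  have "open (\<eta> ` V)"
    using assms unfolding local_param_def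
    by (intro open_mapping_thm3) (auto intro: holomorphic_on_subset inj_on_subset)
  from openin_P1_chart_image[OF this, of z] show ?thesis by (simp add: image_image)
qed

lemma local_param_j:
  "local_param j z v n \<rho> \<eta> \<Longrightarrow> x \<in> ball 0 \<rho> \<Longrightarrow> j (P1_chart z (\<eta> x)) = Some (v + x ^ n)"
  "local_param j z v n \<rho> \<eta> \<Longrightarrow> \<rho> > 0"
  "local_param j z v n \<rho> \<eta> \<Longrightarrow> \<eta> 0 = 0"
  by (auto simp: local_param_def)

section \<open>Coverings branched over 0, 1 and infinity\<close>

text \<open>The properties of the j-invariant on which the skeleton depends: finite fibres and power
  maps as normal forms over finite values, unramified away from 0 and 1. At the poles only
  continuity is asked. The normal coordinates are holomorphic because tangent directions of edge
  ends are compared later.\<close>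

locale dessin =
  fixes j :: "P1 \<Rightarrow> P1" and ram :: "P1 \<Rightarrow> nat"
  assumes cont: "continuous_map P1_top P1_top j"
    and fin: "finite {z. j z = Some v}"
    and ram_pos: "j z = Some v \<Longrightarrow> ram z \<ge> 1"
    and param_ex: "j z = Some v \<Longrightarrow> \<exists>\<rho> \<eta>. local_param j z v (ram z) \<rho> \<eta>"
    and unram: "j z = Some v \<Longrightarrow> v \<notin> {0, 1} \<Longrightarrow> ram z = 1"
begin

text \<open>By compactness \<open>j\<close> is a closed map, so the image of the complement of
  \<open>N\<close> is closed; it misses \<open>v\<close> and hence a disc around it.\<close>

lemma tube:
  assumes N: "openin P1_top N" and sub: "{z. j z = Some v} \<subseteq> N"
  obtains \<epsilon> where "\<epsilon> > 0" "\<And>z w. j z = Some w \<Longrightarrow> dist w v < \<epsilon> \<Longrightarrow> z \<in> N"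
proof -
  have "closedin P1_top (UNIV - N)" using N by (simp add: closedin_def Diff_Diff_Int)
  then have "compactin P1_top (UNIV - N)"
    using compact_space_P1 closedin_compact_space by blast
  then have "compactin P1_top (j ` (UNIV - N))" using image_compactin cont by blast
  then have "closedin P1_top (j ` (UNIV - N))"
    using Hausdorff_space_P1 compactin_imp_closedin by blast
  then have "openin P1_top (UNIV - j ` (UNIV - N))" by (simp add: closedin_def)
  then have "open {t. Some t \<in> UNIV - j ` (UNIV - N)}" by (simp only: openin_P1)
  moreover have "v \<in> {t. Some t \<in> UNIV - j ` (UNIV - N)}" using sub by force
  ultimately obtain \<epsilon> where e: "\<epsilon> > 0" "ball v \<epsilon> \<subseteq> {t. Some t \<in> UNIV - j ` (UNIV - N)}"
    using open_contains_ball by blast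
  show ?thesis
  proof (rule that[OF e(1)])
    fix z w assume "j z = Some w" "dist w v < \<epsilon>"
    then have "Some w \<notin> j ` (UNIV - N)" using e(2) by (auto simp: dist_commute)
    then show "z \<in> N" using \<open>j z = Some w\<close> by force
  qed
qed

text \<open>Without a pole the range would be compact, and by the normal forms it would also be open
  in the plane. The pole is deleted in order to work in the complex plane.\<close>

lemma pole_exists: "\<exists>z. j z = None"
proof (rule ccontr)
  assume np: "\<not> ?thesis"
  let ?I = "{v. Some v \<in> range j}"
  have "compactin P1_top (range j)"
    using image_compactin[OF _ cont, of UNIV] compact_space_P1 by (simp add: compact_space_def)
  then have "closedin P1_top (range j)"
    using Hausdorff_space_P1 compactin_imp_closedin by blast
  then have op: "openin P1_top (UNIV - range j)" by (simp add: closedin_def)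
  have N: "None \<in> UNIV - range j"
  proof -
    have "j z \<noteq> None" for z using np by metis
    then show ?thesis by (metis DiffI UNIV_I rangeE)
  qed
  have 1: "open {t. Some t \<in> UNIV - range j}"
    by (rule conjunct1[OF op[unfolded openin_P1]])
  have 2: "\<exists>R. \<forall>t. norm t > R \<longrightarrow> Some t \<in> UNIV - range j"
    by (rule mp[OF conjunct2[OF op[unfolded openin_P1]] N])
  have "- ?I = {t. Some t \<in> UNIV - range j}" by auto
  with 1 have "closed ?I" by (metis closed_def)
  moreover have "open ?I"
    unfolding open_contains_ball
  proof
    fix v assume "v \<in> ?I"
    then obtain z where z: "j z = Some v" by auto
    obtain \<rho> \<eta> where lp: "local_param j z v (ram z) \<rho> \<eta>" using param_ex[OF z] by blast
    \<comment> \<open>The normal form covers the whole disc of radius \<open>\<rho> ^ ram z\<close>,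
      because every \<open>y - v\<close> in it has a \<open>ram z\<close>-th root of norm below
      \<open>\<rho>\<close>.\<close>
    have "y \<in> ?I" if y: "y \<in> ball v (\<rho> ^ ram z)" for y
    proof -
      obtain x where x: "y - v = x ^ ram z"
        using exists_complex_root[of "ram z" "y - v"] ram_pos[OF z] by auto
      have "norm x ^ ram z = norm (y - v)" by (simp add: x norm_power)
      then have "norm x ^ ram z < \<rho> ^ ram z" using y by (simp add: dist_norm norm_minus_commute)
      then have "norm x < \<rho>"
        by (rule power_less_imp_less_base) (use local_param_j(2)[OF lp] in simp)
      then have "j (P1_chart z (\<eta> x)) = Some (v + x ^ ram z)"
        by (intro local_param_j(1)[OF lp]) simp
      then have "j (P1_chart z (\<eta> x)) = Some y" using x by (simp add: algebra_simps)
      then have "Some y \<in> range j" by (rule range_eqI[OF sym])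
      then show ?thesis by simp
    qed
    then show "\<exists>e>0. ball v e \<subseteq> ?I" using local_param_j(2)[OF lp] by (intro exI[of _ "\<rho> ^ ram z"]) auto
  qed
  ultimately have clop: "?I = {} \<or> ?I = UNIV" using clopen[of ?I] by simp
  obtain v where "j (Some 0) = Some v" using np by (metis option.exhaust)
  then have "Some v \<in> range j" by (rule range_eqI[OF sym])
  with clop have "?I = UNIV" by (simp add: set_eq_iff) metis
  moreover obtain R where "\<forall>t. norm t > R \<longrightarrow> Some t \<notin> range j" using 2 by auto
  then have "Some (complex_of_real (\<bar>R\<bar> + 1)) \<notin> range j" by (simp del: of_real_add)
  then have "complex_of_real (\<bar>R\<bar> + 1) \<notin> ?I" by (simp del: of_real_add)
  ultimately show False by simp
qed

lemma unram_param:
  assumes "j p = Some w" "w \<notin> {0, 1}"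
  obtains \<rho> \<eta> where "local_param j p w 1 \<rho> \<eta>"
  using param_ex[OF assms(1)] unram[OF assms] by auto

text \<open>The set of agreement is closed because the projective line is Hausdorff, and open
  because \<open>j\<close> is injective near a point that does not lie over 0 or 1.\<close>

lemma section_unique:
  assumes s1: "is_section j \<Omega> s1" and s2: "is_section j \<Omega> s2"
    and \<Omega>: "connected \<Omega>" "0 \<notin> \<Omega>" "1 \<notin> \<Omega>"
    and w0: "w0 \<in> \<Omega>" "s1 w0 = s2 w0" and w: "w \<in> \<Omega>"
  shows "s1 w = s2 w"
proof -
  let ?X = "top_of_set \<Omega>"
  let ?A = "{x \<in> topspace ?X. s1 x = s2 x}"
  have c: "continuous_map ?X P1_top s1" "continuous_map ?X P1_top s2"
    using s1 s2 by (auto simp: is_section_def)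
  have closed: "closedin ?X ?A"
    by (rule closedin_continuous_maps_eq[OF Hausdorff_space_P1 c])
  have op: "openin ?X ?A"
  proof (subst openin_subopen, intro ballI)
    fix x assume x: "x \<in> ?A"
    then have x\<Omega>: "x \<in> \<Omega>" "s1 x = s2 x" by auto
    then have jx: "j (s1 x) = Some x" using s1 by (auto simp: is_section_def)
    have xn: "x \<notin> {0, 1}" using x\<Omega> \<Omega> by auto
    obtain \<rho> \<eta> where lp: "local_param j (s1 x) x 1 \<rho> \<eta>"
      using unram_param[OF jx xn] by blast
    let ?\<iota> = "\<lambda>y. P1_chart (s1 x) (\<eta> y)"
    let ?N = "?\<iota> ` ball 0 \<rho>"
    have N: "openin P1_top ?N" using local_param_open[OF lp] by auto
    have xN: "s1 x \<in> ?N"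
      by (rule image_eqI[of _ _ 0]) (use local_param_j[OF lp] in auto)
    let ?T = "{y \<in> topspace ?X. s1 y \<in> ?N} \<inter> {y \<in> topspace ?X. s2 y \<in> ?N}"
    have "openin ?X ?T"
      by (intro openin_Int openin_continuous_map_preimage[OF _ N] c)
    moreover have "x \<in> ?T" using xN x\<Omega> by simp
    moreover have "?T \<subseteq> ?A"
    proof
      fix y assume "y \<in> ?T"
      then have y: "y \<in> \<Omega>" "s1 y \<in> ?N" "s2 y \<in> ?N" by simp_all
      from y obtain a b where a: "a \<in> ball 0 \<rho>" "s1 y = ?\<iota> a" and b: "b \<in> ball 0 \<rho>" "s2 y = ?\<iota> b"
        by blast
      have "Some y = Some (x + a ^ 1)" "Some y = Some (x + b ^ 1)"
        using local_param_j(1)[OF lp a(1)] local_param_j(1)[OF lp b(1)] s1 s2 y(1) a b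
        by (auto simp: is_section_def)
      then have "a = b" by simp
      then show "y \<in> ?A" using a b y by simp
    qed
    ultimately show "\<exists>T. openin ?X T \<and> x \<in> T \<and> T \<subseteq> ?A" by blast
  qed
  have "?A = {} \<or> ?A = \<Omega>"
    using closed op \<Omega>(1) unfolding connected_clopen by blast
  then show ?thesis using w0 w by auto
qed

text \<open>Near each value a section agrees, by uniqueness, with the inverse of \<open>j\<close>
  given by the local parameter, whose image is open.\<close>

lemma section_openin:
  assumes s: "is_section j \<Omega> s" and \<Omega>: "open \<Omega>" "0 \<notin> \<Omega>" "1 \<notin> \<Omega>"
  shows "openin P1_top (s ` \<Omega>)"
proof (subst openin_subopen, intro ballI)
  fix p assume "p \<in> s ` \<Omega>"
  then obtain w where w: "w \<in> \<Omega>" "p = s w" by auto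
  have jp: "j p = Some w" using s w by (auto simp: is_section_def)
  have wn: "w \<notin> {0, 1}" using w \<Omega> by auto
  obtain \<rho> \<eta> where lp: "local_param j p w 1 \<rho> \<eta>"
    using unram_param[OF jp wn] by blast
  obtain \<epsilon> where \<epsilon>: "\<epsilon> > 0" "ball w \<epsilon> \<subseteq> \<Omega>" using \<Omega>(1) w(1) open_contains_ball by blast
  define r where "r = min \<rho> \<epsilon>"
  have r: "r > 0" "r \<le> \<rho>" "r \<le> \<epsilon>" using local_param_j(2)[OF lp] \<epsilon> by (auto simp: r_def)
  note lp' = local_param_shrink[OF lp r(1,2)]
  let ?\<iota> = "\<lambda>y. P1_chart p (\<eta> y)"
  have b: "ball w r \<subseteq> \<Omega>" using \<epsilon> r by (auto intro: less_le_trans)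
  have b01: "0 \<notin> ball w r" "1 \<notin> ball w r" using b \<Omega> by blast+
  have "is_section j (ball w r) (\<lambda>y. ?\<iota> (y - w))"
    unfolding is_section_def
  proof (intro conjI ballI)
    have "continuous_map (top_of_set (ball w r)) (top_of_set (ball 0 r)) (\<lambda>y. y - w)"
      by (auto simp: dist_norm norm_minus_commute intro!: continuous_intros)
    from continuous_map_compose[OF this local_param_continuous[OF lp']]
    show "continuous_map (top_of_set (ball w r)) P1_top (\<lambda>y. ?\<iota> (y - w))"
      by (simp add: comp_def)
    fix y assume "y \<in> ball w r"
    then show "j (?\<iota> (y - w)) = Some y"
      using local_param_j(1)[OF lp', of "y - w"] by (simp add: dist_norm norm_minus_commute)
  qed
  then have eq: "?\<iota> (y - w) = s y" if "y \<in> ball w r" for y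
    by (rule section_unique[OF _ is_section_subset[OF s b] connected_ball b01 _ _ that, of _ w])
      (use r w local_param_j(3)[OF lp'] in auto)
  have "?\<iota> ` ball 0 r \<subseteq> s ` \<Omega>"
  proof
    fix q assume "q \<in> ?\<iota> ` ball 0 r"
    then obtain x where x: "x \<in> ball 0 r" "q = ?\<iota> x" by blast
    then have "w + x \<in> ball w r" by (simp add: dist_norm)
    then show "q \<in> s ` \<Omega>" using eq[of "w + x"] x b by auto
  qed
  moreover have "p \<in> ?\<iota> ` ball 0 r"
    by (rule image_eqI[of _ _ 0]) (use local_param_j(3)[OF lp'] r in auto)
  ultimately show "\<exists>T. openin P1_top T \<and> p \<in> T \<and> T \<subseteq> s ` \<Omega>"
    using local_param_open[OF lp', of "ball 0 r"] by auto
qed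

text \<open>The values taken form an open set by the local parameters; the omitted ones form an open
  set by \<open>tube\<close>, applied to an empty fibre with the empty neighbourhood.\<close>

lemma surjective_on:
  assumes "connected \<Omega>" "open \<Omega>" "p0 \<in> {p. j p \<in> Some ` \<Omega>}" "0 \<notin> \<Omega>" "1 \<notin> \<Omega>" "w \<in> \<Omega>"
  shows "\<exists>p. j p = Some w"
proof -
  let ?I = "{v \<in> \<Omega>. Some v \<in> range j}"
  have "openin (top_of_set \<Omega>) ?I"
    unfolding openin_contains_ball
  proof (intro conjI ballI)
    fix v assume "v \<in> ?I"
    then obtain z where z: "j z = Some v" and v: "v \<in> \<Omega>" by auto
    have vn: "v \<notin> {0, 1}" using v assms by auto
    obtain \<rho> \<eta> where lp: "local_param j z v 1 \<rho> \<eta>" using unram_param[OF z vn] by blast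
    have "y \<in> ?I" if y: "y \<in> ball v \<rho> \<inter> \<Omega>" for y
    proof -
      have "j (P1_chart z (\<eta> (y - v))) = Some y"
        using local_param_j(1)[OF lp, of "y - v"] y by (simp add: dist_norm norm_minus_commute)
      then have "Some y \<in> range j" by (rule range_eqI[OF sym])
      then show ?thesis using y by simp
    qed
    then show "\<exists>e>0. ball v e \<inter> \<Omega> \<subseteq> ?I" using local_param_j(2)[OF lp] by blast
  qed auto
  moreover have "openin (top_of_set \<Omega>) (\<Omega> - ?I)"
    unfolding openin_contains_ball
  proof (intro conjI ballI)
    fix v assume v: "v \<in> \<Omega> - ?I"
    then have "{z. j z = Some v} \<subseteq> {}" by (metis (mono_tags, lifting) Diff_iff mem_Collect_eq rangeI subsetI)
    from tube[OF openin_empty this] obtain \<epsilon>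
      where "\<epsilon> > 0" "\<And>z w. j z = Some w \<Longrightarrow> dist w v < \<epsilon> \<Longrightarrow> False" by (metis empty_iff)
    then have "ball v \<epsilon> \<inter> \<Omega> \<subseteq> \<Omega> - ?I" by (auto simp: dist_commute) (metis dist_commute)
    then show "\<exists>e>0. ball v e \<inter> \<Omega> \<subseteq> \<Omega> - ?I" using \<open>\<epsilon> > 0\<close> by blast
  qed auto
  then have "closedin (top_of_set \<Omega>) ?I" by (auto simp: closedin_def)
  ultimately have "?I = {} \<or> ?I = \<Omega>" using assms(1) connected_clopen by blast
  moreover obtain v0 where "v0 \<in> \<Omega>" "j p0 = Some v0" using assms(3) by auto
  then have "v0 \<in> ?I" by (metis (mono_tags, lifting) mem_Collect_eq rangeI)
  ultimately have "?I = \<Omega>" by blast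
  then have "w \<in> ?I" using assms by simp
  then show ?thesis by auto
qed

text \<open>The library's lifting theorem for covering spaces needs subsets of normed spaces, hence the
  passage from the projective line minus a pole to the complex plane.\<close>

lemma affine_param:
  obtains c and \<kappa> :: "complex \<Rightarrow> P1" where
    "j c = None" "inj \<kappa>" "range \<kappa> = UNIV - {c}" "continuous_map euclidean P1_top \<kappa>"
    "\<forall>V. open V \<longrightarrow> openin P1_top (\<kappa> ` V)"
proof -
  obtain c where c: "j c = None" using pole_exists by blast
  show ?thesis
  proof (cases c)
    case None
    have "range Some = UNIV - {None::P1}" by (auto simp: image_iff)
    moreover have "openin P1_top (Some ` V)" if "open V" for V
      using that by (simp add: P1_top_def)
    moreover have "continuous_map euclidean P1_top Some"
      unfolding P1_top_def by (rule continuous_map_Some)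
    ultimately show ?thesis using c None by (intro that[of c Some]) auto
  next
    case (Some a)
    show ?thesis
      using c Some continuous_shifted_inverse openin_shifted_inverse_image
        range_shifted_inverse inj_shifted_inverse
      by (intro that[of c "shifted_inverse a"]) auto
  qed
qed

text \<open>Over \<open>\<Omega>\<close> the map \<open>j\<close> is a covering: the local
  parameters at the points of a fibre give sheets over a small disc, and by \<open>tube\<close>
  these sheets exhaust the preimage of a smaller disc. Since \<open>\<Omega>\<close> is simply
  connected, its identity map lifts.\<close>

lemma lift_exists:
  assumes \<Omega>: "open \<Omega>" "simply_connected \<Omega>" "0 \<notin> \<Omega>" "1 \<notin> \<Omega>"
    and p: "j p = Some w0" "w0 \<in> \<Omega>"
  shows "\<exists>s. is_section j \<Omega> s \<and> s w0 = p"
proof -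
  have conn: "connected \<Omega>" using \<Omega>(2) by (rule simply_connected_imp_connected)
  obtain c and \<kappa> :: "complex \<Rightarrow> P1" where c: "j c = None" and inj: "inj \<kappa>" and rng: "range \<kappa> = UNIV - {c}"
    and cont\<kappa>: "continuous_map euclidean P1_top \<kappa>"
    and op\<kappa>: "\<forall>V. open V \<longrightarrow> openin P1_top (\<kappa> ` V)"
    by (rule affine_param)
  define T where "T = {u. j (\<kappa> u) \<in> Some ` \<Omega>}"
  define J where "J u = the (j (\<kappa> u))" for u
  have J: "j (\<kappa> u) = Some (J u)" "J u \<in> \<Omega>" if "u \<in> T" for u using that by (auto simp: T_def J_def)
  have JI: "u \<in> T \<and> J u = w" if "j (\<kappa> u) = Some w" "w \<in> \<Omega>" for u w
    using that by (auto simp: T_def J_def)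
  have fin_in: "\<exists>u. \<kappa> u = q" if "j q = Some w" for q w
  proof -
    have "q \<in> range \<kappa>" using that c rng by auto
    then show ?thesis by auto
  qed
  have inv: "inv \<kappa> (\<kappa> u) = u" for u using inj by simp
  have opJ: "open {u. j (\<kappa> u) \<in> Some ` V}" if "open V" for V
  proof -
    have "openin P1_top (Some ` V)" using that by (simp add: P1_top_def)
    from openin_continuous_map_preimage[OF continuous_map_compose[OF cont\<kappa> cont] this]
    show ?thesis by simp
  qed
  have T_open: "open T" unfolding T_def by (rule opJ[OF \<Omega>(1)])
  have contJ: "continuous_on T J"
    unfolding continuous_on_open_vimage[OF T_open]
  proof (intro allI impI)
    fix B :: "complex set" assume "open B"
    then have "open ({u. j (\<kappa> u) \<in> Some ` B} \<inter> T)" using opJ T_open by auto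
    moreover have "J -` B \<inter> T = {u. j (\<kappa> u) \<in> Some ` B} \<inter> T" using J by force
    ultimately show "open (J -` B \<inter> T)" by simp
  qed
  have cov: "covering_space T J \<Omega>"
  proof
    show "continuous_on T J" by (rule contJ)
    show "J ` T = \<Omega>"
    proof
      show "J ` T \<subseteq> \<Omega>" using J by auto
      show "\<Omega> \<subseteq> J ` T"
      proof
        fix w assume w: "w \<in> \<Omega>"
        then obtain q where q: "j q = Some w"
          using surjective_on[OF conn \<Omega>(1) _ \<Omega>(3,4), of p w] p by auto
        then obtain u where "\<kappa> u = q" using fin_in by blast
        then show "w \<in> J ` T" using JI[of u w] q w by force
      qed
    qed
    fix x assume x: "x \<in> \<Omega>"
    let ?F = "{q. j q = Some x}"
    have xn: "x \<notin> {0, 1}" using x \<Omega> by auto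
    have "\<forall>q\<in>?F. \<exists>P. local_param j q x 1 (fst P) (snd P)"
      using unram_param[OF _ xn] by (metis (mono_tags) fst_conv mem_Collect_eq snd_conv)
    then obtain P where P: "\<And>q. q \<in> ?F \<Longrightarrow> local_param j q x 1 (fst (P q)) (snd (P q))"
      by metis
    obtain \<epsilon>0 where e0: "\<epsilon>0 > 0" "ball x \<epsilon>0 \<subseteq> \<Omega>" using \<Omega>(1) x open_contains_ball by blast
    \<comment> \<open>A radius common to all local parameters over \<open>x\<close>, available
      because the fibre is finite; \<open>\<epsilon>0\<close> keeps the disc inside
      \<open>\<Omega>\<close>.\<close>
    define r where "r = Min (insert \<epsilon>0 ((\<lambda>q. fst (P q)) ` ?F))"
    have pos: "fst (P q) > 0" if "q \<in> ?F" for q by (rule local_param_j(2)[OF P[OF that]])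
    have r0: "r > 0" unfolding r_def
      using fin[of x] e0 pos by (subst Min_gr_iff) auto
    have re: "r \<le> \<epsilon>0" unfolding r_def using fin[of x] by (intro Min_le) auto
    have rq: "r \<le> fst (P q)" if "q \<in> ?F" for q
      unfolding r_def using fin[of x] that by (intro Min_le) auto
    define \<iota> where "\<iota> q y = P1_chart q (snd (P q) y)" for q y
    have lp: "local_param j q x 1 r (snd (P q))" if "q \<in> ?F" for q
      by (rule local_param_shrink[OF P[OF that] r0 rq[OF that]])
    have opN: "openin P1_top (\<Union>q\<in>?F. \<iota> q ` ball 0 r)"
      unfolding \<iota>_def by (intro openin_Union) (auto intro: local_param_open[OF lp])
    have subN: "?F \<subseteq> (\<Union>q\<in>?F. \<iota> q ` ball 0 r)"
    proof
      fix q assume q: "q \<in> ?F"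
      have "q \<in> \<iota> q ` ball 0 r"
        by (rule image_eqI[of _ _ 0]) (use local_param_j(3)[OF lp[OF q]] r0 in \<open>auto simp: \<iota>_def\<close>)
      then show "q \<in> (\<Union>q\<in>?F. \<iota> q ` ball 0 r)" using q by blast
    qed
    obtain \<epsilon>1 where e1: "\<epsilon>1 > 0"
      "\<And>z w. j z = Some w \<Longrightarrow> dist w x < \<epsilon>1 \<Longrightarrow> z \<in> (\<Union>q\<in>?F. \<iota> q ` ball 0 r)"
      using tube[OF opN subN] by blast
    define \<epsilon> where "\<epsilon> = min \<epsilon>1 r"
    have e: "\<epsilon> > 0" "\<epsilon> \<le> \<epsilon>1" "\<epsilon> \<le> r" using e1(1) r0 by (auto simp: \<epsilon>_def)
    have bO: "ball x \<epsilon> \<subseteq> \<Omega>" using e re e0 by (auto intro: less_le_trans)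
    have b01: "0 \<notin> ball x \<epsilon>" "1 \<notin> ball x \<epsilon>" using bO \<Omega> by blast+
    have lp': "local_param j q x 1 \<epsilon> (snd (P q))" if "q \<in> ?F" for q
      by (rule local_param_shrink[OF lp[OF that] e(1,3)])
    have j\<iota>: "j (\<iota> q y) = Some (x + y)" if "q \<in> ?F" "y \<in> ball 0 \<epsilon>" for q y
      using local_param_j(1)[OF lp'[OF that(1)] that(2)] by (simp add: \<iota>_def)
    have sec: "is_section j (ball x \<epsilon>) (\<lambda>w. \<iota> q (w - x))" if q: "q \<in> ?F" for q
      unfolding is_section_def
    proof (intro conjI ballI)
      have "continuous_map (top_of_set (ball x \<epsilon>)) (top_of_set (ball 0 \<epsilon>)) (\<lambda>y. y - x)"
        by (auto simp: dist_norm norm_minus_commute intro!: continuous_intros)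
      from continuous_map_compose[OF this local_param_continuous[OF lp'[OF q]]]
      show "continuous_map (top_of_set (ball x \<epsilon>)) P1_top (\<lambda>y. \<iota> q (y - x))"
        by (simp add: comp_def \<iota>_def)
      fix y assume "y \<in> ball x \<epsilon>"
      then show "j (\<iota> q (y - x)) = Some y"
        using j\<iota>[OF q, of "y - x"] by (simp add: dist_norm norm_minus_commute)
    qed
    define sh where "sh q = {u. \<kappa> u \<in> \<iota> q ` ball 0 \<epsilon>}" for q
    have sh_T: "u \<in> T \<and> J u \<in> ball x \<epsilon>" if q: "q \<in> ?F" and u: "u \<in> sh q" for q u
    proof -
      obtain y where y: "y \<in> ball 0 \<epsilon>" "\<kappa> u = \<iota> q y" using u by (auto simp: sh_def)
      have xy: "x + y \<in> ball x \<epsilon>" using y by (simp add: dist_norm)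
      moreover have "j (\<kappa> u) = Some (x + y)" using j\<iota>[OF q y(1)] y(2) by simp
      ultimately show ?thesis using JI[of u "x + y"] bO by (metis subsetD)
    qed
    have U1: "\<Union>(sh ` ?F) = T \<inter> J -` ball x \<epsilon>"
    proof
      show "\<Union>(sh ` ?F) \<subseteq> T \<inter> J -` ball x \<epsilon>" using sh_T by blast
      show "T \<inter> J -` ball x \<epsilon> \<subseteq> \<Union>(sh ` ?F)"
      proof
        fix u assume u: "u \<in> T \<inter> J -` ball x \<epsilon>"
        then have ju: "j (\<kappa> u) = Some (J u)" "dist (J u) x < \<epsilon>" using J by (auto simp: dist_commute)
        then obtain q y where q: "q \<in> ?F" and y: "y \<in> ball 0 r" "\<kappa> u = \<iota> q y"
          using e1(2)[of "\<kappa> u" "J u"] e by force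
        have "j (\<kappa> u) = Some (x + y)"
          using local_param_j(1)[OF lp[OF q] y(1)] y(2) by (simp add: \<iota>_def)
        then have "J u = x + y" using ju by simp
        then have "y \<in> ball 0 \<epsilon>" using ju(2) by (simp add: dist_norm)
        then show "u \<in> \<Union>(sh ` ?F)" using q y by (auto simp: sh_def)
      qed
    qed
    have U2: "openin (top_of_set T) (sh q)" if q: "q \<in> ?F" for q
    proof -
      have "openin P1_top (\<iota> q ` ball 0 \<epsilon>)" unfolding \<iota>_def
        by (rule local_param_open[OF lp'[OF q]]) auto
      from openin_continuous_map_preimage[OF cont\<kappa> this]
      have "open (sh q)" by (simp add: sh_def)
      moreover have "sh q \<subseteq> T" using sh_T[OF q] by blast
      ultimately show ?thesis by (simp add: open_subset)
    qed
    have U3: "pairwise disjnt (sh ` ?F)"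
      unfolding pairwise_def disjnt_def
    proof (intro ballI impI)
      fix A B assume "A \<in> sh ` ?F" "B \<in> sh ` ?F" "A \<noteq> B"
      then obtain q q' where q: "q \<in> ?F" "q' \<in> ?F" "A = sh q" "B = sh q'" by blast
      show "A \<inter> B = {}"
      proof (rule ccontr)
        assume "A \<inter> B \<noteq> {}"
        then obtain u where u: "u \<in> sh q" "u \<in> sh q'" using q by blast
        then obtain y y' where y: "y \<in> ball 0 \<epsilon>" "\<kappa> u = \<iota> q y" "y' \<in> ball 0 \<epsilon>" "\<kappa> u = \<iota> q' y'"
          unfolding sh_def by blast
        have "x + y = x + y'" using j\<iota>[OF q(1) y(1)] j\<iota>[OF q(2) y(3)] y by simp
        then have eq: "\<iota> q ((x + y) - x) = \<iota> q' ((x + y) - x)" using y by simp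
        \<comment> \<open>Two sheets with a common point coincide as sections over the disc, in
          particular at its centre, where their values are \<open>q\<close> and
          \<open>q'\<close>.\<close>
        have "\<iota> q (x - x) = \<iota> q' (x - x)"
          by (rule section_unique[OF sec[OF q(1)] sec[OF q(2)] connected_ball b01 _ eq])
            (use y e in \<open>auto simp: dist_norm\<close>)
        then have "q = q'"
          using local_param_j(3)[OF lp'[OF q(1)]] local_param_j(3)[OF lp'[OF q(2)]]
          by (simp add: \<iota>_def)
        then show False using q \<open>A \<noteq> B\<close> by simp
      qed
    qed
    have U4: "\<exists>f. homeomorphism (sh q) (ball x \<epsilon>) J f" if q: "q \<in> ?F" for q
    proof (intro exI)
      let ?f = "\<lambda>w. inv \<kappa> (\<iota> q (w - x))"
      have \<kappa>f: "\<kappa> (?f w) = \<iota> q (w - x)" if "w \<in> ball x \<epsilon>" for w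
      proof -
        have "j (\<iota> q (w - x)) = Some w" using sec[OF q] that by (auto simp: is_section_def)
        then obtain u where "\<kappa> u = \<iota> q (w - x)" using fin_in by blast
        then show ?thesis using inv by metis
      qed
      have fsh: "?f w \<in> sh q" if "w \<in> ball x \<epsilon>" for w
        using \<kappa>f[OF that] that unfolding sh_def
        by (auto intro!: image_eqI[of _ _ "w - x"] simp: dist_norm norm_minus_commute)
      have Jf: "J (?f w) = w" if "w \<in> ball x \<epsilon>" for w
        using \<kappa>f[OF that] sec[OF q] that by (auto simp: J_def is_section_def)
      have fJ: "?f (J u) = u" if "u \<in> sh q" for u
      proof -
        obtain y where y: "y \<in> ball 0 \<epsilon>" "\<kappa> u = \<iota> q y" using \<open>u \<in> sh q\<close> by (auto simp: sh_def)
        then have "J u = x + y" using j\<iota>[OF q y(1)] by (simp add: J_def)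
        then show ?thesis using y inv by (simp flip: y(2))
      qed
      have "continuous_on (ball x \<epsilon>) ?f"
        unfolding continuous_on_open_vimage[OF open_ball]
      proof (intro allI impI)
        fix B :: "complex set" assume "open B"
        then have "openin P1_top (\<kappa> ` B)" using op\<kappa> by blast
        then have "openin (top_of_set (ball x \<epsilon>)) {w \<in> topspace (top_of_set (ball x \<epsilon>)). \<iota> q (w - x) \<in> \<kappa> ` B}"
          using sec[OF q] by (intro openin_continuous_map_preimage) (auto simp: is_section_def)
        then have "open {w \<in> ball x \<epsilon>. \<iota> q (w - x) \<in> \<kappa> ` B}"
          by (simp add: openin_open_eq)
        moreover have "{w \<in> ball x \<epsilon>. \<iota> q (w - x) \<in> \<kappa> ` B} = ?f -` B \<inter> ball x \<epsilon>"
        proof (intro set_eqI iffI)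
          fix w assume "w \<in> {w \<in> ball x \<epsilon>. \<iota> q (w - x) \<in> \<kappa> ` B}"
          then show "w \<in> ?f -` B \<inter> ball x \<epsilon>" using inv by auto
        next
          fix w assume w: "w \<in> ?f -` B \<inter> ball x \<epsilon>"
          then have "?f w \<in> B" "\<kappa> (?f w) = \<iota> q (w - x)" using \<kappa>f[of w] by auto
          then have "\<iota> q (w - x) \<in> \<kappa> ` B" by (metis imageI)
          then show "w \<in> {w \<in> ball x \<epsilon>. \<iota> q (w - x) \<in> \<kappa> ` B}" using w by simp
        qed
        ultimately show "open (?f -` B \<inter> ball x \<epsilon>)" by simp
      qed
      then show "homeomorphism (sh q) (ball x \<epsilon>) J ?f"
        using fsh Jf fJ sh_T[OF q] contJ
        by (intro homeomorphismI) (auto intro: continuous_on_subset)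
    qed
    show "\<exists>T'. x \<in> T' \<and> openin (top_of_set \<Omega>) T' \<and>
        (\<exists>v. \<Union>v = T \<inter> J -` T' \<and> (\<forall>u\<in>v. openin (top_of_set T) u) \<and>
             pairwise disjnt v \<and> (\<forall>u\<in>v. \<exists>q. homeomorphism u T' J q))"
    proof (intro exI[of _ "ball x \<epsilon>"] conjI exI[of _ "sh ` ?F"])
      show "openin (top_of_set \<Omega>) (ball x \<epsilon>)" using bO by (simp add: open_subset)
    qed (use U1 U2 U3 U4 e in auto)
  qed
  obtain u0 where u0: "\<kappa> u0 = p" using fin_in[OF p(1)] by blast
  have u0T: "u0 \<in> T" "J u0 = w0" using JI[of u0 w0] u0 p by auto
  obtain g where g: "continuous_on \<Omega> g" "g \<in> \<Omega> \<rightarrow> T" "g w0 = u0" "\<And>y. y \<in> \<Omega> \<Longrightarrow> J (g y) = y"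
    using covering_space_lift_strong[OF cov u0T(1) p(2) \<Omega>(2) open_imp_locally_path_connected[OF \<Omega>(1)], of "\<lambda>w. w"]
      u0T by auto
  have "is_section j \<Omega> (\<kappa> \<circ> g)"
    unfolding is_section_def
  proof (intro conjI ballI)
    show "continuous_map (top_of_set \<Omega>) P1_top (\<kappa> \<circ> g)"
      by (rule continuous_map_compose[OF _ cont\<kappa>]) (use g in auto)
    fix w assume w: "w \<in> \<Omega>"
    then show "j ((\<kappa> \<circ> g) w) = Some w" using J(1)[of "g w"] g(2,4) by auto
  qed
  then show ?thesis using g(3) u0 by auto
qed

definition lift :: "complex set \<Rightarrow> P1 \<Rightarrow> complex \<Rightarrow> P1" where
  "lift \<Omega> p = (SOME s. is_section j \<Omega> s \<and> s (the (j p)) = p)"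

lemma lift_section:
  assumes "slit_domain \<Omega>" "j p = Some w" "w \<in> \<Omega>"
  shows "is_section j \<Omega> (lift \<Omega> p)" "lift \<Omega> p w = p"
proof -
  have "\<exists>s. is_section j \<Omega> s \<and> s (the (j p)) = p"
    using lift_exists[OF open_slit[OF assms(1)] starlike_imp_simply_connected[OF starlike_slit[OF assms(1)]]
        slit_avoids[OF assms(1)] assms(2,3)] assms(2) by simp
  from someI_ex[OF this] show "is_section j \<Omega> (lift \<Omega> p)" "lift \<Omega> p w = p"
    unfolding lift_def using assms(2) by auto
qed

lemma section_slit_unique:
  assumes "slit_domain \<Omega>" "is_section j \<Omega> s1" "is_section j \<Omega> s2" "w0 \<in> \<Omega>" "s1 w0 = s2 w0" "w \<in> \<Omega>"
  shows "s1 w = s2 w"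
  using section_unique[OF assms(2,3) starlike_imp_connected[OF starlike_slit[OF assms(1)]]
      slit_avoids[OF assms(1)] assms(4,5,6)] .

lemma lift_eq_section:
  assumes "slit_domain \<Omega>" "is_section j \<Omega> s" "w0 \<in> \<Omega>" "w \<in> \<Omega>"
  shows "lift \<Omega> (s w0) w = s w"
proof -
  have "j (s w0) = Some w0" using assms by (auto simp: is_section_def)
  from lift_section[OF assms(1) this assms(3)] show ?thesis
    using section_slit_unique[OF assms(1) _ assms(2,3) _ assms(4)] by blast
qed

end

section \<open>Roots, and edge ends as sheets over the middle slit plane\<close>

definition unit_interval :: "complex set" where
  "unit_interval = complex_of_real ` {0<..<1}"

lemma unit_interval_slit: "unit_interval \<subseteq> slit_mid"
  by (auto simp: unit_interval_def slit_mid_def)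

lemma half_in_unit_interval: "1 / 2 \<in> unit_interval"
  unfolding unit_interval_def by (rule image_eqI[of _ _ "1/2"]) auto

lemma connected_unit_interval: "connected unit_interval"
  unfolding unit_interval_def
  by (intro connected_continuous_image continuous_intros connected_Ioo)

text \<open>The principal root. As an exponential it never vanishes, so it is a root only of nonzero
  numbers.\<close>

definition nrt :: "nat \<Rightarrow> complex \<Rightarrow> complex" where
  "nrt n w = exp (Ln w / of_nat n)"

lemma nrt_power: "n \<ge> 1 \<Longrightarrow> w \<noteq> 0 \<Longrightarrow> nrt n w ^ n = w"
  unfolding nrt_def by (subst exp_of_nat_mult[symmetric]) auto

lemma nrt_nonzero [simp]: "nrt n w \<noteq> 0"
  by (simp add: nrt_def)

lemma nrt_of_real:
  assumes "n \<ge> 1" "t > 0"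
  shows "nrt n (of_real t ^ n) = of_real t"
proof -
  have "Ln (of_real t ^ n) = Ln (of_real (t ^ n))" by simp
  also have "\<dots> = of_real (real n * ln t)"
    using assms by (subst Ln_of_real) (simp_all add: ln_realpow)
  finally have "nrt n (of_real t ^ n) = exp (of_real (ln t))"
    using assms by (simp add: nrt_def)
  also have "\<dots> = of_real t" using assms by (simp add: exp_of_real)
  finally show ?thesis .
qed

lemma continuous_on_nrt:
  assumes "A \<inter> \<real>\<^sub>\<le>\<^sub>0 = {}"
  shows "continuous_on A (nrt n)"
  unfolding nrt_def using assms
  by (cases "n = 0") (auto intro!: continuous_intros)

lemma cis_over_power:
  assumes "n \<ge> 1"
  shows "cis (pi / real n) ^ n = -1" "cis (- pi / real n) ^ n = -1"
proof -
  have "real n * (pi / real n) = pi" "real n * (- pi / real n) = - pi" using assms by simp_all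
  moreover have cis_minus_pi: "cis (- pi) = -1" by (simp add: complex_eq_iff)
  ultimately show "cis (pi / real n) ^ n = -1" "cis (- pi / real n) ^ n = -1"
    using Complex.DeMoivre[of "pi / real n" n] Complex.DeMoivre[of "- pi / real n" n]
    by (simp_all only: cis_pi cis_minus_pi)
qed

text \<open>An \<open>n\<close>-th root of -1 lies midway between two consecutive
  \<open>n\<close>-th roots of 1. A section crossing the negative axis at a vertex sits at such a
  midpoint, and the two adjacent edge ends are half a step away.\<close>

lemma cis_half_turns:
  "C * cis (- pi / real n) * cis (2 * pi / real n) = C * cis (pi / real n)"
  "C * cis (pi / real n) * cis (- pi / real n) = C"
  "C * cis (pi / real n) * cis (pi / real n) = C * cis (2 * pi / real n)"
proof -
  have "2 * pi / real n = pi / real n + pi / real n" "- pi / real n = - (pi / real n)" by simp_all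
  then show "C * cis (- pi / real n) * cis (2 * pi / real n) = C * cis (pi / real n)"
    "C * cis (pi / real n) * cis (- pi / real n) = C"
    "C * cis (pi / real n) * cis (pi / real n) = C * cis (2 * pi / real n)"
    by (simp_all only: mult.assoc cis_mult) simp_all
qed

lemma norm_root_of_unity:
  assumes "(C::complex) ^ n = 1" "n \<ge> 1"
  shows "norm C = 1"
proof (rule power_eq_imp_eq_base[of _ n])
  show "norm C ^ n = 1 ^ n" using assms(1) by (metis norm_one norm_power power_one)
qed (use assms in auto)

lemma norm_less_of_power:
  assumes "norm (x::complex) ^ n < \<rho> ^ n" "\<rho> > 0"
  shows "norm x < \<rho>"
  by (rule power_less_imp_less_base[OF assms(1)]) (use assms(2) in simp)

lemma slit_mid_nonpos: "slit_mid \<inter> \<real>\<^sub>\<le>\<^sub>0 = {}"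
  by (auto simp: slit_mid_def complex_nonpos_Reals_iff)

lemma slit_neg_nonpos: "uminus ` slit_neg \<inter> \<real>\<^sub>\<le>\<^sub>0 = {}"
  by (auto simp: slit_neg_def complex_nonpos_Reals_iff)

context dessin
begin

text \<open>Defined for every point over the middle slit plane, not only on the skeleton: each sheet
  over \<open>slit_mid\<close> contains exactly one edge end, and \<open>end_of p\<close> is that of
  the sheet through \<open>p\<close>.\<close>

definition end_of :: "P1 \<Rightarrow> P1 set" where
  "end_of p = lift slit_mid p ` unit_interval"

definition open_edges :: "P1 set" where
  "open_edges = {z. j z \<in> Some ` unit_interval}"

lemma section_j: "is_section j \<Omega> s \<Longrightarrow> w \<in> \<Omega> \<Longrightarrow> j (s w) = Some w"
  by (simp add: is_section_def)

lemma end_of_section: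
  assumes "is_section j slit_mid s" "w \<in> slit_mid"
  shows "end_of (s w) = s ` unit_interval"
  unfolding end_of_def
  using lift_eq_section[OF _ assms] unit_interval_slit by (intro image_cong) auto

lemma mid_section:
  assumes "j p = Some w" "w \<in> slit_mid"
  obtains s where "is_section j slit_mid s" "s w = p" "end_of p = s ` unit_interval"
  using lift_section[OF _ assms] that[of "lift slit_mid p"] end_of_def by auto

text \<open>On a half plane, a section over any slit plane is a piece of a single sheet over
  \<open>slit_mid\<close>. So a section over \<open>slit_neg\<close> or \<open>slit_pos\<close> has
  one edge end for the upper and one for the lower half plane.\<close>

lemma end_of_half_plane:
  assumes \<Omega>: "slit_domain \<Omega>" and S: "is_section j \<Omega> S" and H: "H \<in> {upper_half, lower_half}"
    and w: "w \<in> H" "w' \<in> H"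
  shows "end_of (S w) = end_of (S w')"
proof -
  have sub: "H \<subseteq> \<Omega>" "H \<subseteq> slit_mid" using H half_plane_slit[OF \<Omega>] half_plane_slit[of slit_mid] by auto
  have wm: "w \<in> slit_mid" using sub w by auto
  have jw: "j (S w) = Some w" using section_j[OF S] sub w by auto
  obtain s where s: "is_section j slit_mid s" "s w = S w" "end_of (S w) = s ` unit_interval"
    using mid_section[OF jw wm] .
  have "connected H" using H half_plane_props by auto
  then have "s w' = S w'"
    by (rule section_unique[OF is_section_subset[OF s(1) sub(2)] is_section_subset[OF S sub(1)] _ _ _ w(1) s(2) w(2)])
      (use sub slit_avoids[OF \<Omega>] in auto)
  then show ?thesis using end_of_section[OF s(1), of w'] s(3) sub w by auto
qed

lemma end_of_eq_section_image:
  assumes s: "is_section j slit_mid s"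
  shows "s ` unit_interval = s ` slit_mid \<inter> open_edges"
  using section_j[OF s] unit_interval_slit by (fastforce simp: open_edges_def)

lemma section_image_end:
  assumes s: "is_section j slit_mid s" and q: "q \<in> s ` slit_mid"
  shows "end_of q = s ` unit_interval"
  using end_of_section[OF s] q by auto

lemma skeleton_open_edges: "skeleton j - sk_vertices j - {z. j z = Some 1} = open_edges"
proof (intro set_eqI iffI)
  fix z assume "z \<in> skeleton j - sk_vertices j - {z. j z = Some 1}"
  then obtain r :: real where r: "0 \<le> r" "r \<le> 1" "j z = Some (of_real r)" "r \<noteq> 0" "r \<noteq> 1"
    by (auto simp: skeleton_def sk_vertices_def)
  then have "0 < r" "r < 1" by auto
  with r(3) show "z \<in> open_edges" by (auto simp: open_edges_def unit_interval_def)
next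
  fix z assume "z \<in> open_edges"
  then obtain r :: real where r: "0 < r" "r < 1" "j z = Some (of_real r)"
    by (auto simp: open_edges_def unit_interval_def)
  then show "z \<in> skeleton j - sk_vertices j - {z. j z = Some 1}"
    by (auto simp: skeleton_def sk_vertices_def intro!: exI[of _ r])
qed

lemma open_edges_section:
  assumes "p \<in> open_edges"
  obtains s where "is_section j slit_mid s" "end_of p = s ` unit_interval" "p \<in> end_of p"
proof -
  obtain w where w: "w \<in> unit_interval" "j p = Some w" using assms by (auto simp: open_edges_def)
  have "w \<in> slit_mid" using w unit_interval_slit by auto
  from mid_section[OF w(2) this] obtain s where
    "is_section j slit_mid s" "s w = p" "end_of p = s ` unit_interval" .
  then show ?thesis using w by (intro that[of s]) auto
qed

lemma end_of_subset: "p \<in> open_edges \<Longrightarrow> end_of p \<subseteq> open_edges"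
  by (metis Int_lower2 end_of_eq_section_image open_edges_section)

lemma end_of_same: "p \<in> open_edges \<Longrightarrow> q \<in> end_of p \<Longrightarrow> end_of q = end_of p"
  by (metis Int_iff end_of_eq_section_image open_edges_section section_image_end)

lemma connectedin_end_of:
  assumes "p \<in> open_edges" shows "connectedin P1_top (end_of p)"
proof -
  obtain s where s: "is_section j slit_mid s" "end_of p = s ` unit_interval"
    using open_edges_section[OF assms] .
  have "continuous_map (top_of_set unit_interval) P1_top s"
    using is_section_subset[OF s(1) unit_interval_slit] by (simp add: is_section_def)
  from connectedin_continuous_map_image[OF this, of unit_interval]
  show ?thesis using s(2) connected_unit_interval by (simp add: connectedin_subtopology)
qed

lemma openin_end_of:
  assumes "p \<in> open_edges" shows "\<exists>U. openin P1_top U \<and> end_of p = U \<inter> open_edges"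
proof -
  obtain s where s: "is_section j slit_mid s" "end_of p = s ` unit_interval"
    using open_edges_section[OF assms] .
  have "openin P1_top (s ` slit_mid)"
    by (rule section_openin[OF s(1) open_slit slit_avoids]) simp_all
  then show ?thesis using s end_of_eq_section_image[OF s(1)] by auto
qed

text \<open>An edge end is connected as the image of an interval, and relatively open because its
  sheet over \<open>slit_mid\<close> is open and meets the open edges in nothing else.\<close>

lemma sk_ends_eq: "sk_ends j = end_of ` open_edges"
  unfolding sk_ends_def skeleton_open_edges
proof (rule connected_components_of_open_partition)
  have "p \<in> end_of p" if "p \<in> open_edges" for p using that open_edges_section by metis
  then show "\<Union>(end_of ` open_edges) = topspace (subtopology P1_top open_edges)"
    using end_of_subset by auto
  show "pairwise disjnt (end_of ` open_edges)"
    unfolding pairwise_def disjnt_def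
  proof (intro ballI impI)
    fix A B assume "A \<in> end_of ` open_edges" "B \<in> end_of ` open_edges" "A \<noteq> B"
    then show "A \<inter> B = {}" using end_of_same by blast
  qed
next
  fix A assume "A \<in> end_of ` open_edges"
  then obtain p where p: "p \<in> open_edges" "A = end_of p" by blast
  have "A \<noteq> {}" using open_edges_section[OF p(1)] p(2) by blast
  moreover have "connectedin (subtopology P1_top open_edges) A"
    using connectedin_end_of[OF p(1)] end_of_subset[OF p(1)] p(2) by (simp add: connectedin_subtopology)
  moreover have "openin (subtopology P1_top open_edges) A"
    using openin_end_of[OF p(1)] p(2) unfolding openin_subtopology by auto
  ultimately show "A \<noteq> {} \<and> connectedin (subtopology P1_top open_edges) A \<and>
      openin (subtopology P1_top open_edges) A" by blast
qed

lemma end_of_in_sk_ends: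
  assumes "j p = Some w" "w \<in> slit_mid"
  shows "end_of p \<in> sk_ends j"
proof -
  obtain s where s: "is_section j slit_mid s" "s w = p" "end_of p = s ` unit_interval"
    using mid_section[OF assms] .
  have h: "1 / 2 \<in> slit_mid" using half_in_unit_interval unit_interval_slit by blast
  have "end_of (s (1/2)) = end_of p" using end_of_section[OF s(1) h] s(3) by simp
  moreover have "s (1/2) \<in> open_edges"
    using section_j[OF s(1) h] half_in_unit_interval by (auto simp: open_edges_def)
  ultimately show ?thesis unfolding sk_ends_eq by (metis imageI)
qed

lemma sk_endsE:
  assumes "h \<in> sk_ends j"
  obtains s where "is_section j slit_mid s" "h = s ` unit_interval"
  using assms unfolding sk_ends_eq by (metis imageE open_edges_section)

lemma sk_ends_eq_end_of: "h \<in> sk_ends j \<Longrightarrow> p \<in> h \<Longrightarrow> end_of p = h"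
  unfolding sk_ends_eq using end_of_same by auto

lemma sk_ends_subset: "h \<in> sk_ends j \<Longrightarrow> h \<subseteq> open_edges"
  unfolding sk_ends_eq using end_of_subset by auto

section \<open>Edge ends at a vertex\<close>

text \<open>With radius at most 1 the values of \<open>j\<close> on the normal disc stay in the unit
  disc, where the middle slit plane restricted to a ball is connected and positive values lie in
  \<open>unit_interval\<close>.\<close>

definition vparam :: "P1 \<Rightarrow> real \<times> (complex \<Rightarrow> complex)" where
  "vparam z = (SOME P. local_param j z 0 (ram z) (fst P) (snd P) \<and> fst P \<le> 1)"

definition vrad :: "P1 \<Rightarrow> real" where "vrad z = fst (vparam z)"

definition vmap :: "P1 \<Rightarrow> complex \<Rightarrow> P1" where "vmap z x = P1_chart z (snd (vparam z) x)"

text \<open>For a \<open>ram z\<close>-th root of unity \<open>C\<close>, the ray in direction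
  \<open>C\<close> of the normal disc is mapped by \<open>j\<close> to positive reals; this is the
  edge end leaving \<open>z\<close> along it. Half the radius serves as base point.\<close>

definition vend :: "P1 \<Rightarrow> complex \<Rightarrow> P1 set" where
  "vend z C = end_of (vmap z (C * of_real (vrad z / 2)))"

lemma vparam:
  assumes "j z = Some 0"
  shows "local_param j z 0 (ram z) (vrad z) (snd (vparam z))" "vrad z \<le> 1" "vrad z > 0"
proof -
  obtain \<rho> \<eta> where lp: "local_param j z 0 (ram z) \<rho> \<eta>" using param_ex[OF assms] by blast
  have "local_param j z 0 (ram z) (min \<rho> 1) \<eta>"
    using local_param_shrink[OF lp, of "min \<rho> 1"] local_param_j(2)[OF lp] by auto
  then have "\<exists>P. local_param j z 0 (ram z) (fst P) (snd P) \<and> fst P \<le> 1"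
    by (intro exI[of _ "(min \<rho> 1, \<eta>)"]) auto
  from someI_ex[OF this]
  show a: "local_param j z 0 (ram z) (vrad z) (snd (vparam z))" "vrad z \<le> 1"
    by (auto simp: vrad_def vparam_def)
  show "vrad z > 0" by (rule local_param_j(2)[OF a(1)])
qed

lemma vmap_props:
  assumes z: "j z = Some 0"
  shows "x \<in> ball 0 (vrad z) \<Longrightarrow> j (vmap z x) = Some (x ^ ram z)"
    "continuous_map (top_of_set (ball 0 (vrad z))) P1_top (vmap z)"
    "vmap z 0 = z"
    "x \<in> ball 0 (vrad z) \<Longrightarrow> y \<in> ball 0 (vrad z) \<Longrightarrow> vmap z x = vmap z y \<Longrightarrow> x = y"
    "openin P1_top (vmap z ` ball 0 (vrad z))"
  using local_param_j[OF vparam(1)[OF z]] local_param_continuous[OF vparam(1)[OF z]]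
    local_param_inj[OF vparam(1)[OF z]] local_param_open[OF vparam(1)[OF z] open_ball]
  unfolding vmap_def by auto

lemma vrad_power: "j z = Some 0 \<Longrightarrow> 0 < vrad z ^ ram z \<and> vrad z ^ ram z \<le> 1"
  using vparam[of z] by (simp add: power_le_one)

lemma power_in_ball:
  assumes "j z = Some 0" "(x::complex) ^ ram z \<in> ball 0 (vrad z ^ ram z)"
  shows "x \<in> ball 0 (vrad z)"
  using assms norm_less_of_power[of x "ram z" "vrad z"] vparam(3)[OF assms(1)]
  by (simp add: norm_power)

lemma power_in_ball_iff:
  assumes "j z = Some 0" "(x::complex) \<in> ball 0 (vrad z)"
  shows "x ^ ram z \<in> ball 0 (vrad z ^ ram z)"
  using assms ram_pos[OF assms(1)] by (simp add: norm_power power_strict_mono)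

text \<open>In the normal coordinate a section is a continuous root of \<open>w\<close>; the later
  choices of \<open>f\<close> are a constant times a principal root of \<open>w\<close> or of
  \<open>- w\<close>.\<close>

lemma branch_section:
  assumes z: "j z = Some 0" and \<Omega>: "0 \<notin> \<Omega>" "\<Omega> \<subseteq> ball 0 (vrad z ^ ram z)"
    and f: "continuous_on \<Omega> f" "\<And>w. w \<in> \<Omega> \<Longrightarrow> f w ^ ram z = w"
  shows "is_section j \<Omega> (\<lambda>w. vmap z (f w))"
  unfolding is_section_def
proof (intro conjI ballI)
  have im: "f w \<in> ball 0 (vrad z)" if "w \<in> \<Omega>" for w
    using power_in_ball[OF z] f(2)[OF that] \<Omega> that by auto
  have "continuous_map (top_of_set \<Omega>) (top_of_set (ball 0 (vrad z))) f"
    using f(1) im by (auto simp del: mem_ball)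
  from continuous_map_compose[OF this vmap_props(2)[OF z]]
  show "continuous_map (top_of_set \<Omega>) P1_top (\<lambda>w. vmap z (f w))" by (simp add: comp_def)
  fix w assume w: "w \<in> \<Omega>"
  show "j (vmap z (f w)) = Some w"
    using vmap_props(1)[OF z im[OF w]] f(2)[OF w] by simp
qed

text \<open>Both sides are sections over the connected set \<open>slit_mid\<close> cut with a disc,
  and they agree at \<open>w0\<close>.\<close>

lemma vend_section:
  assumes z: "j z = Some 0" and C: "C ^ ram z = 1" and s: "is_section j slit_mid s"
    and w0: "w0 \<in> slit_mid \<inter> ball 0 (vrad z ^ ram z)" "s w0 = vmap z (C * nrt (ram z) w0)"
    and w: "w \<in> slit_mid \<inter> ball 0 (vrad z ^ ram z)"
  shows "s w = vmap z (C * nrt (ram z) w)"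
proof -
  let ?\<Omega> = "slit_mid \<inter> ball 0 (vrad z ^ ram z)"
  have n0: "0 \<notin> slit_mid" "1 \<notin> slit_mid" using slit_avoids[of slit_mid] by auto
  have sec: "is_section j ?\<Omega> (\<lambda>w. vmap z (C * nrt (ram z) w))"
  proof (rule branch_section[OF z])
    show "continuous_on ?\<Omega> (\<lambda>w. C * nrt (ram z) w)"
      using slit_mid_nonpos by (intro continuous_intros continuous_on_nrt) auto
    fix w assume "w \<in> ?\<Omega>"
    then have "w \<noteq> 0" using n0 by auto
    then show "(C * nrt (ram z) w) ^ ram z = w"
      using C nrt_power[OF ram_pos[OF z]] by (simp add: power_mult_distrib)
  qed (use n0 in auto)
  have "connected ?\<Omega>" using connected_slit_mid_ball vrad_power[OF z] by simp
  then show ?thesis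
    by (intro section_unique[OF is_section_subset[OF s Int_lower1] sec _ _ _ w0 w]) (use n0 in auto)
qed

lemma vend_base:
  assumes z: "j z = Some 0" and C: "C ^ ram z = 1" and t: "0 < t" "t < vrad z"
  shows "C * of_real t \<in> ball 0 (vrad z)" "j (vmap z (C * of_real t)) = Some (of_real t ^ ram z)"
    "of_real t ^ ram z \<in> slit_mid \<inter> ball 0 (vrad z ^ ram z)" "of_real t ^ ram z \<in> unit_interval"
    "nrt (ram z) (of_real t ^ ram z) = of_real t"
proof -
  have n: "ram z \<ge> 1" by (rule ram_pos[OF z])
  have nC: "norm C = 1" using C n by (rule norm_root_of_unity)
  show b: "C * of_real t \<in> ball 0 (vrad z)" using nC t by (simp add: norm_mult)
  show "j (vmap z (C * of_real t)) = Some (of_real t ^ ram z)"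
    using vmap_props(1)[OF z b] C by (simp add: power_mult_distrib)
  have "t ^ ram z < 1" using t vparam(2)[OF z] n by (intro power_less_one_iff[THEN iffD2]) auto
  then show u: "of_real t ^ ram z \<in> unit_interval" using t
    unfolding unit_interval_def by (intro image_eqI[of _ _ "t ^ ram z"]) auto
  show "of_real t ^ ram z \<in> slit_mid \<inter> ball 0 (vrad z ^ ram z)"
    using u unit_interval_slit power_in_ball_iff[OF z b] C by (auto simp: power_mult_distrib)
  show "nrt (ram z) (of_real t ^ ram z) = of_real t" by (rule nrt_of_real[OF n t(1)])
qed

text \<open>The power \<open>x ^ ram z\<close> determines \<open>x\<close> up to a root of unity.
  That root of unity, the quotient of \<open>x\<close> by the principal root, identifies the edge
  end.\<close>

lemma end_of_vmap:
  assumes z: "j z = Some 0" and x: "x \<in> ball 0 (vrad z)" "x ^ ram z \<in> slit_mid"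
    and C: "C = x / nrt (ram z) (x ^ ram z)"
  shows "C ^ ram z = 1" "end_of (vmap z x) = vend z C"
proof -
  let ?w = "x ^ ram z"
  have "?w \<noteq> 0" using x(2) slit_avoids(1)[of slit_mid] slit_domain_simps(1) by metis
  then show C1: "C ^ ram z = 1"
    using nrt_power[OF ram_pos[OF z], of ?w] unfolding C power_divide
    by (metis divide_self)
  obtain s where s: "is_section j slit_mid s" "s ?w = vmap z x" "end_of (vmap z x) = s ` unit_interval"
    using mid_section[OF vmap_props(1)[OF z x(1)] x(2)] .
  have t: "0 < vrad z / 2" "vrad z / 2 < vrad z" using vparam(3)[OF z] by auto
  note b = vend_base[OF z C1 t]
  have "s ?w = vmap z (C * nrt (ram z) ?w)" using s(2) by (simp add: C)
  then have "s (of_real (vrad z / 2) ^ ram z) = vmap z (C * nrt (ram z) (of_real (vrad z / 2) ^ ram z))"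
    using vend_section[OF z C1 s(1) _ _ b(3), of ?w] x power_in_ball_iff[OF z x(1)] by blast
  then have "s (of_real (vrad z / 2) ^ ram z) = vmap z (C * of_real (vrad z / 2))" by (simp only: b(5))
  moreover have "end_of (s (of_real (vrad z / 2) ^ ram z)) = s ` unit_interval"
    using end_of_section[OF s(1)] b(3) by blast
  ultimately show "end_of (vmap z x) = vend z C" using s(3) by (simp add: vend_def)
qed

lemma vend_sectionE:
  assumes z: "j z = Some 0" and C: "C ^ ram z = 1"
  obtains s where "is_section j slit_mid s" "vend z C = s ` unit_interval"
    "\<And>t. 0 < t \<Longrightarrow> t < vrad z \<Longrightarrow> s (of_real t ^ ram z) = vmap z (C * of_real t)"
proof -
  have t: "0 < vrad z / 2" "vrad z / 2 < vrad z" using vparam(3)[OF z] by auto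
  note b = vend_base[OF z C t]
  obtain s where s: "is_section j slit_mid s"
    "s (of_real (vrad z / 2) ^ ram z) = vmap z (C * of_real (vrad z / 2))"
    "vend z C = s ` unit_interval"
    using mid_section[OF b(2)] b(3) unfolding vend_def by blast
  show ?thesis
  proof (rule that[OF s(1,3)])
    fix t assume t: "0 < t" "t < vrad z"
    note b' = vend_base[OF z C t]
    have "s (of_real t ^ ram z) = vmap z (C * nrt (ram z) (of_real t ^ ram z))"
      by (rule vend_section[OF z C s(1) b(3) _ b'(3)]) (simp only: s(2) b(5))
    then show "s (of_real t ^ ram z) = vmap z (C * of_real t)" by (simp only: b'(5))
  qed
qed

lemma vend_in_sk_ends:
  assumes z: "j z = Some 0" and C: "C ^ ram z = 1"
  shows "vend z C \<in> sk_ends j"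
proof -
  have t: "0 < vrad z / 2" "vrad z / 2 < vrad z" using vparam(3)[OF z] by auto
  note b = vend_base[OF z C t]
  show ?thesis unfolding vend_def using end_of_in_sk_ends[OF b(2)] b(3) by blast
qed

text \<open>An edge end has one point for each value of \<open>j\<close>. Comparing the points with
  the value of the base point gives \<open>C = C'\<close>, as the normal coordinate is
  injective.\<close>

lemma vend_inj:
  assumes z: "j z = Some 0" and C: "C ^ ram z = 1" "C' ^ ram z = 1" and eq: "vend z C = vend z C'"
  shows "C = C'"
proof -
  obtain s where s: "is_section j slit_mid s" "vend z C = s ` unit_interval"
    "\<And>t. 0 < t \<Longrightarrow> t < vrad z \<Longrightarrow> s (of_real t ^ ram z) = vmap z (C * of_real t)"
    using vend_sectionE[OF z C(1)] by blast
  have t: "0 < vrad z / 2" "vrad z / 2 < vrad z" using vparam(3)[OF z] by auto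
  obtain s' where s': "is_section j slit_mid s'" "vend z C' = s' ` unit_interval"
    "\<And>t. 0 < t \<Longrightarrow> t < vrad z \<Longrightarrow> s' (of_real t ^ ram z) = vmap z (C' * of_real t)"
    using vend_sectionE[OF z C(2)] by blast
  let ?w = "complex_of_real (vrad z / 2) ^ ram z"
  note b = vend_base[OF z C(1) t] and b' = vend_base[OF z C(2) t]
  have "s' ?w \<in> s ` unit_interval" using eq s(2) s'(2) b(4) by auto
  then obtain w where w: "w \<in> unit_interval" "s' ?w = s w" by auto
  have "j (s w) = Some w" "j (s' ?w) = Some ?w"
    using section_j[OF s(1)] section_j[OF s'(1)] w(1) b(3) unit_interval_slit by auto
  then have "w = ?w" using w(2) by simp
  then have "vmap z (C' * of_real (vrad z / 2)) = vmap z (C * of_real (vrad z / 2))"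
    using w(2) s(3)[OF t] s'(3)[OF t] by simp
  then have "C' * of_real (vrad z / 2) = C * of_real (vrad z / 2)"
    using vmap_props(4)[OF z b'(1) b(1)] by blast
  then show ?thesis using t by simp
qed

lemma vend_tendsto:
  assumes z: "j z = Some 0" and C: "C ^ ram z = 1" and U: "openin P1_top U" "z \<in> U"
  obtains \<delta> where "\<delta> > 0" "\<delta> \<le> vrad z" "\<And>t. 0 < t \<Longrightarrow> t < \<delta> \<Longrightarrow> vmap z (C * of_real t) \<in> U"
proof -
  have "openin (top_of_set (ball 0 (vrad z))) {x \<in> topspace (top_of_set (ball 0 (vrad z))). vmap z x \<in> U}"
    by (rule openin_continuous_map_preimage[OF vmap_props(2)[OF z] U(1)])
  then have "open {x \<in> ball 0 (vrad z). vmap z x \<in> U}" by (simp add: openin_open_eq)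
  moreover have "0 \<in> {x \<in> ball 0 (vrad z). vmap z x \<in> U}"
    using vparam(3)[OF z] vmap_props(3)[OF z] U(2) by simp
  ultimately obtain e where e: "e > 0" "ball 0 e \<subseteq> {x \<in> ball 0 (vrad z). vmap z x \<in> U}"
    using open_contains_ball by blast
  have nC: "norm C = 1" using C ram_pos[OF z]
    by (rule norm_root_of_unity)
  show ?thesis
  proof (rule that[of "min e (vrad z)"])
    fix t assume t: "0 < t" "t < min e (vrad z)"
    then have "C * of_real t \<in> ball 0 e" using nC by (simp add: norm_mult)
    then show "vmap z (C * of_real t) \<in> U" using e(2) by blast
  qed (use e(1) vparam(3)[OF z] in auto)
qed

text \<open>Rays of the normal disc tend to \<open>z\<close>; conversely, an end with
  \<open>z\<close> in its closure enters the normal disc, where \<open>end_of_vmap\<close>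
  identifies it.\<close>

lemma ends_at_eq:
  assumes z: "j z = Some 0"
  shows "ends_at j z = vend z ` {C. C ^ ram z = 1}"
proof (intro set_eqI iffI)
  fix h assume "h \<in> vend z ` {C. C ^ ram z = 1}"
  then obtain C where C: "C ^ ram z = 1" "h = vend z C" by auto
  obtain s where s: "is_section j slit_mid s" "vend z C = s ` unit_interval"
    "\<And>t. 0 < t \<Longrightarrow> t < vrad z \<Longrightarrow> s (of_real t ^ ram z) = vmap z (C * of_real t)"
    using vend_sectionE[OF z C(1)] by blast
  have "z \<in> P1_top closure_of h"
    unfolding in_closure_of
  proof (intro conjI allI impI)
    fix U assume "z \<in> U \<and> openin P1_top U"
    then obtain \<delta> where d: "\<delta> > 0" "\<delta> \<le> vrad z"
      "\<And>t. 0 < t \<Longrightarrow> t < \<delta> \<Longrightarrow> vmap z (C * of_real t) \<in> U"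
      using vend_tendsto[OF z C(1), of U] by metis
    have t: "0 < \<delta> / 2" "\<delta> / 2 < vrad z" "\<delta> / 2 < \<delta>" using d by auto
    have "vmap z (C * of_real (\<delta> / 2)) \<in> h"
      using s(3)[OF t(1,2)] vend_base(4)[OF z C(1) t(1,2)] s(2) C(2) by (metis imageI)
    then show "\<exists>y. y \<in> h \<and> y \<in> U" using d(3)[OF t(1,3)] by blast
  qed simp
  then show "h \<in> ends_at j z" using vend_in_sk_ends[OF z C(1)] C(2) by (simp add: ends_at_def)
next
  fix h assume "h \<in> ends_at j z"
  then have h: "h \<in> sk_ends j" "z \<in> P1_top closure_of h" by (auto simp: ends_at_def)
  have "z \<in> vmap z ` ball 0 (vrad z)"
    by (rule image_eqI[of _ _ 0]) (use vmap_props(3)[OF z] vparam(3)[OF z] in auto)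
  then obtain p where p: "p \<in> h" "p \<in> vmap z ` ball 0 (vrad z)"
    using h(2) vmap_props(5)[OF z] unfolding in_closure_of by blast
  then obtain x where x: "x \<in> ball 0 (vrad z)" "p = vmap z x" by blast
  have "p \<in> open_edges" using sk_ends_subset h p by blast
  then have "x ^ ram z \<in> slit_mid"
    using vmap_props(1)[OF z x(1)] x(2) unit_interval_slit by (auto simp: open_edges_def)
  from end_of_vmap[OF z x(1) this refl] show "h \<in> vend z ` {C. C ^ ram z = 1}"
    using sk_ends_eq_end_of[OF h(1) p(1)] x(2) by blast
qed

lemma small_values_near_vertices:
  obtains \<epsilon> where "\<epsilon> > 0" "\<epsilon> \<le> 1"
    "\<And>p w. j p = Some w \<Longrightarrow> norm w < \<epsilon> \<Longrightarrow> \<exists>z x. j z = Some 0 \<and> x \<in> ball 0 (vrad z) \<and> p = vmap z x"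
proof -
  let ?N = "\<Union>z\<in>{z. j z = Some 0}. vmap z ` ball 0 (vrad z)"
  have opN: "openin P1_top ?N" using vmap_props(5) by (intro openin_Union) auto
  have "z \<in> vmap z ` ball 0 (vrad z)" if "j z = Some 0" for z
    by (rule image_eqI[of _ _ 0]) (use vmap_props(3)[OF that] vparam(3)[OF that] in auto)
  then have subN: "{z. j z = Some 0} \<subseteq> ?N" by blast
  obtain \<epsilon> where "\<epsilon> > 0" "\<And>z w. j z = Some w \<Longrightarrow> dist w 0 < \<epsilon> \<Longrightarrow> z \<in> ?N"
    using tube[OF opN subN] by blast
  then have "j p = Some w \<Longrightarrow> norm w < min \<epsilon> 1 \<Longrightarrow>
      \<exists>z x. j z = Some 0 \<and> x \<in> ball 0 (vrad z) \<and> p = vmap z x" for p w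
    by (fastforce simp: dist_norm)
  then show ?thesis using that[of "min \<epsilon> 1"] \<open>\<epsilon> > 0\<close> by simp
qed

text \<open>Following the sheet of the end to a small positive value of \<open>j\<close> leads into
  the normal disc of some vertex.\<close>

lemma end_has_vertex:
  assumes h: "h \<in> sk_ends j"
  obtains z where "j z = Some 0" "h \<in> ends_at j z"
proof -
  obtain s where s: "is_section j slit_mid s" "h = s ` unit_interval" using sk_endsE[OF h] .
  obtain \<epsilon> where e: "\<epsilon> > 0" "\<epsilon> \<le> 1"
    "\<And>p w. j p = Some w \<Longrightarrow> norm w < \<epsilon> \<Longrightarrow> \<exists>z x. j z = Some 0 \<and> x \<in> ball 0 (vrad z) \<and> p = vmap z x"
    using small_values_near_vertices by metis
  let ?w = "complex_of_real (\<epsilon> / 2)"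
  have u: "?w \<in> unit_interval" unfolding unit_interval_def using e by (intro imageI) auto
  then have sm: "?w \<in> slit_mid" using unit_interval_slit by blast
  have jw: "j (s ?w) = Some ?w" by (rule section_j[OF s(1) sm])
  moreover have "norm ?w < \<epsilon>" unfolding norm_of_real using e by simp
  ultimately obtain z x where z: "j z = Some 0" "x \<in> ball 0 (vrad z)" "s ?w = vmap z x"
    using e(3) by blast
  have "x ^ ram z = ?w" using vmap_props(1)[OF z(1,2)] jw z(3) by (metis option.inject)
  with sm have "x ^ ram z \<in> slit_mid" by (simp only:)
  from end_of_vmap[OF z(1,2) this refl] have "end_of (vmap z x) \<in> ends_at j z"
    unfolding ends_at_eq[OF z(1)] by blast
  moreover have "end_of (vmap z x) = h" using end_of_section[OF s(1) sm] unfolding z(3) s(2) .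
  ultimately have "h \<in> ends_at j z" by (simp only:)
  with z(1) show ?thesis by (rule that)
qed

text \<open>Points of the end with small \<open>j\<close> would have to lie in disjoint
  neighbourhoods of \<open>z\<close> and \<open>z'\<close>, although the end has only one point for
  each value of \<open>j\<close>.\<close>

lemma end_vertex_unique:
  assumes z: "j z = Some 0" "h \<in> ends_at j z" and z': "j z' = Some 0" "h \<in> ends_at j z'"
  shows "z = z'"
proof (rule ccontr)
  assume ne: "z \<noteq> z'"
  obtain C where C: "C ^ ram z = 1" "h = vend z C" using z ends_at_eq by auto
  obtain C' where C': "C' ^ ram z' = 1" "h = vend z' C'" using z' ends_at_eq by auto
  obtain s where s: "is_section j slit_mid s" "vend z C = s ` unit_interval"
    "\<And>t. 0 < t \<Longrightarrow> t < vrad z \<Longrightarrow> s (of_real t ^ ram z) = vmap z (C * of_real t)"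
    using vend_sectionE[OF z(1) C(1)] by blast
  obtain s' where s': "is_section j slit_mid s'" "vend z' C' = s' ` unit_interval"
    "\<And>t. 0 < t \<Longrightarrow> t < vrad z' \<Longrightarrow> s' (of_real t ^ ram z') = vmap z' (C' * of_real t)"
    using vend_sectionE[OF z'(1) C'(1)] by blast
  have ss: "s w = s' w" if w: "w \<in> unit_interval" for w
  proof -
    have "s w \<in> s' ` unit_interval" using w s(2) s'(2) C C' by auto
    then obtain w' where w': "w' \<in> unit_interval" "s w = s' w'" by auto
    have "w \<in> slit_mid" "w' \<in> slit_mid" using w w'(1) unit_interval_slit by auto
    then have "w' = w" using section_j[OF s(1), of w] section_j[OF s'(1), of w'] w'(2) by simp
    then show ?thesis using w' by simp
  qed
  obtain U V where UV: "openin P1_top U" "openin P1_top V" "z \<in> U" "z' \<in> V" "disjnt U V"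
    using Hausdorff_space_P1 ne unfolding Hausdorff_space_def by (metis UNIV_I topspace_P1)
  obtain \<delta> where d: "\<delta> > 0" "\<delta> \<le> vrad z" "\<And>t. 0 < t \<Longrightarrow> t < \<delta> \<Longrightarrow> vmap z (C * of_real t) \<in> U"
    using vend_tendsto[OF z(1) C(1) UV(1,3)] by blast
  obtain \<delta>' where d': "\<delta>' > 0" "\<delta>' \<le> vrad z'" "\<And>t. 0 < t \<Longrightarrow> t < \<delta>' \<Longrightarrow> vmap z' (C' * of_real t) \<in> V"
    using vend_tendsto[OF z'(1) C'(1) UV(2,4)] by blast
  \<comment> \<open>A value of \<open>j\<close> that both rays attain inside their neighbourhoods;
    the parameter on each ray is the corresponding root of \<open>r\<close>.\<close>
  define r where "r = min (\<delta> ^ ram z) (\<delta>' ^ ram z') / 2"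
  have r: "0 < r" "r < \<delta> ^ ram z" "r < \<delta>' ^ ram z'" 
    using zero_less_power[OF d(1), of "ram z"] zero_less_power[OF d'(1), of "ram z'"]
    by (auto simp: r_def min_def)
  have rt: "\<exists>t. 0 < t \<and> t < e \<and> t ^ n = r" if "n \<ge> 1" "r < e ^ n" "e > 0" for e n
  proof (intro exI conjI)
    show "0 < root n r" using that r by simp
    show eq: "root n r ^ n = r" using that r by simp
    show "root n r < e" by (rule power_less_imp_less_base[of _ n]) (use eq that in auto)
  qed
  obtain t where t: "0 < t" "t < \<delta>" "t ^ ram z = r" using rt[OF ram_pos[OF z(1)] r(2) d(1)] by blast
  obtain t' where t': "0 < t'" "t' < \<delta>'" "t' ^ ram z' = r" using rt[OF ram_pos[OF z'(1)] r(3) d'(1)] by blast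
  have "s (of_real t ^ ram z) \<in> U" using s(3)[of t] d t by simp
  moreover have "s' (of_real t' ^ ram z') \<in> V" using s'(3)[of t'] d' t' by simp
  moreover have "of_real t ^ ram z = (of_real t' ^ ram z' :: complex)"
    using t(3) t'(3) by (metis of_real_power)
  moreover have "of_real t ^ ram z \<in> unit_interval"
    using vend_base(4)[OF z(1) C(1) t(1)] t d by simp
  ultimately show False using ss UV(5) by (metis disjnt_iff)
qed

text \<open>Continuing a section across the negative real axis turns around a vertex from one edge end to
  the next one counterclockwise.\<close>

lemma turn_around_vertex:
  assumes z: "j z = Some 0" and A: "A ^ ram z = -1" and S: "is_section j slit_neg S"
    and w0: "w0 \<in> slit_neg \<inter> ball 0 (vrad z ^ ram z)" "S w0 = vmap z (A * nrt (ram z) (- w0))"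
  shows "end_of (S \<i>) = vend z (A * cis (- pi / ram z))" "end_of (S (- \<i>)) = vend z (A * cis (pi / ram z))"
proof -
  let ?\<Omega> = "slit_neg \<inter> ball 0 (vrad z ^ ram z)"
  have n: "ram z \<ge> 1" by (rule ram_pos[OF z])
  have n0: "0 \<notin> slit_neg" "1 \<notin> slit_neg" using slit_avoids[of slit_neg] by auto
  have sec: "is_section j ?\<Omega> (\<lambda>w. vmap z (A * nrt (ram z) (- w)))"
  proof (rule branch_section[OF z])
    have c1: "continuous_on (uminus ` ?\<Omega>) (nrt (ram z))"
      using slit_neg_nonpos by (intro continuous_on_nrt) auto
    have c2: "continuous_on ?\<Omega> uminus" by (intro continuous_intros)
    from continuous_on_compose[OF c2 c1] have "continuous_on ?\<Omega> (nrt (ram z) \<circ> uminus)" .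
    then show "continuous_on ?\<Omega> (\<lambda>w. A * nrt (ram z) (- w))"
      by (auto simp: comp_def intro: continuous_intros)
    fix w assume "w \<in> ?\<Omega>"
    then have "- w \<noteq> 0" using n0 by auto
    then show "(A * nrt (ram z) (- w)) ^ ram z = w"
      using A nrt_power[OF n] by (simp add: power_mult_distrib)
  qed (use n0 in auto)
  have "connected ?\<Omega>" using connected_slit_neg_ball vrad_power[OF z] by simp
  then have S_eq: "S w = vmap z (A * nrt (ram z) (- w))" if "w \<in> ?\<Omega>" for w
    by (intro section_unique[OF is_section_subset[OF S Int_lower1] sec _ _ _ w0 that]) (use n0 in auto)
  define \<delta> where "\<delta> = vrad z ^ ram z / 2"
  have d: "0 < \<delta>" "\<delta> < vrad z ^ ram z" using vrad_power[OF z] by (auto simp: \<delta>_def)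
  \<comment> \<open>Across the negative axis the section involves the principal root of
    \<open>- w\<close>, while edge ends are named by that of \<open>w\<close>. At small multiples of
    \<open>\<i>\<close> and \<open>- \<i>\<close> the two differ by an angle of
    \<open>pi / ram z\<close>, with opposite signs.\<close>
  have Ln1: "Ln (of_real \<delta> * \<i>) = of_real (ln \<delta>) + \<i> * (pi / 2)"
    using d by (subst Ln_times_of_real) (auto simp: Ln_of_real)
  have Ln2: "Ln (of_real \<delta> * - \<i>) = of_real (ln \<delta>) - \<i> * (pi / 2)"
    using d by (subst Ln_times_of_real) (auto simp: Ln_of_real)
  have ratio1: "nrt (ram z) (of_real \<delta> * - \<i>) = cis (- pi / ram z) * nrt (ram z) (of_real \<delta> * \<i>)"
    unfolding nrt_def Ln1 Ln2 cis_conv_exp exp_add[symmetric]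
    by (rule arg_cong[of _ _ exp]) (simp add: add_divide_distrib diff_divide_distrib algebra_simps)
  have ratio2: "nrt (ram z) (of_real \<delta> * \<i>) = cis (pi / ram z) * nrt (ram z) (of_real \<delta> * - \<i>)"
    unfolding nrt_def Ln1 Ln2 cis_conv_exp exp_add[symmetric]
    by (rule arg_cong[of _ _ exp]) (simp add: add_divide_distrib diff_divide_distrib algebra_simps)
  have key: "end_of (S (of_real \<delta> * u)) = vend z (A * c)"
    if u: "u \<in> {\<i>, - \<i>}" and c: "nrt (ram z) (of_real \<delta> * - u) = c * nrt (ram z) (of_real \<delta> * u)" for u c
  proof -
    let ?w = "of_real \<delta> * u"
    let ?x = "A * nrt (ram z) (- ?w)"
    have w: "?w \<in> ?\<Omega>" "?w \<in> slit_mid" "?w \<noteq> 0" using u d by (auto simp: slit_defs norm_mult)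
    have x: "?x ^ ram z = ?w"
      using A nrt_power[OF n, of "- ?w"] w(3) by (simp add: power_mult_distrib)
    have xb: "?x \<in> ball 0 (vrad z)" by (rule power_in_ball[OF z]) (use x w in simp)
    have "?x / nrt (ram z) (?x ^ ram z) = A * c" unfolding x using c by simp
    then show ?thesis using end_of_vmap(2)[OF z xb _ refl] x w S_eq[OF w(1)] by simp
  qed
  have "end_of (S \<i>) = end_of (S (of_real \<delta> * \<i>))"
    by (rule end_of_half_plane[OF _ S, of upper_half]) (use d in \<open>auto simp: upper_half_def\<close>)
  then show "end_of (S \<i>) = vend z (A * cis (- pi / ram z))" using key[OF _ ratio1] by simp
  have "end_of (S (- \<i>)) = end_of (S (of_real \<delta> * - \<i>))"
    by (rule end_of_half_plane[OF _ S, of lower_half]) (use d in \<open>auto simp: lower_half_def\<close>)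
  then show "end_of (S (- \<i>)) = vend z (A * cis (pi / ram z))" using key[of "- \<i>" "cis (pi / ram z)"] ratio2 by simp
qed

text \<open>At a small negative value the section lies in the normal disc of a vertex, on a ray
  whose direction \<open>A\<close> is a root of -1. Passing from \<open>\<i>\<close> to
  \<open>- \<i>\<close> across the negative axis is a counterclockwise turn around 0, from the end
  before \<open>A\<close> to the end after it.\<close>

lemma section_turns:
  assumes S: "is_section j slit_neg S"
  obtains z C where "j z = Some 0" "C ^ ram z = 1"
    "end_of (S \<i>) = vend z C" "end_of (S (- \<i>)) = vend z (C * cis (2 * pi / ram z))"
proof -
  obtain \<epsilon> where e: "\<epsilon> > 0" "\<epsilon> \<le> 1"
    "\<And>p w. j p = Some w \<Longrightarrow> norm w < \<epsilon> \<Longrightarrow> \<exists>z x. j z = Some 0 \<and> x \<in> ball 0 (vrad z) \<and> p = vmap z x"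
    using small_values_near_vertices by metis
  define w where "w = - complex_of_real (\<epsilon> / 2)"
  have w: "w \<in> slit_neg" "norm w < \<epsilon>" "w \<noteq> 0" using e by (auto simp: slit_neg_def w_def)
  have jw: "j (S w) = Some w" by (rule section_j[OF S w(1)])
  then obtain z x where z: "j z = Some 0" and x: "x \<in> ball 0 (vrad z)" "S w = vmap z x"
    using e(3) w(2) by blast
  have n: "ram z \<ge> 1" by (rule ram_pos[OF z])
  have xn: "x ^ ram z = w" using vmap_props(1)[OF z x(1)] x(2) jw by simp
  define A where "A = x / nrt (ram z) (- w)"
  have A: "A ^ ram z = -1"
    unfolding A_def power_divide xn using nrt_power[OF n, of "- w"] w(3) by simp
  have "w \<in> slit_neg \<inter> ball 0 (vrad z ^ ram z)" using w power_in_ball_iff[OF z x(1)] xn by simp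
  moreover have "S w = vmap z (A * nrt (ram z) (- w))" using x(2) by (simp add: A_def)
  ultimately have t: "end_of (S \<i>) = vend z (A * cis (- pi / ram z))"
    "end_of (S (- \<i>)) = vend z (A * cis (pi / ram z))"
    using turn_around_vertex[OF z A S] by blast+
  have "(A * cis (- pi / ram z)) ^ ram z = 1"
    unfolding power_mult_distrib A cis_over_power(2)[OF n] by simp
  from that[OF z this t(1)] t(2) show ?thesis by (simp only: cis_half_turns)
qed

text \<open>The section starts from a point on the ray midway between the two ends, where
  \<open>j\<close> is negative.\<close>

lemma turning_section_exists:
  assumes z: "j z = Some 0" and C: "C ^ ram z = 1"
  obtains S where "is_section j slit_neg S"
    "end_of (S \<i>) = vend z C" "end_of (S (- \<i>)) = vend z (C * cis (2 * pi / ram z))"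
proof -
  have n: "ram z \<ge> 1" by (rule ram_pos[OF z])
  define A where "A = C * cis (pi / ram z)"
  have A: "A ^ ram z = -1" 
    unfolding A_def power_mult_distrib C cis_over_power(1)[OF n] by simp
  define t where "t = vrad z / 2"
  have t: "0 < t" "t < vrad z" using vparam(3)[OF z] by (auto simp: t_def)
  have nA: "norm A = 1" using C n by (simp add: A_def norm_mult norm_root_of_unity)
  define w where "w = complex_of_real (- (t ^ ram z))"
  have mw: "- w = of_real t ^ ram z" by (simp add: w_def)

  have xb: "A * of_real t \<in> ball 0 (vrad z)" using t nA by (simp add: norm_mult)
  have xn: "(A * of_real t) ^ ram z = w" unfolding power_mult_distrib A w_def by simp
  have w: "w \<in> slit_neg" unfolding w_def slit_neg_def using t by (simp del: of_real_minus of_real_power)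
  have wb: "w \<in> ball 0 (vrad z ^ ram z)" using power_in_ball_iff[OF z xb] xn by simp
  have jx: "j (vmap z (A * of_real t)) = Some w" using vmap_props(1)[OF z xb] xn by simp
  define S where "S = lift slit_neg (vmap z (A * of_real t))"
  have S: "is_section j slit_neg S" "S w = vmap z (A * of_real t)"
    unfolding S_def using lift_section[OF _ jx w] by auto
  have "S w = vmap z (A * nrt (ram z) (- w))" unfolding mw using S(2) nrt_of_real[OF n t(1)] by simp
  from turn_around_vertex[OF z A S(1) IntI[OF w wb] this]
  have e: "end_of (S \<i>) = vend z (A * cis (- pi / ram z))"
    "end_of (S (- \<i>)) = vend z (A * cis (pi / ram z))" .
  show ?thesis
    by (rule that[OF S(1)]) (use e in \<open>simp_all only: A_def cis_half_turns\<close>)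
qed

end

section \<open>Directions of edge ends\<close>

definition \<omega> :: complex where "\<omega> = cis (2 * pi / 3)"

lemma omega_eq: "\<omega> = Complex (- 1 / 2) (sqrt 3 / 2)"
  unfolding \<omega>_def by (simp add: complex_eq_iff cos_120 sin_120)

lemma omega_cube: "\<omega> ^ 3 = 1"
  by (simp add: \<omega>_def Complex.DeMoivre)

lemma omega_sum: "1 + \<omega> + \<omega>\<^sup>2 = 0"
  by (simp add: omega_eq complex_eq_iff power2_eq_square)

lemma omega_nonzero [simp]: "\<omega> \<noteq> 0"
  by (simp add: \<omega>_def)

lemma omega_sq: "\<omega>\<^sup>2 = cis (4 * pi / 3)"
  by (simp add: \<omega>_def Complex.DeMoivre)

lemma omega_powers_distinct: "\<omega> \<noteq> 1" "\<omega>\<^sup>2 \<noteq> 1" "\<omega>\<^sup>2 \<noteq> \<omega>"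
proof -
  show "\<omega> \<noteq> 1" by (simp add: omega_eq complex_eq_iff)
  then show "\<omega>\<^sup>2 \<noteq> \<omega>" by (simp add: power2_eq_square)
  show "\<omega>\<^sup>2 \<noteq> 1" by (simp add: omega_eq complex_eq_iff power2_eq_square)
qed

lemma cube_roots_of_unity: "(C::complex) ^ 3 = 1 \<longleftrightarrow> C \<in> {1, \<omega>, \<omega>\<^sup>2}"
proof -
  have s: "\<omega>\<^sup>2 = - 1 - \<omega>" using omega_sum by (simp add: algebra_simps eq_neg_iff_add_eq_0)
  have "(C - \<omega>) * (C - \<omega>\<^sup>2) = C\<^sup>2 - (\<omega> + \<omega>\<^sup>2) * C + \<omega> ^ 3"
    by (simp add: algebra_simps power2_eq_square power3_eq_cube)
  also have "\<dots> = C\<^sup>2 + C + 1" by (simp add: omega_cube s)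
  finally have "(C - 1) * ((C - \<omega>) * (C - \<omega>\<^sup>2)) = C ^ 3 - 1"
    by (simp add: algebra_simps power2_eq_square power3_eq_cube)
  then show ?thesis by (metis eq_iff_diff_eq_0 insert_iff mult_eq_0_iff empty_iff)
qed

lemma Arg2pi_cis: "0 \<le> a \<Longrightarrow> a < 2 * pi \<Longrightarrow> Arg2pi (cis a) = a"
  by (rule Arg2pi_unique[of 1]) (auto simp: cis_conv_exp)

lemma Arg2pi_omega: "Arg2pi 1 = 0" "Arg2pi \<omega> = 2 * pi / 3" "Arg2pi (\<omega>\<^sup>2) = 4 * pi / 3"
  using Arg2pi_cis[of 0] Arg2pi_cis[of "2 * pi / 3"] Arg2pi_cis[of "4 * pi / 3"]
  by (auto simp: omega_sq) (simp_all add: \<omega>_def)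

text \<open>The common factor \<open>K\<close> cancels in the quotients, whose arguments are
  multiples of \<open>2 * pi / 3\<close>; a strict increase from a positive value leaves one
  possibility.\<close>

lemma counterclockwise_cube_roots:
  assumes C: "C1 ^ 3 = 1" "C2 ^ 3 = 1" "C3 ^ 3 = 1" and K: "K \<noteq> 0"
  shows "counterclockwise (C1 * K) (C2 * K) (C3 * K) \<longleftrightarrow> C2 = C1 * \<omega> \<and> C3 = C1 * \<omega>\<^sup>2"
proof -
  have C1: "C1 \<noteq> 0" using C(1) by auto
  have "(C2 / C1) ^ 3 = 1" "(C3 / C1) ^ 3 = 1" using C by (simp_all add: power_divide)
  then have q: "C2 / C1 \<in> {1, \<omega>, \<omega>\<^sup>2}" "C3 / C1 \<in> {1, \<omega>, \<omega>\<^sup>2}"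
    by (simp_all only: cube_roots_of_unity)
  have "counterclockwise (C1 * K) (C2 * K) (C3 * K) \<longleftrightarrow>
      0 < Arg2pi (C2 / C1) \<and> Arg2pi (C2 / C1) < Arg2pi (C3 / C1)"
    using K by (simp add: counterclockwise_def)
  also have "\<dots> \<longleftrightarrow> C2 / C1 = \<omega> \<and> C3 / C1 = \<omega>\<^sup>2"
    using q omega_powers_distinct by (auto simp: Arg2pi_omega)
  also have "\<dots> \<longleftrightarrow> C2 = C1 * \<omega> \<and> C3 = C1 * \<omega>\<^sup>2"
    using C1 by (auto simp: field_simps)
  finally show ?thesis .
qed

context dessin
begin

lemma valency_eq_ram:
  assumes z: "j z = Some 0"
  shows "card (ends_at j z) = ram z"
proof -
  have "inj_on (vend z) {C. C ^ ram z = 1}" using vend_inj[OF z] by (auto intro: inj_onI)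
  then show ?thesis
    unfolding ends_at_eq[OF z] using card_complex_roots_unity[OF ram_pos[OF z]] by (simp add: card_image)
qed

text \<open>A point of the normal disc on the end has some direction \<open>C'\<close> by
  \<open>end_of_vmap\<close>, and \<open>vend_inj\<close> forces \<open>C' = C\<close>. Thus near
  its vertex an end is exactly one ray, which is what the limit of directions requires.\<close>

lemma end_near_vertex:
  assumes z: "j z = Some 0" and C: "C ^ ram z = 1" and x: "x \<in> ball 0 (vrad z)"
  shows "vmap z x \<in> vend z C \<longleftrightarrow> (\<exists>t. 0 < t \<and> t < vrad z \<and> x = C * of_real t)"
proof
  assume "\<exists>t. 0 < t \<and> t < vrad z \<and> x = C * of_real t"
  then obtain t where t: "0 < t" "t < vrad z" "x = C * of_real t" by blast
  obtain s where s: "is_section j slit_mid s" "vend z C = s ` unit_interval"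
    "\<And>t. 0 < t \<Longrightarrow> t < vrad z \<Longrightarrow> s (of_real t ^ ram z) = vmap z (C * of_real t)"
    using vend_sectionE[OF z C] by blast
  show "vmap z x \<in> vend z C"
    unfolding s(2) t(3) s(3)[OF t(1,2), symmetric] using vend_base(4)[OF z C t(1,2)] by blast
next
  assume a: "vmap z x \<in> vend z C"
  have "vmap z x \<in> open_edges" using a sk_ends_subset[OF vend_in_sk_ends[OF z C]] by blast
  then have xu: "x ^ ram z \<in> unit_interval" using vmap_props(1)[OF z x] by (auto simp: open_edges_def)
  then have xm: "x ^ ram z \<in> slit_mid" using unit_interval_slit by blast
  define C' where "C' = x / nrt (ram z) (x ^ ram z)"
  note e = end_of_vmap[OF z x xm C'_def]
  have "end_of (vmap z x) = vend z C" by (rule sk_ends_eq_end_of[OF vend_in_sk_ends[OF z C] a])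
  then have "C' = C" using vend_inj[OF z e(1) C] e(2) by simp
  then have xC: "x = C * nrt (ram z) (x ^ ram z)" by (auto simp: C'_def)
  obtain r where r: "0 < r" "r < 1" "x ^ ram z = complex_of_real r" using xu by (auto simp: unit_interval_def)
  define t where "t = root (ram z) r"
  have t: "t > 0" "t ^ ram z = r" using r ram_pos[OF z] by (auto simp: t_def)
  have "nrt (ram z) (x ^ ram z) = of_real t"
    unfolding r(3) t(2)[symmetric] of_real_power by (rule nrt_of_real[OF ram_pos[OF z] t(1)])
  then have xt: "x = C * of_real t" using xC by simp
  moreover have "t < vrad z"
    using x t(1) norm_root_of_unity[OF C ram_pos[OF z]] by (simp add: xt norm_mult)
  ultimately show "\<exists>t. 0 < t \<and> t < vrad z \<and> x = C * of_real t" using t(1) by blast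
qed

text \<open>Let \<open>g\<close> be the inverse of the normal coordinate and \<open>d\<close> its
  derivative at 0. On the end \<open>g u\<close> is a positive multiple of \<open>C\<close>, so
  \<open>sgn u\<close> is \<open>C\<close> divided by \<open>sgn (g u / u)\<close>, which tends to
  \<open>sgn d\<close>. Being conformal, the coordinate change rotates all ends alike.\<close>

lemma end_directions:
  assumes z: "j z = Some 0"
  obtains K where "K \<noteq> 0" "\<And>C. C ^ ram z = 1 \<Longrightarrow> end_direction z (vend z C) = C * K"
proof -
  let ?\<eta> = "snd (vparam z)" and ?B = "ball 0 (vrad z) :: complex set"
  have lp: "?\<eta> holomorphic_on ?B" "inj_on ?\<eta> ?B" "?\<eta> 0 = 0" "vrad z > 0"
    using vparam(1)[OF z] by (auto simp: local_param_def)
  obtain g where g: "g holomorphic_on (?\<eta> ` ?B)" "\<And>x. x \<in> ?B \<Longrightarrow> deriv ?\<eta> x * deriv g (?\<eta> x) = 1"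
    "\<And>x. x \<in> ?B \<Longrightarrow> g (?\<eta> x) = x"
    using holomorphic_has_inverse[OF lp(1) open_ball lp(2)] by blast
  have op: "open (?\<eta> ` ?B)" by (rule open_mapping_thm3[OF lp(1) open_ball lp(2)])
  have zB: "0 \<in> ?B" using lp(4) by simp
  then have z\<eta>: "0 \<in> ?\<eta> ` ?B" using lp(3) by (metis imageI)
  define d where "d = deriv g 0"
  have "d \<noteq> 0" using g(2)[OF zB] lp(3) by (auto simp: d_def)
  have g0: "g 0 = 0" using g(3)[OF zB] lp(3) by simp
  have "(g has_field_derivative d) (at 0)"
    unfolding d_def by (rule holomorphic_derivI[OF g(1) op z\<eta>])
  then have lim: "((\<lambda>u. g u / u) \<longlongrightarrow> d) (at 0)"
    using g0 by (simp add: has_field_derivative_iff)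
  define K where "K = 1 / sgn d"
  show ?thesis
  proof (rule that)
    show "K \<noteq> 0" using \<open>d \<noteq> 0\<close> by (simp add: K_def sgn_zero_iff)
    fix C :: complex assume C: "C ^ ram z = 1"
    let ?A = "{u. P1_chart z u \<in> vend z C}"
    have nC: "norm C = 1" by (rule norm_root_of_unity[OF C ram_pos[OF z]])
    have A: "u \<in> ?A \<longleftrightarrow> (\<exists>t. 0 < t \<and> t < vrad z \<and> g u = C * of_real t)" if u: "u \<in> ?\<eta> ` ?B" for u
    proof -
      obtain x where x: "x \<in> ?B" "u = ?\<eta> x" using u by blast
      have "P1_chart z u = vmap z x" by (simp add: vmap_def x(2))
      moreover have "g u = x" using g(3) x by simp
      ultimately show ?thesis using end_near_vertex[OF z C x(1)] by simp
    qed
    have "((\<lambda>u. C / sgn (g u / u)) \<longlongrightarrow> C / sgn d) (at 0)"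
      using \<open>d \<noteq> 0\<close> by (intro tendsto_intros lim) (auto simp: sgn_zero_iff)
    then have lim2: "((\<lambda>u. C / sgn (g u / u)) \<longlongrightarrow> C / sgn d) (at 0 within ?A)"
      by (rule tendsto_within_subset) simp
    have "eventually (\<lambda>u. u \<in> ?\<eta> ` ?B) (at 0 within ?A)"
      using op z\<eta> by (metis eventually_at_topological)
    moreover have "eventually (\<lambda>u. u \<in> ?A \<and> u \<noteq> 0) (at 0 within ?A)"
      by (simp add: eventually_at_filter)
    ultimately have "eventually (\<lambda>u. C / sgn (g u / u) = sgn u) (at 0 within ?A)"
    proof eventually_elim
      case (elim u)
      then obtain t where t: "0 < t" "g u = C * of_real t" using A by blast
      have "sgn C = C" using nC by (simp add: sgn_div_norm)
      then have "sgn (g u / u) = C / sgn u"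
        using t by (simp add: sgn_divide sgn_mult sgn_of_real)
      moreover have "C \<noteq> 0" using nC by auto
      ultimately show ?case using elim by (simp add: sgn_zero_iff)
    qed
    then have "(sgn \<longlongrightarrow> C / sgn d) (at 0 within ?A)"
      using lim2 by (simp add: tendsto_cong)
    \<comment> \<open>The value of \<open>Lim\<close> is determined by convergence only along a
      nontrivial filter, so the end must accumulate at the vertex.\<close>
    moreover have "at 0 within ?A \<noteq> bot"
    proof -
      have "\<exists>u\<in>?A. u \<noteq> 0 \<and> dist u 0 < e" if e: "e > 0" for e
      proof -
        have "continuous (at 0) ?\<eta>"
          using lp(1) zB by (metis continuous_on_eq_continuous_at holomorphic_on_imp_continuous_on open_ball)
        then obtain \<delta> where dl: "\<delta> > 0" "\<And>x. norm x < \<delta> \<Longrightarrow> norm (?\<eta> x) < e"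
          using e lp(3) unfolding continuous_at_eps_delta by (auto simp: dist_norm)
        define t where "t = min \<delta> (vrad z) / 2"
        have t: "0 < t" "t < \<delta>" "t < vrad z" using dl(1) lp(4) by (auto simp: t_def)
        let ?x = "C * of_real t"
        have xb: "?x \<in> ?B" "norm ?x < \<delta>" "?x \<noteq> 0" using t nC by (auto simp: norm_mult)
        have "?\<eta> ?x \<noteq> 0" using inj_onD[OF lp(2) _ xb(1) zB] xb(3) lp(3) by auto
        moreover have "?\<eta> ?x \<in> ?A" using A[of "?\<eta> ?x"] g(3)[OF xb(1)] xb(1) t by auto
        ultimately show ?thesis using dl(2)[OF xb(2)] by auto
      qed
      then have "0 islimpt ?A" unfolding islimpt_approachable by blast
      then show ?thesis by (simp add: trivial_limit_within)
    qed
    ultimately show "end_direction z (vend z C) = C * K"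
      unfolding end_direction_def K_def by (simp add: tendsto_Lim)
  qed
qed

end

section \<open>The points over 1\<close>

text \<open>Exchanges the fibres over 0 and 1, so that the local theory at vertices applies to
  points over 1.\<close>

definition co :: "(P1 \<Rightarrow> P1) \<Rightarrow> P1 \<Rightarrow> P1" where
  "co j z = map_option (\<lambda>w. 1 - w) (j z)"

lemma co_eq_Some: "co j z = Some w \<longleftrightarrow> j z = Some (1 - w)"
  by (auto simp: co_def)

lemma continuous_map_one_minus: "continuous_map P1_top P1_top (map_option (\<lambda>w. 1 - w))"
  unfolding continuous_map_def
proof (intro conjI allI impI)
  fix U assume U: "openin P1_top U"
  have "open ((\<lambda>w. 1 - w) -` {t. Some t \<in> U})"
    using U by (intro open_vimage) (auto simp: openin_P1 intro!: continuous_intros)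
  then have 1: "open {w. Some (1 - w) \<in> U}" by (simp add: vimage_def)
  have 2: "\<exists>R. \<forall>t. norm t > R \<longrightarrow> Some (1 - t) \<in> U" if N: "None \<in> U"
  proof -
    obtain R where R: "\<And>t. norm t > R \<Longrightarrow> Some t \<in> U" using U N by (auto simp: openin_P1)
    have "Some (1 - t) \<in> U" if "norm t > R + 1" for t
    proof -
      have "norm t \<le> norm (1 - t) + norm (1::complex)"
        using norm_triangle_sub[of t 1] by (simp add: norm_minus_commute)
      then show ?thesis using R that by simp
    qed
    then show ?thesis by blast
  qed
  show "openin P1_top {x \<in> topspace P1_top. map_option (\<lambda>w. 1 - w) x \<in> U}"
    using 1 2 by (simp add: openin_P1)
qed simp

context dessin
begin

lemma dessin_co: "dessin (co j) ram"
proof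
  have "co j = map_option (\<lambda>w. 1 - w) \<circ> j" by (auto simp: co_def)
  then show "continuous_map P1_top P1_top (co j)"
    using continuous_map_compose[OF cont continuous_map_one_minus] by simp
  fix z v
  show "finite {z. co j z = Some v}" using fin[of "1 - v"] by (simp add: co_eq_Some)
  assume cz: "co j z = Some v"
  then have jz: "j z = Some (1 - v)" by (simp add: co_eq_Some)
  show n: "ram z \<ge> 1" by (rule ram_pos[OF jz])
  show "v \<notin> {0, 1} \<Longrightarrow> ram z = 1" using unram[OF jz] by auto
  obtain \<rho> \<eta> where lp: "local_param j z (1 - v) (ram z) \<rho> \<eta>" using param_ex[OF jz] by blast
  \<comment> \<open>The sign in \<open>1 - w\<close> is absorbed into the normal coordinate by a
    factor whose \<open>ram z\<close>-th power is -1.\<close>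
  define c where "c = cis (pi / ram z)"
  have c: "c ^ ram z = -1" "norm c = 1" using cis_over_power(1)[OF n] by (auto simp: c_def)
  have c0: "c \<noteq> 0" using c(2) by auto
  have b: "c * x \<in> ball 0 \<rho>" if "x \<in> ball 0 \<rho>" for x :: complex using that c(2) by (simp add: norm_mult)
  have "local_param (co j) z v (ram z) \<rho> (\<lambda>x. \<eta> (c * x))"
    unfolding local_param_def
  proof (intro conjI ballI)
    show "\<rho> > 0" "\<eta> (c * 0) = 0" using lp by (auto simp: local_param_def)
    have h: "(\<lambda>x. c * x) holomorphic_on ball 0 \<rho>" by (intro holomorphic_intros)
    have "\<eta> holomorphic_on ((\<lambda>x. c * x) ` ball 0 \<rho>)"
      using lp b by (auto simp: local_param_def intro: holomorphic_on_subset)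
    from holomorphic_on_compose[OF h this]
    show "(\<lambda>x. \<eta> (c * x)) holomorphic_on ball 0 \<rho>" by (simp add: comp_def)
    show "inj_on (\<lambda>x. \<eta> (c * x)) (ball 0 \<rho>)"
    proof (rule inj_onI)
      fix x y :: complex assume "x \<in> ball 0 \<rho>" "y \<in> ball 0 \<rho>" "\<eta> (c * x) = \<eta> (c * y)"
      then have "c * x = c * y" using lp b unfolding local_param_def by (metis inj_onD)
      then show "x = y" using c0 by simp
    qed
    fix x :: complex assume "x \<in> ball 0 \<rho>"
    then have "j (P1_chart z (\<eta> (c * x))) = Some (1 - v + (c * x) ^ ram z)"
      by (intro local_param_j(1)[OF lp] b)
    then show "co j (P1_chart z (\<eta> (c * x))) = Some (v + x ^ ram z)"
      unfolding power_mult_distrib c(1) by (simp add: co_eq_Some)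
  qed
  then show "\<exists>\<rho> \<eta>. local_param (co j) z v (ram z) \<rho> \<eta>" by blast
qed

end

lemma is_section_co:
  assumes "is_section (co j) \<Omega> s"
  shows "is_section j ((\<lambda>w. 1 - w) ` \<Omega>) (\<lambda>w. s (1 - w))"
  unfolding is_section_def
proof (intro conjI ballI)
  have c1: "continuous_map (top_of_set ((\<lambda>w. 1 - w) ` \<Omega>)) (top_of_set \<Omega>) (\<lambda>w. 1 - w)"
    by (auto intro!: continuous_intros)
  have c2: "continuous_map (top_of_set \<Omega>) P1_top s" using assms by (simp add: is_section_def)
  from continuous_map_compose[OF c1 c2]
  show "continuous_map (top_of_set ((\<lambda>w. 1 - w) ` \<Omega>)) P1_top (\<lambda>w. s (1 - w))"
    by (simp add: comp_def)
  fix w assume "w \<in> (\<lambda>w. 1 - w) ` \<Omega>"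
  then have "1 - w \<in> \<Omega>" by auto
  then have "co j (s (1 - w)) = Some (1 - w)" using assms by (simp add: is_section_def)
  then show "j (s (1 - w)) = Some w" by (simp add: co_eq_Some)
qed

lemma co_co: "co (co j) = j"
  by (auto simp: co_def option.map_comp comp_def option.map_ident)

lemma one_minus_image:
  "(\<lambda>w. 1 - w) ` slit_mid = slit_mid" "(\<lambda>w. 1 - w) ` slit_neg = slit_pos"
  "(\<lambda>w. 1 - w) ` slit_pos = slit_neg" "(\<lambda>w. 1 - w) ` unit_interval = unit_interval"
proof -
  have im: "(\<lambda>w. 1 - w) ` A = {w. 1 - w \<in> A}" for A :: "complex set"
    by (auto intro: image_eqI[of _ _ "1 - w" for w])
  show "(\<lambda>w. 1 - w) ` slit_mid = slit_mid" "(\<lambda>w. 1 - w) ` slit_neg = slit_pos"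
    "(\<lambda>w. 1 - w) ` slit_pos = slit_neg"
    unfolding im by (auto simp: slit_defs)
  show "(\<lambda>w. 1 - w) ` unit_interval = unit_interval"
  proof -
    have "1 - w \<in> unit_interval" if "w \<in> unit_interval" for w
    proof -
      obtain r where "0 < r" "r < 1" "w = complex_of_real r" using \<open>w \<in> unit_interval\<close> by (auto simp: unit_interval_def)
      then show ?thesis unfolding unit_interval_def by (intro image_eqI[of _ _ "1 - r"]) auto
    qed
    then show ?thesis unfolding im by force
  qed
qed

context dessin
begin

lemma co_open_edges: "dessin.open_edges (co j) = open_edges"
proof -
  interpret co: dessin "co j" ram by (rule dessin_co)
  have 1: "1 - w \<in> unit_interval" if "w \<in> unit_interval" for w
    using that one_minus_image(4) by blast
  show ?thesis
    unfolding co.open_edges_def open_edges_def using 1 by (force simp: co_def)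
qed

lemma co_end_of:
  assumes "j p = Some w" "w \<in> slit_mid"
  shows "dessin.end_of (co j) p = end_of p"
proof -
  interpret co: dessin "co j" ram by (rule dessin_co)
  have "co j p = Some (1 - w)" using assms by (simp add: co_eq_Some)
  moreover have "1 - w \<in> slit_mid" using assms one_minus_image(1) by blast
  ultimately obtain s where s: "is_section (co j) slit_mid s" "s (1 - w) = p"
    "co.end_of p = s ` unit_interval"
    by (rule co.mid_section)
  have "is_section j slit_mid (\<lambda>w. s (1 - w))"
    using is_section_co[OF s(1)] one_minus_image(1) by simp
  from end_of_section[OF this assms(2)] s(2)
  have "end_of p = (\<lambda>w. s (1 - w)) ` unit_interval" by simp
  also have "\<dots> = s ` ((\<lambda>w. 1 - w) ` unit_interval)" by (simp add: image_image)
  finally show ?thesis using s(3) one_minus_image(4) by simp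
qed

lemma co_sk_ends: "sk_ends (co j) = sk_ends j"
proof -
  interpret co: dessin "co j" ram by (rule dessin_co)
  have "co.end_of p = end_of p" if "p \<in> open_edges" for p
    using that unit_interval_slit co_end_of[of p] by (auto simp: open_edges_def)
  then show ?thesis unfolding co.sk_ends_eq sk_ends_eq co_open_edges by (intro image_cong) auto
qed

lemma co_ends_at: "ends_at (co j) q = ends_at j q"
  by (simp add: ends_at_def co_sk_ends)

text \<open>Edge ends at a point over 1, named by their directions in a normal coordinate for
  \<open>1 - j\<close>.\<close>

definition wend :: "P1 \<Rightarrow> complex \<Rightarrow> P1 set" where
  "wend = dessin.vend (co j) ram"

lemma co_over_1: "j q = Some 1 \<Longrightarrow> co j q = Some 0"
  by (simp add: co_eq_Some)

lemma ends_at_1: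
  assumes q: "j q = Some 1"
  shows "ends_at j q = wend q ` {C. C ^ ram q = 1}" "card (ends_at j q) = ram q"
    "C ^ ram q = 1 \<Longrightarrow> C' ^ ram q = 1 \<Longrightarrow> wend q C = wend q C' \<Longrightarrow> C = C'"
proof -
  interpret co: dessin "co j" ram by (rule dessin_co)
  show "ends_at j q = wend q ` {C. C ^ ram q = 1}" "card (ends_at j q) = ram q"
    "C ^ ram q = 1 \<Longrightarrow> C' ^ ram q = 1 \<Longrightarrow> wend q C = wend q C' \<Longrightarrow> C = C'"
    using co.ends_at_eq[OF co_over_1[OF q]] co.valency_eq_ram[OF co_over_1[OF q]]
      co.vend_inj[OF co_over_1[OF q]]
    unfolding co_ends_at wend_def by blast+
qed

lemma end_has_point_over_1:
  assumes "h \<in> sk_ends j"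
  obtains q where "j q = Some 1" "h \<in> ends_at j q"
proof -
  interpret co: dessin "co j" ram by (rule dessin_co)
  have "h \<in> sk_ends (co j)" using assms co_sk_ends by simp
  then obtain q where "co j q = Some 0" "h \<in> ends_at (co j) q" by (rule co.end_has_vertex)
  then show ?thesis using that[of q] by (simp add: co_eq_Some co_ends_at)
qed

lemma end_point_over_1_unique:
  assumes "j q = Some 1" "h \<in> ends_at j q" "j q' = Some 1" "h \<in> ends_at j q'"
  shows "q = q'"
proof -
  interpret co: dessin "co j" ram by (rule dessin_co)
  show ?thesis
    using co.end_vertex_unique[of q h q'] assms co_over_1 co_ends_at by simp
qed

lemma co_section_pos:
  assumes "is_section j slit_pos S"
  shows "is_section (co j) slit_neg (\<lambda>w. S (1 - w))"
  using is_section_co[of "co j" slit_pos S] assms by (simp add: co_co one_minus_image)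

lemma co_section_neg:
  assumes "is_section (co j) slit_neg S"
  shows "is_section j slit_pos (\<lambda>w. S (1 - w))"
  using is_section_co[OF assms] by (simp add: one_minus_image)

text \<open>The numbers \<open>1 - u\<close> and \<open>- u\<close> lie in the same half plane,
  hence belong to the same sheet and the same end.\<close>

lemma co_end_of_flip:
  assumes S: "is_section j slit_pos S" and u: "u \<in> {\<i>, - \<i>}"
  shows "dessin.end_of (co j) (S (1 - u)) = end_of (S (- u))"
proof -
  have "1 - u \<in> slit_pos" "1 - u \<in> slit_mid" using u by (auto simp: slit_defs)
  then have "dessin.end_of (co j) (S (1 - u)) = end_of (S (1 - u))"
    using co_end_of section_j[OF S] by blast
  also have "\<dots> = end_of (S (- u))"
    using u end_of_half_plane[OF _ S, of upper_half "1 - u" "- u"]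
      end_of_half_plane[OF _ S, of lower_half "1 - u" "- u"]
    by (auto simp: upper_half_def lower_half_def)
  finally show ?thesis .
qed

text \<open>Counterclockwise around 1, the ray beyond 1 is crossed from below to above. Therefore
  \<open>- \<i>\<close> comes first here, in contrast to sections over
  \<open>slit_neg\<close>.\<close>

lemma section_pos_turns:
  assumes S: "is_section j slit_pos S"
  obtains q C where "j q = Some 1" "C ^ ram q = 1"
    "end_of (S (- \<i>)) = wend q C" "end_of (S \<i>) = wend q (C * cis (2 * pi / ram q))"
proof -
  interpret co: dessin "co j" ram by (rule dessin_co)
  obtain q C where q: "co j q = Some 0" "C ^ ram q = 1"
    "co.end_of (S (1 - \<i>)) = co.vend q C" "co.end_of (S (1 - (- \<i>))) = co.vend q (C * cis (2 * pi / ram q))"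
    using co.section_turns[OF co_section_pos[OF S]] .
  show ?thesis
    by (rule that[of q C])
      (use q co_end_of_flip[OF S, of \<i>] co_end_of_flip[OF S, of "- \<i>"] in \<open>auto simp: co_eq_Some wend_def\<close>)
qed

lemma turning_section_pos_exists:
  assumes q: "j q = Some 1" and C: "C ^ ram q = 1"
  obtains S where "is_section j slit_pos S"
    "end_of (S (- \<i>)) = wend q C" "end_of (S \<i>) = wend q (C * cis (2 * pi / ram q))"
proof -
  interpret co: dessin "co j" ram by (rule dessin_co)
  obtain S where S: "is_section (co j) slit_neg S" "co.end_of (S \<i>) = co.vend q C"
    "co.end_of (S (- \<i>)) = co.vend q (C * cis (2 * pi / ram q))"
    using co.turning_section_exists[OF co_over_1[OF q] C] .
  have S': "is_section j slit_pos (\<lambda>w. S (1 - w))" by (rule co_section_neg[OF S(1)])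
  show ?thesis
    by (rule that[OF S'])
      (use S co_end_of_flip[OF S', of \<i>] co_end_of_flip[OF S', of "- \<i>"] in \<open>auto simp: wend_def\<close>)
qed

section \<open>Edges\<close>

text \<open>Every edge, hanging or not, contains one point over 1 and is the star of that
  point.\<close>

definition edge_through :: "P1 \<Rightarrow> P1 set" where
  "edge_through q = insert q (\<Union>(ends_at j q))"

lemma skeleton_edges: "skeleton j - sk_vertices j = open_edges \<union> {z. j z = Some 1}"
proof -
  have "{z. j z = Some 1} \<subseteq> skeleton j - sk_vertices j"
    by (auto simp: skeleton_def sk_vertices_def intro!: exI[of _ 1])
  then show ?thesis using skeleton_open_edges by blast
qed

lemma ends_at_sk_ends: "h \<in> ends_at j q \<Longrightarrow> h \<in> sk_ends j"
  by (simp add: ends_at_def)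

lemma sk_ends_disjoint: "h \<in> sk_ends j \<Longrightarrow> h' \<in> sk_ends j \<Longrightarrow> p \<in> h \<Longrightarrow> p \<in> h' \<Longrightarrow> h = h'"
  using sk_ends_eq_end_of by blast

lemma not_open_edge: "j q = Some 1 \<Longrightarrow> q \<notin> open_edges"
  by (auto simp: open_edges_def unit_interval_def)

lemma sk_ends_nonempty: "h \<in> sk_ends j \<Longrightarrow> \<exists>p. p \<in> h"
  unfolding sk_ends_eq using open_edges_section by blast

text \<open>In the normal disc of \<open>1 - j\<close> at \<open>q\<close>, the only point over 1 is
  \<open>q\<close>, and by \<open>end_of_vmap\<close> any point of an open edge lies on an end at
  \<open>q\<close>.\<close>

lemma neighbourhood_over_1:
  assumes q: "j q = Some 1"
  obtains N where "openin P1_top N" "q \<in> N" "N \<inter> (open_edges \<union> {z. j z = Some 1}) \<subseteq> edge_through q"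
proof -
  interpret co: dessin "co j" ram by (rule dessin_co)
  note cq = co_over_1[OF q]
  let ?N = "co.vmap q ` ball 0 (co.vrad q)"
  show ?thesis
  proof (rule that)
    show "openin P1_top ?N" by (rule co.vmap_props(5)[OF cq])
    show "q \<in> ?N"
      by (rule image_eqI[of _ _ 0]) (use co.vmap_props(3)[OF cq] co.vparam(3)[OF cq] in auto)
    show "?N \<inter> (open_edges \<union> {z. j z = Some 1}) \<subseteq> edge_through q"
    proof
      fix p assume p: "p \<in> ?N \<inter> (open_edges \<union> {z. j z = Some 1})"
      then obtain x where x: "x \<in> ball 0 (co.vrad q)" "p = co.vmap q x" by blast
      have jp: "co j p = Some (x ^ ram q)" using co.vmap_props(1)[OF cq x(1)] x(2) by simp
      show "p \<in> edge_through q"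
      proof (cases "j p = Some 1")
        case True
        then have "x ^ ram q = 0" using jp by (simp add: co_eq_Some)
        then have "x = 0" by simp
        then show ?thesis using co.vmap_props(3)[OF cq] x(2) by (simp add: edge_through_def)
      next
        case False
        then have po: "p \<in> open_edges" using p by simp
        then have "co j p \<in> Some ` unit_interval" using co_open_edges unfolding co.open_edges_def by blast
        then have "x ^ ram q \<in> unit_interval" using jp by auto
        then have "x ^ ram q \<in> slit_mid" using unit_interval_slit by blast
        from co.end_of_vmap[OF cq x(1) this refl] x(2)
        have "co.end_of p \<in> ends_at j q"
          unfolding co_ends_at[symmetric] co.ends_at_eq[OF cq] by blast
        moreover have "co.end_of p = end_of p"
          using po co_end_of[of p] unit_interval_slit by (auto simp: open_edges_def)
        moreover have "p \<in> end_of p" using open_edges_section[OF po] by blast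
        ultimately show ?thesis by (auto simp: edge_through_def)
      qed
    qed
  qed
qed

text \<open>The stars are disjoint because an end has only one point over 1. They are relatively
  open: near the point over 1 by \<open>neighbourhood_over_1\<close>, elsewhere because the sheet of
  an end is open.\<close>

lemma sk_edges_eq: "sk_edges j = edge_through ` {q. j q = Some 1}"
  unfolding sk_edges_def skeleton_edges
proof (rule connected_components_of_open_partition)
  let ?E = "open_edges \<union> {z. j z = Some 1}"
  have sub: "edge_through q \<subseteq> ?E" if "j q = Some 1" for q
    using that sk_ends_subset ends_at_sk_ends by (force simp: edge_through_def)
  show "\<Union>(edge_through ` {q. j q = Some 1}) = topspace (subtopology P1_top ?E)"
  proof -
    have "\<exists>q. j q = Some 1 \<and> p \<in> edge_through q" if p: "p \<in> ?E" for p
    proof (cases "j p = Some 1")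
      case True
      then show ?thesis by (auto simp: edge_through_def)
    next
      case False
      then have po: "p \<in> open_edges" using p by simp
      then have "end_of p \<in> sk_ends j" unfolding sk_ends_eq by blast
      then obtain q where "j q = Some 1" "end_of p \<in> ends_at j q" by (rule end_has_point_over_1)
      moreover have "p \<in> end_of p" using open_edges_section[OF po] by blast
      ultimately show ?thesis unfolding edge_through_def by blast
    qed
    then show ?thesis using sub by auto
  qed
  show "pairwise disjnt (edge_through ` {q. j q = Some 1})"
    unfolding pairwise_def disjnt_def
  proof (intro ballI impI)
    fix A B assume "A \<in> edge_through ` {q. j q = Some 1}" "B \<in> edge_through ` {q. j q = Some 1}" "A \<noteq> B"
    then obtain q q' where q: "j q = Some 1" "j q' = Some 1" "A = edge_through q" "B = edge_through q'" "q \<noteq> q'"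
      by blast
    show "A \<inter> B = {}"
    proof (rule ccontr)
      assume "A \<inter> B \<noteq> {}"
      then obtain p where p: "p \<in> edge_through q" "p \<in> edge_through q'" using q by blast
      have noq: "q \<notin> h" if "j q = Some 1" "h \<in> sk_ends j" for q h
        using that not_open_edge sk_ends_subset by blast
      from p obtain h h' where h: "h \<in> ends_at j q" "h' \<in> ends_at j q'" "p \<in> h" "p \<in> h'"
        using q noq ends_at_sk_ends unfolding edge_through_def by blast
      then have "h = h'" using sk_ends_disjoint ends_at_sk_ends by blast
      then show False using end_point_over_1_unique h q by blast
    qed
  qed
  fix A assume "A \<in> edge_through ` {q. j q = Some 1}"
  then obtain q where q: "j q = Some 1" "A = edge_through q" by blast
  \<comment> \<open>An end with \<open>q\<close> added lies between the end and its closure and so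
    is connected; all these sets share \<open>q\<close>.\<close>
  have "connectedin P1_top (\<Union>(insert {q} (insert q ` ends_at j q)))"
  proof (rule connectedin_Union)
    fix S assume "S \<in> insert {q} (insert q ` ends_at j q)"
    then consider "S = {q}" | h where "h \<in> ends_at j q" "S = insert q h" by blast
    then show "connectedin P1_top S"
    proof cases
      case 2
      then have h: "h \<in> sk_ends j" "q \<in> P1_top closure_of h" by (auto simp: ends_at_def)
      from h(1) have "connectedin P1_top h"
        unfolding sk_ends_eq using connectedin_end_of by blast
      moreover have "insert q h \<subseteq> P1_top closure_of h"
        using h(2) closure_of_subset[of h P1_top] by simp
      ultimately show ?thesis
        unfolding 2(2) by (rule connectedin_intermediate_closure_of[OF _ subset_insertI])
    qed simp
  next
    have "q \<in> \<Inter>(insert {q} (insert q ` ends_at j q))" by blast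
    then show "\<Inter>(insert {q} (insert q ` ends_at j q)) \<noteq> {}" by blast
  qed
  moreover have "\<Union>(insert {q} (insert q ` ends_at j q)) = A"
    by (auto simp: q(2) edge_through_def)
  ultimately have "connectedin (subtopology P1_top ?E) A"
    using sub[OF q(1)] q(2) by (simp add: connectedin_subtopology)
  moreover have "openin (subtopology P1_top ?E) A"
  proof (subst openin_subopen, intro ballI)
    fix p assume p: "p \<in> A"
    show "\<exists>T. openin (subtopology P1_top ?E) T \<and> p \<in> T \<and> T \<subseteq> A"
    proof (cases "p = q")
      case True
      obtain N where N: "openin P1_top N" "q \<in> N" "N \<inter> ?E \<subseteq> edge_through q"
        using neighbourhood_over_1[OF q(1)] .
      have "openin (subtopology P1_top ?E) (N \<inter> ?E)" using N(1) by (auto simp: openin_subtopology)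
      then show ?thesis using N True q by blast
    next
      case False
      then obtain h where h: "h \<in> ends_at j q" "p \<in> h" using p q(2) by (auto simp: edge_through_def)
      obtain s where s: "is_section j slit_mid s" "h = s ` unit_interval"
        using sk_endsE[OF ends_at_sk_ends[OF h(1)]] .
      have "openin P1_top (s ` slit_mid)"
        by (rule section_openin[OF s(1) open_slit slit_avoids]) simp_all
      then have "openin (subtopology P1_top ?E) (s ` slit_mid \<inter> ?E)" by (auto simp: openin_subtopology)
      moreover have "z \<notin> s ` slit_mid" if "j z = Some 1" for z
        using that section_j[OF s(1)] slit_avoids(2)[of slit_mid] by auto
      then have "s ` slit_mid \<inter> ?E = h"
        using end_of_eq_section_image[OF s(1)] s(2) by blast
      ultimately show ?thesis using h q(2) by (auto simp: edge_through_def)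
    qed
  qed
  ultimately show "A \<noteq> {} \<and> connectedin (subtopology P1_top ?E) A \<and> openin (subtopology P1_top ?E) A"
    using q(2) by (auto simp: edge_through_def)
qed

lemma ends_of_edge_through:
  assumes q: "j q = Some 1"
  shows "ends_of_edge j (edge_through q) = ends_at j q"
proof
  show "ends_at j q \<subseteq> ends_of_edge j (edge_through q)"
    by (auto simp: ends_of_edge_def edge_through_def ends_at_sk_ends)
  show "ends_of_edge j (edge_through q) \<subseteq> ends_at j q"
  proof
    fix h assume "h \<in> ends_of_edge j (edge_through q)"
    then have h: "h \<in> sk_ends j" "h \<subseteq> edge_through q" by (auto simp: ends_of_edge_def)
    obtain p where p: "p \<in> h" using sk_ends_nonempty[OF h(1)] by blast
    have "p \<noteq> q" using p not_open_edge[OF q] sk_ends_subset[OF h(1)] by blast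
    then obtain h' where "h' \<in> ends_at j q" "p \<in> h'" using p h(2) by (auto simp: edge_through_def)
    then show "h \<in> ends_at j q" using sk_ends_disjoint[OF h(1) _ p] ends_at_sk_ends by blast
  qed
qed

end

section \<open>Markings as labellings of edge ends\<close>

text \<open>The monodromy of the three branches of \<open>y\<close>: the 3-cycle of a turn around 0,
  and the transposition of 2 and 3 (which is \<open>5 - i\<close>) of a turn around 1.\<close>

definition next_index :: "nat \<Rightarrow> nat" where "next_index i = (if i = 3 then 1 else i + 1)"
definition flip_index :: "nat \<Rightarrow> nat" where "flip_index i = (if i = 1 then 1 else 5 - i)"

context dessin
begin

text \<open>The points \<open>\<i>\<close> and \<open>- \<i>\<close> merely represent the half
  planes. In terms of sections the conditions are gluing data: they relate the branch indices above
  and below an interval that a section crosses.\<close>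

definition compatible :: "(P1 set \<Rightarrow> nat) \<Rightarrow> bool" where
  "compatible lab \<longleftrightarrow> (\<forall>h\<in>sk_ends j. lab h \<in> {1, 2, 3}) \<and>
     (\<forall>S. is_section j slit_neg S \<longrightarrow> lab (end_of (S (- \<i>))) = next_index (lab (end_of (S \<i>)))) \<and>
     (\<forall>S. is_section j slit_pos S \<longrightarrow> lab (end_of (S (- \<i>))) = flip_index (lab (end_of (S \<i>))))"

text \<open>Sections over \<open>slit_neg\<close> and pairs of consecutive ends at a vertex
  determine the same pairs of ends.\<close>

lemma turns_neg_iff:
  "(\<forall>S. is_section j slit_neg S \<longrightarrow> P (end_of (S \<i>)) (end_of (S (- \<i>)))) \<longleftrightarrow>
   (\<forall>z C. j z = Some 0 \<longrightarrow> C ^ ram z = 1 \<longrightarrow> P (vend z C) (vend z (C * cis (2 * pi / ram z))))"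
  (is "?L \<longleftrightarrow> ?R")
proof
  assume L: ?L
  show ?R
  proof (intro allI impI)
    fix z and C :: complex assume "j z = Some 0" "C ^ ram z = 1"
    then obtain S where "is_section j slit_neg S"
      "end_of (S \<i>) = vend z C" "end_of (S (- \<i>)) = vend z (C * cis (2 * pi / ram z))"
      by (rule turning_section_exists)
    with L show "P (vend z C) (vend z (C * cis (2 * pi / ram z)))" by metis
  qed
next
  assume R: ?R
  show ?L
  proof (intro allI impI)
    fix S assume "is_section j slit_neg S"
    then obtain z C where "j z = Some 0" "C ^ ram z = 1"
      "end_of (S \<i>) = vend z C" "end_of (S (- \<i>)) = vend z (C * cis (2 * pi / ram z))"
      by (rule section_turns)
    with R show "P (end_of (S \<i>)) (end_of (S (- \<i>)))" by metis
  qed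
qed

lemma turns_pos_iff:
  "(\<forall>S. is_section j slit_pos S \<longrightarrow> P (end_of (S \<i>)) (end_of (S (- \<i>)))) \<longleftrightarrow>
   (\<forall>q C. j q = Some 1 \<longrightarrow> C ^ ram q = 1 \<longrightarrow> P (wend q (C * cis (2 * pi / ram q))) (wend q C))"
  (is "?L \<longleftrightarrow> ?R")
proof
  assume L: ?L
  show ?R
  proof (intro allI impI)
    fix q and C :: complex assume "j q = Some 1" "C ^ ram q = 1"
    then obtain S where "is_section j slit_pos S"
      "end_of (S (- \<i>)) = wend q C" "end_of (S \<i>) = wend q (C * cis (2 * pi / ram q))"
      by (rule turning_section_pos_exists)
    with L show "P (wend q (C * cis (2 * pi / ram q))) (wend q C)" by metis
  qed
next
  assume R: ?R
  show ?L
  proof (intro allI impI)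
    fix S assume "is_section j slit_pos S"
    then obtain q C where "j q = Some 1" "C ^ ram q = 1"
      "end_of (S (- \<i>)) = wend q C" "end_of (S \<i>) = wend q (C * cis (2 * pi / ram q))"
      by (rule section_pos_turns)
    with R show "P (end_of (S \<i>)) (end_of (S (- \<i>)))" by metis
  qed
qed

lemma ends_over_1_cases:
  assumes q: "j q = Some 1" and r: "ram q \<le> 2"
  shows "(\<forall>C. C ^ ram q = 1 \<longrightarrow> P (wend q (C * cis (2 * pi / ram q))) (wend q C)) \<longleftrightarrow>
    (\<exists>h. ends_at j q = {h} \<and> P h h) \<or> (\<exists>h h'. h \<noteq> h' \<and> ends_at j q = {h, h'} \<and> P h h' \<and> P h' h)"
    (is "?L \<longleftrightarrow> ?R")
proof -
  have "ram q = 1 \<or> ram q = 2" using ram_pos[OF q] r by linarith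
  then show ?thesis
  proof
    assume n: "ram q = 1"
    have e: "ends_at j q = {wend q 1}" using ends_at_1(1)[OF q] by (simp add: n)
    then have "(\<exists>h h'. h \<noteq> h' \<and> ends_at j q = {h, h'} \<and> P h h' \<and> P h' h) = False"
      by (auto simp: doubleton_eq_iff)
    then show ?thesis using e by (simp add: n)
  next
    assume n: "ram q = 2"
    have rt: "C ^ 2 = 1 \<longleftrightarrow> C = 1 \<or> C = -1" for C :: complex by (rule power2_eq_1_iff)
    have "{C::complex. C ^ 2 = 1} = {1, -1}" by (auto simp: rt)
    then have e: "ends_at j q = {wend q 1, wend q (-1)}" using ends_at_1(1)[OF q] by (simp add: n)
    have ne: "wend q 1 \<noteq> wend q (-1)" using ends_at_1(3)[OF q, of 1 "-1"] by (auto simp: n)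
    have "?L \<longleftrightarrow> P (wend q 1) (wend q (-1)) \<and> P (wend q (-1)) (wend q 1)"
      by (auto simp: n rt)
    moreover have "?R \<longleftrightarrow> P (wend q 1) (wend q (-1)) \<and> P (wend q (-1)) (wend q 1)"
      unfolding e using ne by (auto simp: doubleton_eq_iff)
    ultimately show ?thesis by blast
  qed
qed

text \<open>On the labels 1, 2, 3 the map \<open>flip_index\<close> is an involution fixing only 1.
  Hence a single end at a point over 1 is labelled 1, and for two ends one of the two equations
  suffices.\<close>

lemma compatible_iff:
  assumes r0: "\<forall>z. j z = Some 0 \<longrightarrow> ram z \<le> 3" and r1: "\<forall>z. j z = Some 1 \<longrightarrow> ram z \<le> 2"
  shows "compatible lab \<longleftrightarrow> (\<forall>h\<in>sk_ends j. lab h \<in> {1, 2, 3}) \<and>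
    (\<forall>z. j z = Some 0 \<longrightarrow> ram z = 3 \<and>
       (\<forall>C. C ^ 3 = 1 \<longrightarrow> lab (vend z (C * \<omega>)) = next_index (lab (vend z C)))) \<and>
    (\<forall>q. j q = Some 1 \<longrightarrow> (\<exists>h. ends_at j q = {h} \<and> lab h = 1) \<or>
       (\<exists>h h'. h \<noteq> h' \<and> ends_at j q = {h, h'} \<and> lab h' = flip_index (lab h)))"
proof -
  have V: "(\<forall>C. C ^ ram z = 1 \<longrightarrow> lab (vend z (C * cis (2 * pi / ram z))) = next_index (lab (vend z C))) \<longleftrightarrow>
      ram z = 3 \<and> (\<forall>C. C ^ 3 = 1 \<longrightarrow> lab (vend z (C * \<omega>)) = next_index (lab (vend z C)))"
    if z: "j z = Some 0" and lab: "\<forall>h\<in>sk_ends j. lab h \<in> {1, 2, 3}" for z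
  proof -
    have l: "lab (vend z 1) \<in> {1, 2, 3}" using lab vend_in_sk_ends[OF z] by simp
    have "ram z = 3" if a: "\<forall>C. C ^ ram z = 1 \<longrightarrow>
        lab (vend z (C * cis (2 * pi / ram z))) = next_index (lab (vend z C))"
    proof -
      have "ram z \<in> {1, 2, 3}" using ram_pos[OF z] r0[rule_format, OF z] by auto
      then consider "ram z = 1" | "ram z = 2" | "ram z = 3" by auto
      then show ?thesis
      proof cases
        case 1
        then have "lab (vend z 1) = next_index (lab (vend z 1))" using a[rule_format, of 1] by simp
        then show ?thesis using l by (auto simp: next_index_def split: if_splits)
      next
        case 2
        then have "lab (vend z (-1)) = next_index (lab (vend z 1))"
          "lab (vend z 1) = next_index (lab (vend z (-1)))"
          using a[rule_format, of 1] a[rule_format, of "-1"] by simp_all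
        then show ?thesis using l by (auto simp: next_index_def split: if_splits)
      qed
    qed
    then show ?thesis by (auto simp: \<omega>_def)
  qed
  have W: "(\<forall>C. C ^ ram q = 1 \<longrightarrow> lab (wend q C) = flip_index (lab (wend q (C * cis (2 * pi / ram q))))) \<longleftrightarrow>
      (\<exists>h. ends_at j q = {h} \<and> lab h = 1) \<or>
      (\<exists>h h'. h \<noteq> h' \<and> ends_at j q = {h, h'} \<and> lab h' = flip_index (lab h))"
    if q: "j q = Some 1" and lab: "\<forall>h\<in>sk_ends j. lab h \<in> {1, 2, 3}" for q
  proof -
    have one: "lab h = flip_index (lab h) \<longleftrightarrow> lab h = 1" if "h \<in> sk_ends j" for h
      using lab that by (auto simp: flip_index_def)
    have two: "lab h' = flip_index (lab h) \<and> lab h = flip_index (lab h') \<longleftrightarrow> lab h' = flip_index (lab h)"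
      if "h \<in> sk_ends j" for h h'
      using lab that by (auto simp: flip_index_def)
    have es: "h \<in> ends_at j q \<Longrightarrow> h \<in> sk_ends j" for h by (rule ends_at_sk_ends)
    show ?thesis
      unfolding ends_over_1_cases[OF q r1[rule_format, OF q], of "\<lambda>h h'. lab h' = flip_index (lab h)"]
      using one two es by (metis insertI1)
  qed
  \<comment> \<open>Separates the quantifiers so that the premise on \<open>j z\<close> is available
    when \<open>V\<close> and \<open>W\<close> rewrite the inner statement.\<close>
  have pull: "(\<forall>z C. A z \<longrightarrow> B z C) \<longleftrightarrow> (\<forall>z. A z \<longrightarrow> (\<forall>C. B z C))" for A and B :: "P1 \<Rightarrow> complex \<Rightarrow> bool" by blast
  note defs = compatible_def turns_neg_iff[of "\<lambda>h h'. lab h' = next_index (lab h)"]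
    turns_pos_iff[of "\<lambda>h h'. lab h' = flip_index (lab h)"]
    pull[of "\<lambda>z. j z = Some 0"] pull[of "\<lambda>z. j z = Some 1"]
  show ?thesis
  proof (cases "\<forall>h\<in>sk_ends j. lab h \<in> {1, 2, 3}")
    case True
    then show ?thesis
      unfolding defs by (simp only: V[OF _ True] W[OF _ True] cong: imp_cong)
  next
    case False
    then show ?thesis unfolding compatible_def by blast
  qed
qed

lemma valency_vertex: "j z = Some 0 \<Longrightarrow> valency j z = ram z"
  by (simp add: valency_def valency_eq_ram)

lemma sk_vertices_iff: "z \<in> sk_vertices j \<longleftrightarrow> j z = Some 0"
  by (auto simp: sk_vertices_def skeleton_def intro!: exI[of _ 0])

text \<open>The directions of the three ends are \<open>C * K\<close> with one common
  \<open>K\<close>, so the counterclockwise order is successive multiplication by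
  \<open>\<omega>\<close>.\<close>

lemma marking_at_iff:
  assumes z: "j z = Some 0" and r: "ram z = 3"
  shows "marking_at j z e \<longleftrightarrow> (\<exists>C. C ^ 3 = 1 \<and> e 1 = vend z C \<and> e 2 = vend z (C * \<omega>) \<and> e 3 = vend z (C * \<omega>\<^sup>2))"
proof -
  obtain K where K: "K \<noteq> 0" "\<And>C. C ^ ram z = 1 \<Longrightarrow> end_direction z (vend z C) = C * K"
    using end_directions[OF z] by blast
  note K = K[unfolded r]
  have ends: "ends_at j z = vend z ` {C. C ^ 3 = 1}" using ends_at_eq[OF z] r by simp
  have 1: "\<exists>C. C ^ 3 = 1 \<and> e 1 = vend z C \<and> e 2 = vend z (C * \<omega>) \<and> e 3 = vend z (C * \<omega>\<^sup>2)"
    if m: "marking_at j z e"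
  proof -
    from m have b: "bij_betw e {1, 2, 3} (ends_at j z)" by (simp add: marking_at_def)
    have "e i \<in> vend z ` {C. C ^ 3 = 1}" if "i \<in> {1, 2, 3}" for i
      using b that unfolding ends by (metis bij_betwE)
    then have "e 1 \<in> vend z ` {C. C ^ 3 = 1}" "e 2 \<in> vend z ` {C. C ^ 3 = 1}"
      "e 3 \<in> vend z ` {C. C ^ 3 = 1}" by simp_all
    then obtain C1 C2 C3 where C: "C1 ^ 3 = 1" "C2 ^ 3 = 1" "C3 ^ 3 = 1"
      "e 1 = vend z C1" "e 2 = vend z C2" "e 3 = vend z C3" by blast
    have "counterclockwise (C1 * K) (C2 * K) (C3 * K)"
      using m C K(2) by (simp add: marking_at_def)
    then have "C2 = C1 * \<omega>" "C3 = C1 * \<omega>\<^sup>2"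
      using counterclockwise_cube_roots[OF C(1-3) K(1)] by auto
    then show ?thesis
      using C by blast
  qed
  have 2: "marking_at j z e"
    if "\<exists>C. C ^ 3 = 1 \<and> e 1 = vend z C \<and> e 2 = vend z (C * \<omega>) \<and> e 3 = vend z (C * \<omega>\<^sup>2)"
  proof -
    from that obtain C where C: "C ^ 3 = 1" "e 1 = vend z C" "e 2 = vend z (C * \<omega>)" "e 3 = vend z (C * \<omega>\<^sup>2)"
      by blast
    have C': "(C * \<omega>) ^ 3 = 1" "(C * \<omega>\<^sup>2) ^ 3 = 1"
      using C(1) cube_roots_of_unity[of \<omega>] cube_roots_of_unity[of "\<omega>\<^sup>2"]
      unfolding power_mult_distrib by simp_all
    have C0: "C \<noteq> 0" using C(1) by auto
    have inj: "vend z A = vend z B \<Longrightarrow> A = B" if "A ^ 3 = 1" "B ^ 3 = 1" for A B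
      using vend_inj[OF z] that r by simp
    have "e 1 \<noteq> e 2" "e 1 \<noteq> e 3" "e 2 \<noteq> e 3"
      using inj[OF C(1) C'(1)] inj[OF C(1) C'(2)] inj[OF C'] C C0 omega_powers_distinct by auto
    then have "inj_on e {1, 2, 3}" by (auto simp: inj_on_def)
    moreover have "e ` {1, 2, 3} = ends_at j z"
    proof (rule card_subset_eq)
      show "finite (ends_at j z)" using valency_eq_ram[OF z] r by (simp add: card_ge_0_finite)
      show "e ` {1, 2, 3} \<subseteq> ends_at j z" unfolding ends using C C' by auto
      show "card (e ` {1, 2, 3}) = card (ends_at j z)"
        using calculation r by (simp add: card_image valency_eq_ram[OF z])
    qed
    ultimately have "bij_betw e {1, 2, 3} (ends_at j z)" by (simp add: bij_betw_def)
    moreover have "counterclockwise (C * K) ((C * \<omega>) * K) ((C * \<omega>\<^sup>2) * K)"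
      using counterclockwise_cube_roots[OF C(1) C' K(1)] by simp
    ultimately show ?thesis
      using C C' K(2) by (simp add: marking_at_def)
  qed
  show ?thesis using 1 2 by blast
qed

text \<open>The label of an end is its index at its vertex, well defined since an end has only one
  vertex. The pairs (1,1), (2,3), (3,2) form the graph of \<open>flip_index\<close>, and
  \<open>next_index\<close> expresses the counterclockwise order. Conversely, the end labelled 1 at
  each vertex is taken as the first one.\<close>

theorem marking_iff_compatible:
  assumes r0: "\<forall>z. j z = Some 0 \<longrightarrow> ram z \<le> 3" and r1: "\<forall>z. j z = Some 1 \<longrightarrow> ram z \<le> 2"
  shows "(\<forall>z \<in> sk_vertices j. valency j z = 3) \<and>
    (\<exists>m. marking j m \<and>
       (\<forall>e \<in> sk_edges j. hanging_edge j e \<longrightarrow> hanging_edge_has_index j m e 1) \<and>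
       (\<forall>e \<in> sk_edges j. \<not> hanging_edge j e \<longrightarrow>
          (\<exists>p \<in> {(1, 1), (2, 3), (3, 2)}. edge_has_indices j m e p))) \<longleftrightarrow> (\<exists>lab. compatible lab)"
    (is "?L \<longleftrightarrow> ?R")
proof
  assume L: ?L
  then have r3: "ram z = 3" if "j z = Some 0" for z
    using that valency_vertex sk_vertices_iff by metis
  from L obtain m where m: "marking j m"
    "\<And>e. e \<in> sk_edges j \<Longrightarrow> hanging_edge j e \<Longrightarrow> hanging_edge_has_index j m e 1"
    "\<And>e. e \<in> sk_edges j \<Longrightarrow> \<not> hanging_edge j e \<Longrightarrow>
      \<exists>p \<in> {(1, 1), (2, 3), (3, 2)}. edge_has_indices j m e p" by blast
  have mz: "\<exists>C. C ^ 3 = 1 \<and> m z 1 = vend z C \<and> m z 2 = vend z (C * \<omega>) \<and> m z 3 = vend z (C * \<omega>\<^sup>2)"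
    if "j z = Some 0" for z
  proof -
    have "marking_at j z (m z)"
      using m(1) that by (simp add: marking_def sk_vertices_iff valency_vertex r3)
    then show ?thesis by (simp only: marking_at_iff[OF that r3[OF that]])
  qed
  have bij: "bij_betw (m z) {1, 2, 3} (ends_at j z)" if "j z = Some 0" for z
    using m(1) that by (simp add: marking_def sk_vertices_iff valency_vertex r3 marking_at_def)
  have ex: "\<exists>i. end_has_index j m h i" if h: "h \<in> sk_ends j" for h
  proof -
    obtain z where z: "j z = Some 0" "h \<in> ends_at j z" using end_has_vertex[OF h] .
    then obtain i where "i \<in> {1, 2, 3}" "m z i = h" using bij[OF z(1)] by (metis bij_betw_imp_surj_on imageE)
    then show ?thesis
      unfolding end_has_index_def using z r3 valency_vertex sk_vertices_iff by metis
  qed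
  have uniq: "i = i'" if a: "end_has_index j m h i" "end_has_index j m h i'" for h i i'
  proof -
    obtain z where z: "j z = Some 0" "h \<in> ends_at j z" "i \<in> {1, 2, 3}" "m z i = h"
      using a(1) by (auto simp: end_has_index_def sk_vertices_iff)
    obtain z' where z': "j z' = Some 0" "h \<in> ends_at j z'" "i' \<in> {1, 2, 3}" "m z' i' = h"
      using a(2) by (auto simp: end_has_index_def sk_vertices_iff)
    have "z = z'" using end_vertex_unique z z' by blast
    then show ?thesis using bij_betw_imp_inj_on[OF bij[OF z(1)]] z z' by (metis inj_onD)
  qed
  have in3: "i \<in> {1, 2, 3}" if "end_has_index j m h i" for h i
    using that by (auto simp: end_has_index_def)
  define lab where "lab h = (SOME i. end_has_index j m h i)" for h
  have lab: "lab h = i" if "end_has_index j m h i" for h i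
    using uniq that unfolding lab_def by (metis someI)
  have lab_m: "lab (m z i) = i" if "j z = Some 0" "i \<in> {1, 2, 3}" for z i
  proof (rule lab)
    have "m z i \<in> ends_at j z" using bij[OF that(1)] that(2) by (metis bij_betwE)
    then show "end_has_index j m (m z i) i"
      unfolding end_has_index_def using that r3 valency_vertex sk_vertices_iff by metis
  qed
  have "compatible lab"
    unfolding compatible_iff[OF r0 r1]
  proof (intro conjI ballI allI impI)
    fix h assume "h \<in> sk_ends j"
    then obtain i where "end_has_index j m h i" using ex by blast
    then show "lab h \<in> {1, 2, 3}" using lab in3 by metis
  next
    fix z assume z: "j z = Some 0"
    show "ram z = 3" by (rule r3[OF z])
    fix C :: complex assume C: "C ^ 3 = 1"
    obtain C1 where C1: "C1 ^ 3 = 1" "m z 1 = vend z C1" "m z 2 = vend z (C1 * \<omega>)" "m z 3 = vend z (C1 * \<omega>\<^sup>2)"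
      using mz[OF z] by blast
    have l: "lab (vend z C1) = 1" "lab (vend z (C1 * \<omega>)) = 2" "lab (vend z (C1 * \<omega>\<^sup>2)) = 3"
      using lab_m[OF z, of 1] lab_m[OF z, of 2] lab_m[OF z, of 3] C1 by simp_all
    have C10: "C1 \<noteq> 0" using C1(1) by auto
    have "(C / C1) ^ 3 = 1" using C C1 by (simp add: power_divide)
    then have "C / C1 \<in> {1, \<omega>, \<omega>\<^sup>2}" by (simp only: cube_roots_of_unity)
    then consider "C = C1" | "C = C1 * \<omega>" | "C = C1 * \<omega>\<^sup>2"
      using C10 by (auto simp: field_simps)
    then show "lab (vend z (C * \<omega>)) = next_index (lab (vend z C))"
    proof cases
      case 2
      then have "C * \<omega> = C1 * \<omega>\<^sup>2" by (simp add: power2_eq_square)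
      then have "lab (vend z (C * \<omega>)) = 3" "lab (vend z C) = 2" using l 2 by (simp_all only:)
      then show ?thesis by (simp add: next_index_def)
    next
      case 3
      then have "C * \<omega> = C1 * \<omega> ^ 3" by (simp add: power2_eq_square power3_eq_cube)
      then have "C * \<omega> = C1" by (simp add: omega_cube)
      then have "lab (vend z (C * \<omega>)) = 1" "lab (vend z C) = 3" using l 3 by (simp_all only:)
      then show ?thesis by (simp add: next_index_def)
    qed (use l in \<open>simp add: next_index_def\<close>)
  next
    fix q assume q: "j q = Some 1"
    let ?e = "edge_through q"
    have e: "?e \<in> sk_edges j" unfolding sk_edges_eq using q by blast
    note ee = ends_of_edge_through[OF q]
    show "(\<exists>h. ends_at j q = {h} \<and> lab h = 1) \<or>
       (\<exists>h h'. h \<noteq> h' \<and> ends_at j q = {h, h'} \<and> lab h' = flip_index (lab h))"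
    proof (cases "hanging_edge j ?e")
      case True
      from m(2)[OF e True] show ?thesis
        using lab by (auto simp: hanging_edge_has_index_def ee)
    next
      case False
      from m(3)[OF e False] obtain p where p: "p \<in> {(1, 1), (2, 3), (3, 2)}" "edge_has_indices j m ?e p"
        by blast
      obtain i i' where p': "p = (i, i')" by (cases p)
      then obtain h h' where h: "h \<noteq> h'" "ends_at j q = {h, h'}" "end_has_index j m h i" "end_has_index j m h' i'"
        using p(2) by (auto simp: edge_has_indices_def ee)
      then have "lab h = i" "lab h' = i'" using lab by blast+
      moreover have "i' = flip_index i" using p(1) p' by (auto simp: flip_index_def)
      ultimately show ?thesis using h by blast
    qed
  qed
  then show ?R by blast
next
  assume ?R
  then obtain lab where "compatible lab" by blast
  then have lab: "\<And>h. h \<in> sk_ends j \<Longrightarrow> lab h \<in> {1, 2, 3}"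
    and r3: "\<And>z. j z = Some 0 \<Longrightarrow> ram z = 3"
    and nx: "\<And>z C. j z = Some 0 \<Longrightarrow> C ^ 3 = 1 \<Longrightarrow> lab (vend z (C * \<omega>)) = next_index (lab (vend z C))"
    and fl: "\<And>q. j q = Some 1 \<Longrightarrow> (\<exists>h. ends_at j q = {h} \<and> lab h = 1) \<or>
       (\<exists>h h'. h \<noteq> h' \<and> ends_at j q = {h, h'} \<and> lab h' = flip_index (lab h))"
    unfolding compatible_iff[OF r0 r1] by blast+
  have w3: "(C * \<omega>) ^ 3 = 1" if "C ^ 3 = 1" for C using that omega_cube by (simp add: power_mult_distrib)
  \<comment> \<open>Going around the vertex, the labels run cyclically through 1, 2, 3, so 1
    occurs.\<close>
  have base: "\<exists>C. C ^ 3 = 1 \<and> lab (vend z C) = 1" if z: "j z = Some 0" for z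
  proof -
    have "vend z 1 \<in> sk_ends j" using vend_in_sk_ends[OF z] by simp
    then have l: "lab (vend z 1) \<in> {1, 2, 3}" by (rule lab)
    have n1: "lab (vend z \<omega>) = next_index (lab (vend z 1))" using nx[OF z, of 1] by simp
    have n2: "lab (vend z (\<omega> * \<omega>)) = next_index (lab (vend z \<omega>))" using nx[OF z, of \<omega>] omega_cube by simp
    have o: "\<omega> ^ 3 = 1" "(\<omega> * \<omega>) ^ 3 = 1" using omega_cube w3 by auto
    from l consider "lab (vend z 1) = 1" | "lab (vend z 1) = 2" | "lab (vend z 1) = 3" by auto
    then show ?thesis
    proof cases
      case 1 then show ?thesis by (intro exI[of _ 1]) simp
    next
      case 2 then show ?thesis using n1 n2 o by (intro exI[of _ "\<omega> * \<omega>"]) (simp add: next_index_def)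
    next
      case 3 then show ?thesis using n1 o by (intro exI[of _ \<omega>]) (simp add: next_index_def)
    qed
  qed
  define c where "c z = (SOME C. C ^ 3 = 1 \<and> lab (vend z C) = 1)" for z
  have c: "c z ^ 3 = 1" "lab (vend z (c z)) = 1" if "j z = Some 0" for z
    using someI_ex[OF base[OF that]] by (auto simp: c_def)
  define m where "m z i = vend z (c z * \<omega> ^ (i - 1))" for z and i :: nat
  have m123: "m z 1 = vend z (c z)" "m z 2 = vend z (c z * \<omega>)" "m z 3 = vend z (c z * \<omega>\<^sup>2)" for z
    by (simp_all add: m_def)
  have lm: "lab (m z i) = i" if z: "j z = Some 0" and i: "i \<in> {1, 2, 3}" for z i
  proof -
    have "lab (m z 1) = 1" using c[OF z] m123 by simp
    moreover have "lab (m z 2) = 2" using c[OF z] nx[OF z c(1)[OF z]] m123 by (simp add: next_index_def)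
    moreover have "lab (m z 3) = 3"
      using nx[OF z w3[OF c(1)[OF z]]] calculation(2) m123
      by (simp add: next_index_def power2_eq_square mult.assoc)
    ultimately show ?thesis using i by auto
  qed
  have mat: "marking_at j z (m z)" if z: "j z = Some 0" for z
    unfolding marking_at_iff[OF z r3[OF z]] using c(1)[OF z] m123 by blast
  have mk: "marking j m" using mat by (simp add: marking_def sk_vertices_iff)
  have idx: "end_has_index j m h (lab h)" if h: "h \<in> sk_ends j" for h
  proof -
    obtain z where z: "j z = Some 0" "h \<in> ends_at j z" using end_has_vertex[OF h] .
    have "bij_betw (m z) {1, 2, 3} (ends_at j z)" using mat[OF z(1)] by (simp add: marking_at_def)
    then obtain i where i: "i \<in> {1, 2, 3}" "m z i = h" using z(2) by (metis bij_betw_imp_surj_on imageE)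
    then have "lab h = i" using lm[OF z(1) i(1)] by simp
    then show ?thesis
      unfolding end_has_index_def using z r3 valency_vertex sk_vertices_iff i by metis
  qed
  have val: "\<forall>z \<in> sk_vertices j. valency j z = 3"
    using r3 valency_vertex sk_vertices_iff by metis
  have edge: "(hanging_edge j e \<longrightarrow> hanging_edge_has_index j m e 1) \<and>
      (\<not> hanging_edge j e \<longrightarrow> (\<exists>p \<in> {(1, 1), (2, 3), (3, 2)}. edge_has_indices j m e p))"
    if e: "e \<in> sk_edges j" for e
  proof -
    obtain q where q: "j q = Some 1" "e = edge_through q" using e unfolding sk_edges_eq by blast
    note ee = ends_of_edge_through[OF q(1)]
    from fl[OF q(1)] show ?thesis
    proof
      assume "\<exists>h. ends_at j q = {h} \<and> lab h = 1"
      then obtain h where h: "ends_at j q = {h}" "lab h = 1" by blast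
      then have "end_has_index j m h 1" using idx[of h] ends_at_sk_ends[of h q] by simp
      then show ?thesis using h e q ee by (simp add: hanging_edge_def hanging_edge_has_index_def)
    next
      assume "\<exists>h h'. h \<noteq> h' \<and> ends_at j q = {h, h'} \<and> lab h' = flip_index (lab h)"
      then obtain h h' where h: "h \<noteq> h'" "ends_at j q = {h, h'}" "lab h' = flip_index (lab h)" by blast
      then have s: "h \<in> sk_ends j" "h' \<in> sk_ends j" using ends_at_sk_ends[of _ q] by auto
      have "edge_has_indices j m e (lab h, lab h')"
        unfolding edge_has_indices_def q(2) ee using h idx[OF s(1)] idx[OF s(2)] by auto
      moreover have "(lab h, lab h') \<in> {(1, 1), (2, 3), (3, 2)}"
        using lab[OF s(1)] h(3) by (auto simp: flip_index_def)
      moreover have "\<not> hanging_edge j e" using h q ee by (simp add: hanging_edge_def)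
      ultimately show ?thesis by blast
    qed
  qed
  show ?L using val mk edge by blast
qed

end

section \<open>The roots of the cubic as functions of j\<close>

text \<open>The Weierstrass equation in the coordinate \<open>y = x * g2 / g3\<close>, which depends on \<open>w = j\<close> only.\<close>

definition cubic_rel :: "complex \<Rightarrow> complex \<Rightarrow> bool" where
  "cubic_rel w y \<longleftrightarrow> 4 * (1 - w) * y ^ 3 + 27 * w * y + 27 * w = 0"

text \<open>Cardano's formula: with \<open>m\<^sup>2 = 1 / (1 - w)\<close>, \<open>a ^ 3 = m - 1\<close>, \<open>b ^ 3 = m + 1\<close>, the two summands
  are \<open>3 / 2 * a\<^sup>2 * b\<close> and \<open>- 3 / 2 * a * b\<^sup>2\<close>.\<close>

definition cardano :: "complex \<Rightarrow> complex \<Rightarrow> nat \<Rightarrow> complex" where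
  "cardano a b i = 3 / 2 * (\<omega> ^ (i + 2) * a) * b * (\<omega> ^ (i + 2) * a - b)"

lemma omega_cubed_simps: "\<omega> ^ 3 = 1" "\<omega> ^ 4 = \<omega>" "\<omega> ^ 5 = \<omega>\<^sup>2"
proof -
  show 3: "\<omega> ^ 3 = 1" by (rule omega_cube)
  have "\<omega> ^ 4 = \<omega> ^ 3 * \<omega>" "\<omega> ^ 5 = \<omega> ^ 3 * \<omega>\<^sup>2" by (simp_all flip: power_add power_Suc2)
  then show "\<omega> ^ 4 = \<omega>" "\<omega> ^ 5 = \<omega>\<^sup>2" using 3 by simp_all
qed

text \<open>The exponent \<open>i + 2\<close> is \<open>i - 1\<close> modulo 3, so branch 1 carries
  no root of unity.\<close>

lemma cardano_simps:
  "cardano a b 1 = 3 / 2 * a * b * (a - b)"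
  "cardano a b 2 = 3 / 2 * (\<omega> * a) * b * (\<omega> * a - b)"
  "cardano a b 3 = 3 / 2 * (\<omega>\<^sup>2 * a) * b * (\<omega>\<^sup>2 * a - b)"
proof -
  have "(1::nat) + 2 = 3" "(2::nat) + 2 = 4" "(3::nat) + 2 = 5" by simp_all
  then show "cardano a b 1 = 3 / 2 * a * b * (a - b)"
    "cardano a b 2 = 3 / 2 * (\<omega> * a) * b * (\<omega> * a - b)"
    "cardano a b 3 = 3 / 2 * (\<omega>\<^sup>2 * a) * b * (\<omega>\<^sup>2 * a - b)"
    unfolding cardano_def by (simp_all only: omega_cubed_simps mult_1_left)
qed

lemma omega_sq_eq: "\<omega>\<^sup>2 = - 1 - \<omega>"
  using omega_sum by (simp add: algebra_simps eq_neg_iff_add_eq_0)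

text \<open>The identity behind Cardano's formula: twisting two cube roots \<open>P\<close>,
  \<open>Q\<close> by inverse roots of unity yields all zeros of a cubic without quadratic
  term.\<close>

lemma three_roots_identity:
  fixes P Q y :: complex
  shows "(y - (P + Q)) * (y - (\<omega>\<^sup>2 * P + \<omega> * Q)) * (y - (\<omega> * P + \<omega>\<^sup>2 * Q)) =
    y ^ 3 - 3 * P * Q * y - P ^ 3 - Q ^ 3"
proof -
  have o2: "\<omega> * \<omega> = - 1 - \<omega>" using omega_sq_eq by (simp add: power2_eq_square)
  have "(y - (\<omega>\<^sup>2 * P + \<omega> * Q)) * (y - (\<omega> * P + \<omega>\<^sup>2 * Q)) =
      y\<^sup>2 - (\<omega> + \<omega>\<^sup>2) * (P + Q) * y + \<omega> ^ 3 * (P\<^sup>2 + Q\<^sup>2) + (\<omega>\<^sup>2 + \<omega> ^ 4) * P * Q"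
    by (simp add: algebra_simps power2_eq_square power3_eq_cube power4_eq_xxxx)
  also have "\<dots> = y\<^sup>2 + (P + Q) * y + (P\<^sup>2 + Q\<^sup>2) - P * Q"
    unfolding omega_cubed_simps omega_sq_eq by (simp add: algebra_simps)
  finally have "(y - (P + Q)) * (y - (\<omega>\<^sup>2 * P + \<omega> * Q)) * (y - (\<omega> * P + \<omega>\<^sup>2 * Q)) =
      (y - (P + Q)) * (y\<^sup>2 + (P + Q) * y + (P\<^sup>2 + Q\<^sup>2) - P * Q)" by (simp add: mult.assoc)
  also have "\<dots> = y ^ 3 - 3 * P * Q * y - P ^ 3 - Q ^ 3"
    by (simp add: algebra_simps power2_eq_square power3_eq_cube)
  finally show ?thesis .
qed

text \<open>As \<open>w / (1 - w)\<close> is \<open>m\<^sup>2 - 1\<close>, the cubic is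
  \<open>4 * (1 - w)\<close> times \<open>y ^ 3 + 27 / 4 * (m\<^sup>2 - 1) * (y + 1)\<close>, and
  \<open>P\<close>, \<open>Q\<close> have the product and the sum of cubes that this requires. Two
  roots coincide only if \<open>P ^ 3 = Q ^ 3\<close>, that is, only if
  \<open>a ^ 3 + b ^ 3\<close>, which is \<open>2 * m\<close>, vanishes.\<close>

lemma cardano_roots:
  assumes a: "a ^ 3 = m - 1" and b: "b ^ 3 = m + 1" and m: "m\<^sup>2 * (1 - w) = 1" and w: "w \<noteq> 0"
  shows "cubic_rel w y \<longleftrightarrow> (\<exists>i\<in>{1, 2, 3}. y = cardano a b i)"
    "inj_on (cardano a b) {1, 2, 3}"
proof -
  define P where "P = 3 / 2 * a\<^sup>2 * b"
  define Q where "Q = - 3 / 2 * a * b\<^sup>2"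
  have w1: "1 - w \<noteq> 0" using m by auto
  have m0: "m \<noteq> 0" using m by auto
  have ab: "a ^ 3 * b ^ 3 = m\<^sup>2 - 1" unfolding a b by (simp add: algebra_simps power2_eq_square)
  have m2: "(m\<^sup>2 - 1) * (1 - w) = w" using m by (simp add: algebra_simps)
  have PQ: "3 * P * Q = - 27 / 4 * (m\<^sup>2 - 1)"
    unfolding P_def Q_def ab[symmetric] by (simp add: power2_eq_square power3_eq_cube)
  have P3: "P ^ 3 = 27 / 8 * (a ^ 3 * b ^ 3) * a ^ 3"
    by (simp add: P_def power_mult_distrib power2_eq_square power3_eq_cube)
  have Q3: "Q ^ 3 = - 27 / 8 * (a ^ 3 * b ^ 3) * b ^ 3"
    by (simp add: Q_def power_mult_distrib power2_eq_square power3_eq_cube)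
  have PQ3: "P ^ 3 + Q ^ 3 = - 27 / 4 * (m\<^sup>2 - 1)"
  proof -
    have "P ^ 3 + Q ^ 3 = 27 / 8 * (m\<^sup>2 - 1) * (a ^ 3 - b ^ 3)"
      unfolding P3 Q3 ab by (simp add: field_simps)
    also have "a ^ 3 - b ^ 3 = -2" unfolding a b by simp
    finally show ?thesis by simp
  qed
  have c: "cardano a b 1 = P + Q" "cardano a b 2 = \<omega>\<^sup>2 * P + \<omega> * Q" "cardano a b 3 = \<omega> * P + \<omega>\<^sup>2 * Q"
  proof -
    show "cardano a b 1 = P + Q" "cardano a b 2 = \<omega>\<^sup>2 * P + \<omega> * Q"
      unfolding cardano_simps P_def Q_def by (simp_all add: field_simps power2_eq_square)
    have "cardano a b 3 = \<omega> ^ 4 * P + \<omega>\<^sup>2 * Q"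
      unfolding cardano_simps P_def Q_def
      by (simp add: field_simps power2_eq_square power4_eq_xxxx)
    then show "cardano a b 3 = \<omega> * P + \<omega>\<^sup>2 * Q" by (simp add: omega_cubed_simps)
  qed
  have "4 * (1 - w) * ((y - cardano a b 1) * (y - cardano a b 2) * (y - cardano a b 3)) =
      4 * (1 - w) * (y ^ 3 - 3 * P * Q * y - (P ^ 3 + Q ^ 3))"
    unfolding c three_roots_identity by (simp add: algebra_simps)
  also have "\<dots> = 4 * (1 - w) * y ^ 3 + 27 * ((m\<^sup>2 - 1) * (1 - w)) * y + 27 * ((m\<^sup>2 - 1) * (1 - w))"
    unfolding PQ PQ3 by (simp add: field_simps)
  finally have "4 * (1 - w) * ((y - cardano a b 1) * (y - cardano a b 2) * (y - cardano a b 3)) =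
      4 * (1 - w) * y ^ 3 + 27 * w * y + 27 * w" unfolding m2 .
  then have "cubic_rel w y \<longleftrightarrow> (y - cardano a b 1) * (y - cardano a b 2) * (y - cardano a b 3) = 0"
    unfolding cubic_rel_def using w1 by (metis mult_eq_0_iff zero_neq_numeral)
  then show "cubic_rel w y \<longleftrightarrow> (\<exists>i\<in>{1, 2, 3}. y = cardano a b i)" by auto
  have P0: "a \<noteq> 0" "b \<noteq> 0" using ab m2 w by auto
  have ne: "Q \<noteq> c * P" if "c ^ 3 = 1" for c
  proof
    assume "Q = c * P"
    then have "Q ^ 3 = P ^ 3" using that by (simp add: power_mult_distrib)
    moreover have "(a ^ 3 * b ^ 3) * (a ^ 3 + b ^ 3) = 8 / 27 * (P ^ 3 - Q ^ 3)"
      unfolding P3 Q3 by (simp add: field_simps)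
    ultimately have "(a ^ 3 * b ^ 3) * (a ^ 3 + b ^ 3) = 0" by simp
    then have "a ^ 3 + b ^ 3 = 0" using P0 by simp
    then show False using m0 unfolding a b by simp
  qed
  have o: "\<omega> ^ 3 = 1" "(\<omega>\<^sup>2) ^ 3 = 1" by (simp_all only: cube_roots_of_unity) simp_all
  have "\<omega> - 1 \<noteq> 0" using omega_powers_distinct by simp
  have "cardano a b 1 - cardano a b 2 = (\<omega> - 1) * (\<omega>\<^sup>2 * P - Q)"
    unfolding c by (simp add: algebra_simps power2_eq_square[of \<omega>])
      (simp add: omega_sq_eq[unfolded power2_eq_square] algebra_simps)
  then have 12: "cardano a b 1 \<noteq> cardano a b 2" using ne[OF o(2)] \<open>\<omega> - 1 \<noteq> 0\<close> by auto
  have "cardano a b 2 - cardano a b 3 = \<omega> * (\<omega> - 1) * (P - Q)"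
    unfolding c by (simp add: algebra_simps power2_eq_square)
  then have 23: "cardano a b 2 \<noteq> cardano a b 3" using ne[of 1] \<open>\<omega> - 1 \<noteq> 0\<close> by auto
  have "cardano a b 1 - cardano a b 3 = (1 - \<omega>) * (P + (1 + \<omega>) * Q)"
    unfolding c by (simp add: algebra_simps power2_eq_square)
  also have "(1 + \<omega>) = - \<omega>\<^sup>2" by (simp add: omega_sq_eq)
  finally have d13: "cardano a b 1 - cardano a b 3 = (1 - \<omega>) * (P - \<omega>\<^sup>2 * Q)" by simp
  have 13: "cardano a b 1 \<noteq> cardano a b 3"
  proof
    assume "cardano a b 1 = cardano a b 3"
    then have "P = \<omega>\<^sup>2 * Q" using d13 \<open>\<omega> - 1 \<noteq> 0\<close> by simp
    then have "\<omega> * P = \<omega> ^ 3 * Q" by (simp add: power2_eq_square power3_eq_cube)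
    then show False using ne[OF o(1)] by (simp add: omega_cube)
  qed
  show "inj_on (cardano a b) {1, 2, 3}"
    using 12 13 23 by (auto simp: inj_on_def)
qed

definition root_branches :: "complex set \<Rightarrow> (nat \<Rightarrow> complex \<Rightarrow> complex) \<Rightarrow> bool" where
  "root_branches \<Omega> F \<longleftrightarrow> (\<forall>i\<in>{1, 2, 3}. F i holomorphic_on \<Omega>) \<and>
     (\<forall>w\<in>\<Omega>. (\<forall>y. cubic_rel w y \<longleftrightarrow> (\<exists>i\<in>{1, 2, 3}. y = F i w)) \<and> inj_on (\<lambda>i. F i w) {1, 2, 3})"

lemma holomorphic_on_nrt [holomorphic_intros]:
  assumes "f holomorphic_on \<Omega>" "\<And>w. w \<in> \<Omega> \<Longrightarrow> f w \<notin> \<real>\<^sub>\<le>\<^sub>0" "n \<ge> 1"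
  shows "(\<lambda>w. nrt n (f w)) holomorphic_on \<Omega>"
  unfolding nrt_def using assms by (intro holomorphic_intros) auto

lemma root_branches_cardano:
  assumes w: "\<And>w. w \<in> \<Omega> \<Longrightarrow> w \<noteq> 0"
    and h: "a holomorphic_on \<Omega>" "b holomorphic_on \<Omega>"
    and m: "\<And>w. w \<in> \<Omega> \<Longrightarrow> a w ^ 3 = m w - 1 \<and> b w ^ 3 = m w + 1 \<and> (m w)\<^sup>2 * (1 - w) = 1"
  shows "root_branches \<Omega> (\<lambda>i w. cardano (a w) (b w) i)"
  unfolding root_branches_def
proof (intro conjI ballI allI)
  fix i show "(\<lambda>w. cardano (a w) (b w) i) holomorphic_on \<Omega>"
    unfolding cardano_def using h by (intro holomorphic_intros)
next
  fix w y assume "w \<in> \<Omega>"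
  then show "cubic_rel w y \<longleftrightarrow> (\<exists>i\<in>{1, 2, 3}. y = cardano (a w) (b w) i)"
    "inj_on (cardano (a w) (b w)) {1, 2, 3}"
    using cardano_roots(1)[of "a w" "m w" "b w" w y] cardano_roots(2)[of "a w" "m w" "b w" w] m w by blast+
qed

section \<open>Explicit branches over the slit planes and their monodromy\<close>

definition msqrt :: "complex \<Rightarrow> complex" where "msqrt w = inverse (csqrt (1 - w))"

text \<open>The principal root of \<open>1 - w\<close> has positive real part and an imaginary part
  of sign opposite to \<open>Im w\<close>; inversion reverses that sign once more.\<close>

lemma msqrt_props:
  assumes "w \<in> slit_mid \<union> slit_neg"
  shows "(msqrt w)\<^sup>2 * (1 - w) = 1" "Re (msqrt w) > 0"
    "Im w > 0 \<Longrightarrow> Im (msqrt w) > 0" "Im w < 0 \<Longrightarrow> Im (msqrt w) < 0" "1 - w \<notin> \<real>\<^sub>\<le>\<^sub>0"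
proof -
  let ?c = "csqrt (1 - w)"
  show nr: "1 - w \<notin> \<real>\<^sub>\<le>\<^sub>0" using assms by (auto simp: slit_defs complex_nonpos_Reals_iff)
  have c2: "?c\<^sup>2 = 1 - w" by (rule power2_csqrt)
  have ne: "1 - w \<noteq> 0" using nr by auto
  then have c0: "?c \<noteq> 0" using c2 by auto
  show "(msqrt w)\<^sup>2 * (1 - w) = 1"
    using ne by (simp add: msqrt_def power_inverse c2)
  have ri: "(Re ?c)\<^sup>2 - (Im ?c)\<^sup>2 = 1 - Re w" "2 * Re ?c * Im ?c = - Im w"
    using c2 by (auto simp: complex_eq_iff power2_eq_square mult_ac simp del: csqrt.sel)
  have "Re ?c \<noteq> 0"
  proof
    assume z: "Re ?c = 0"
    then have i: "Im w = 0" using ri(2) by simp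
    have "1 - Re w = - (Im ?c)\<^sup>2" using ri(1) z by simp
    then have "Re w \<ge> 1" by (smt (verit) zero_le_power2)
    then show False using nr i by (simp add: complex_nonpos_Reals_iff)
  qed
  then have Re: "Re ?c > 0" using csqrt_principal[of "1 - w"] by auto
  have n: "(Re ?c)\<^sup>2 + (Im ?c)\<^sup>2 > 0" using Re by (simp add: add_pos_nonneg)
  show "Re (msqrt w) > 0" using Re n by (simp add: msqrt_def del: csqrt.sel)
  show "Im (msqrt w) > 0" if "Im w > 0"
  proof -
    have "Re ?c * Im ?c < 0" using ri(2) that by simp
    then have "Im ?c < 0" using Re by (simp add: mult_less_0_iff)
    then show ?thesis using n by (simp add: msqrt_def divide_neg_pos del: csqrt.sel)
  qed
  show "Im (msqrt w) < 0" if "Im w < 0"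
  proof -
    have "Re ?c * Im ?c > 0" using ri(2) that by simp
    then have "Im ?c > 0" using Re by (simp add: zero_less_mult_iff)
    then show ?thesis using n by (simp add: msqrt_def del: csqrt.sel)
  qed
qed

lemma real_square_root:
  assumes "m\<^sup>2 * (1 - w) = 1" "Im m = 0"
  shows "Im w = 0" "(Re m)\<^sup>2 * (1 - Re w) = 1"
proof -
  have m: "m = of_real (Re m)" using assms(2) by (simp add: complex_eq_iff)
  have "of_real ((Re m)\<^sup>2) * (1 - w) = 1" using assms(1) m by (metis of_real_power)
  then have e: "(Re m)\<^sup>2 * (1 - Re w) = 1" "(Re m)\<^sup>2 * Im w = 0" by (auto simp: complex_eq_iff)
  then show "(Re m)\<^sup>2 * (1 - Re w) = 1" by simp
  then have "(Re m)\<^sup>2 \<noteq> 0" by auto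
  with e(2) show "Im w = 0" by simp
qed

text \<open>A real \<open>m\<close> occurs only for real \<open>w\<close>, which lies between 0 and
  1; there \<open>m\<^sup>2 = 1 / (1 - w)\<close> exceeds 1, so \<open>m - 1\<close> is positive and
  off the cut of the logarithm.\<close>

lemma msqrt_slit_mid:
  assumes w: "w \<in> slit_mid" shows "msqrt w - 1 \<notin> \<real>\<^sub>\<le>\<^sub>0" "msqrt w + 1 \<notin> \<real>\<^sub>\<le>\<^sub>0"
proof -
  note p = msqrt_props[of w]
  show "msqrt w + 1 \<notin> \<real>\<^sub>\<le>\<^sub>0" using p(2) w by (auto simp: complex_nonpos_Reals_iff)
  show "msqrt w - 1 \<notin> \<real>\<^sub>\<le>\<^sub>0"
  proof
    assume "msqrt w - 1 \<in> \<real>\<^sub>\<le>\<^sub>0"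
    then have m: "Im (msqrt w) = 0" "Re (msqrt w) \<le> 1" by (auto simp: complex_nonpos_Reals_iff)
    have r: "Im w = 0" "(Re (msqrt w))\<^sup>2 * (1 - Re w) = 1"
      using real_square_root[OF p(1) m(1)] w by auto
    have "0 < Re w" "Re w < 1" using w r(1) by (auto simp: slit_mid_def)
    moreover have "(Re (msqrt w))\<^sup>2 \<le> 1" using m(2) p(2) w by (simp add: power_le_one)
    then have "(Re (msqrt w))\<^sup>2 * (1 - Re w) \<le> 1 * (1 - Re w)"
      using calculation by (intro mult_right_mono) auto
    ultimately show False using r(2) by simp
  qed
qed

text \<open>For negative \<open>w\<close> the number \<open>m\<close> lies below 1, so here
  \<open>1 - m\<close>, and not \<open>m - 1\<close>, avoids the cut.\<close>

lemma msqrt_slit_neg: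
  assumes w: "w \<in> slit_neg" shows "1 - msqrt w \<notin> \<real>\<^sub>\<le>\<^sub>0" "msqrt w + 1 \<notin> \<real>\<^sub>\<le>\<^sub>0"
proof -
  note p = msqrt_props[of w]
  show "msqrt w + 1 \<notin> \<real>\<^sub>\<le>\<^sub>0" using p(2) w by (auto simp: complex_nonpos_Reals_iff)
  show "1 - msqrt w \<notin> \<real>\<^sub>\<le>\<^sub>0"
  proof
    assume "1 - msqrt w \<in> \<real>\<^sub>\<le>\<^sub>0"
    then have m: "Im (msqrt w) = 0" "Re (msqrt w) \<ge> 1" by (auto simp: complex_nonpos_Reals_iff)
    have r: "Im w = 0" "(Re (msqrt w))\<^sup>2 * (1 - Re w) = 1"
      using real_square_root[OF p(1) m(1)] w by auto
    have neg: "Re w < 0" using w r(1) by (auto simp: slit_neg_def)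
    have "1 \<le> (Re (msqrt w))\<^sup>2" using m(2) by (simp add: one_le_power)
    then have "1 * (1 - Re w) \<le> (Re (msqrt w))\<^sup>2 * (1 - Re w)"
      using neg by (intro mult_right_mono) auto
    then show False using r(2) neg by simp
  qed
qed

lemma msqrt_holomorphic: "msqrt holomorphic_on (slit_mid \<union> slit_neg)"
proof -
  have "csqrt (1 - w) \<noteq> 0" if "w \<in> slit_mid \<union> slit_neg" for w
    using msqrt_props(2)[OF that] by (auto simp: msqrt_def)
  then show ?thesis
    unfolding msqrt_def using msqrt_props(5) by (intro holomorphic_intros) auto
qed

text \<open>On \<open>slit_pos\<close> the number \<open>1 - w\<close> meets the cut of
  \<open>csqrt\<close>, so the root of \<open>1 / (1 - w)\<close> with positive imaginary part is
  used. It equals \<open>msqrt\<close> above the real axis and its negative below; this change of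
  sign is the source of the transposition at 1.\<close>

definition msqrt_pos :: "complex \<Rightarrow> complex" where "msqrt_pos w = \<i> / csqrt (w - 1)"

lemma msqrt_pos_props:
  assumes "w \<in> slit_pos"
  shows "(msqrt_pos w)\<^sup>2 * (1 - w) = 1" "Im (msqrt_pos w) > 0" "w - 1 \<notin> \<real>\<^sub>\<le>\<^sub>0" "csqrt (w - 1) \<noteq> 0"
proof -
  let ?c = "csqrt (w - 1)"
  show nr: "w - 1 \<notin> \<real>\<^sub>\<le>\<^sub>0" using assms by (auto simp: slit_defs complex_nonpos_Reals_iff)
  have c2: "?c\<^sup>2 = w - 1" by (rule power2_csqrt)
  have ne: "w - 1 \<noteq> 0" using nr by auto
  then show c0: "?c \<noteq> 0" using c2 by auto
  show "(msqrt_pos w)\<^sup>2 * (1 - w) = 1"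
    using ne by (simp add: msqrt_pos_def power_divide c2 field_simps)
  have ri: "(Re ?c)\<^sup>2 - (Im ?c)\<^sup>2 = Re w - 1" "2 * Re ?c * Im ?c = Im w"
    using c2 by (auto simp: complex_eq_iff power2_eq_square mult_ac simp del: csqrt.sel)
  have "Re ?c \<noteq> 0"
  proof
    assume z: "Re ?c = 0"
    then have i: "Im w = 0" using ri(2) by simp
    have "Re w - 1 = - (Im ?c)\<^sup>2" using ri(1) z by simp
    then have "Re w \<le> 1" by (smt (verit) zero_le_power2)
    then show False using nr i by (simp add: complex_nonpos_Reals_iff)
  qed
  then have Re: "Re ?c > 0" using csqrt_principal[of "w - 1"] by auto
  have n: "(Re ?c)\<^sup>2 + (Im ?c)\<^sup>2 > 0" using Re by (simp add: add_pos_nonneg)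
  have "Im (msqrt_pos w) = Re ?c / ((Re ?c)\<^sup>2 + (Im ?c)\<^sup>2)"
    by (simp add: msqrt_pos_def Im_divide del: csqrt.sel)
  then show "Im (msqrt_pos w) > 0" using Re n by simp
qed

lemma msqrt_pos_eq:
  assumes "Im w \<noteq> 0"
  shows "Im w > 0 \<Longrightarrow> msqrt w = msqrt_pos w" "Im w < 0 \<Longrightarrow> msqrt w = - msqrt_pos w"
proof -
  have w: "w \<in> slit_pos" "w \<in> slit_mid \<union> slit_neg" using assms by (auto simp: slit_defs)
  note p = msqrt_props[OF w(2)] and q = msqrt_pos_props[OF w(1)]
  have "1 - w \<noteq> 0" using assms by (auto simp: complex_eq_iff)
  then have "(msqrt w)\<^sup>2 = (msqrt_pos w)\<^sup>2" using p(1) q(1) by (metis mult_right_cancel)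
  then have "msqrt w = msqrt_pos w \<or> msqrt w = - msqrt_pos w" by (simp add: power2_eq_iff)
  then show "Im w > 0 \<Longrightarrow> msqrt w = msqrt_pos w" "Im w < 0 \<Longrightarrow> msqrt w = - msqrt_pos w"
    using p(3,4) q(2) by auto
qed

definition roots_mid :: "nat \<Rightarrow> complex \<Rightarrow> complex" where
  "roots_mid i w = cardano (nrt 3 (msqrt w - 1)) (nrt 3 (msqrt w + 1)) i"

text \<open>The factor \<open>cis (pi / 3)\<close>, a cube root of -1, compensates for
  \<open>1 - m\<close> in place of \<open>m - 1\<close>. Among the three cube roots it is the one
  that gives agreement with \<open>roots_mid\<close> on the upper half plane.\<close>

definition roots_neg :: "nat \<Rightarrow> complex \<Rightarrow> complex" where
  "roots_neg i w = cardano (cis (pi / 3) * nrt 3 (1 - msqrt w)) (nrt 3 (msqrt w + 1)) i"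

definition roots_pos :: "nat \<Rightarrow> complex \<Rightarrow> complex" where
  "roots_pos i w = cardano (nrt 3 (msqrt_pos w - 1)) (nrt 3 (msqrt_pos w + 1)) i"

lemma nonpos_nonzero: "(z::complex) \<notin> \<real>\<^sub>\<le>\<^sub>0 \<Longrightarrow> z \<noteq> 0"
  by auto

lemma root_branches_mid: "root_branches slit_mid roots_mid"
proof -
  have mh: "msqrt holomorphic_on slit_mid" using msqrt_holomorphic by (rule holomorphic_on_subset) simp
  have "root_branches slit_mid (\<lambda>i w. cardano (nrt 3 (msqrt w - 1)) (nrt 3 (msqrt w + 1)) i)"
  proof (rule root_branches_cardano[where m = msqrt])
    fix w assume w: "w \<in> slit_mid"
    then show "w \<noteq> 0" using slit_avoids[of slit_mid] by auto
    show "nrt 3 (msqrt w - 1) ^ 3 = msqrt w - 1 \<and> nrt 3 (msqrt w + 1) ^ 3 = msqrt w + 1 \<and>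
        (msqrt w)\<^sup>2 * (1 - w) = 1"
      using nrt_power[of 3] nonpos_nonzero[OF msqrt_slit_mid(1)[OF w]]
        nonpos_nonzero[OF msqrt_slit_mid(2)[OF w]] msqrt_props(1)[of w] w by simp
  qed (use msqrt_slit_mid mh in \<open>auto intro!: holomorphic_intros\<close>)
  then show ?thesis by (simp add: roots_mid_def[abs_def])
qed

lemma root_branches_neg: "root_branches slit_neg roots_neg"
proof -
  have mh: "msqrt holomorphic_on slit_neg" using msqrt_holomorphic by (rule holomorphic_on_subset) simp
  have "root_branches slit_neg (\<lambda>i w. cardano (cis (pi / 3) * nrt 3 (1 - msqrt w)) (nrt 3 (msqrt w + 1)) i)"
  proof (rule root_branches_cardano[where m = msqrt])
    fix w assume w: "w \<in> slit_neg"
    then show "w \<noteq> 0" using slit_avoids[of slit_neg] by auto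
    have "cis (pi / 3) ^ 3 = -1" by (simp add: Complex.DeMoivre)
    then have "(cis (pi / 3) * nrt 3 (1 - msqrt w)) ^ 3 = msqrt w - 1"
      using nrt_power[of 3 "1 - msqrt w"] nonpos_nonzero[OF msqrt_slit_neg(1)[OF w]]
      unfolding power_mult_distrib by simp
    then show "(cis (pi / 3) * nrt 3 (1 - msqrt w)) ^ 3 = msqrt w - 1 \<and>
        nrt 3 (msqrt w + 1) ^ 3 = msqrt w + 1 \<and> (msqrt w)\<^sup>2 * (1 - w) = 1"
      using nrt_power[of 3 "msqrt w + 1"] nonpos_nonzero[OF msqrt_slit_neg(2)[OF w]] msqrt_props(1)[of w] w
      by simp
  qed (use msqrt_slit_neg mh in \<open>auto intro!: holomorphic_intros\<close>)
  then show ?thesis by (simp add: roots_neg_def[abs_def])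
qed

lemma root_branches_pos: "root_branches slit_pos roots_pos"
proof -
  have mh: "msqrt_pos holomorphic_on slit_pos"
    unfolding msqrt_pos_def using msqrt_pos_props(3,4) by (intro holomorphic_intros) auto
  have nr: "msqrt_pos w - 1 \<notin> \<real>\<^sub>\<le>\<^sub>0" "msqrt_pos w + 1 \<notin> \<real>\<^sub>\<le>\<^sub>0" if "w \<in> slit_pos" for w
    using msqrt_pos_props(2)[OF that] by (auto simp: complex_nonpos_Reals_iff)
  have "root_branches slit_pos (\<lambda>i w. cardano (nrt 3 (msqrt_pos w - 1)) (nrt 3 (msqrt_pos w + 1)) i)"
  proof (rule root_branches_cardano[where m = msqrt_pos])
    fix w assume w: "w \<in> slit_pos"
    then show "w \<noteq> 0" using slit_avoids[of slit_pos] by auto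
    show "nrt 3 (msqrt_pos w - 1) ^ 3 = msqrt_pos w - 1 \<and> nrt 3 (msqrt_pos w + 1) ^ 3 = msqrt_pos w + 1 \<and>
        (msqrt_pos w)\<^sup>2 * (1 - w) = 1"
      using nrt_power[of 3] nonpos_nonzero[OF nr(1)[OF w]]
        nonpos_nonzero[OF nr(2)[OF w]] msqrt_pos_props(1)[OF w] by simp
  qed (use nr mh in \<open>auto intro!: holomorphic_intros\<close>)
  then show ?thesis by (simp add: roots_pos_def[abs_def])
qed

lemma nrt_minus:
  assumes "Im z \<noteq> 0"
  shows "Im z > 0 \<Longrightarrow> nrt 3 (- z) = cis (- pi / 3) * nrt 3 z"
    "Im z < 0 \<Longrightarrow> nrt 3 (- z) = cis (pi / 3) * nrt 3 z"
proof -
  have z: "z \<noteq> 0" using assms by auto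
  { assume "Im z > 0"
    then have L: "Ln (- z) = Ln z - \<i> * pi" using Ln_minus[OF z] by simp
    show "nrt 3 (- z) = cis (- pi / 3) * nrt 3 z"
      unfolding nrt_def L cis_conv_exp exp_add[symmetric] by (simp add: diff_divide_distrib algebra_simps) }
  { assume "Im z < 0"
    then have L: "Ln (- z) = Ln z + \<i> * pi" using Ln_minus[OF z] by simp
    show "nrt 3 (- z) = cis (pi / 3) * nrt 3 z"
      unfolding nrt_def L cis_conv_exp exp_add[symmetric] by (simp add: add_divide_distrib algebra_simps) }
qed

lemma roots_neg_upper: "w \<in> upper_half \<Longrightarrow> roots_neg i w = roots_mid i w"
proof -
  assume "w \<in> upper_half"
  then have "Im (msqrt w) > 0" using msqrt_props(3)[of w] by (auto simp: upper_half_def slit_defs)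
  then have "nrt 3 (- (1 - msqrt w)) = cis (pi / 3) * nrt 3 (1 - msqrt w)"
    by (intro nrt_minus(2)) auto
  then show ?thesis by (simp add: roots_neg_def roots_mid_def)
qed

lemma cis_third_turns: "cis (pi / 3) * cis (pi / 3) = \<omega>" "cis (- pi / 3) ^ 3 = -1"
    "cis (- pi / 3) * cis (- pi / 3) * cis (- pi / 3) = -1"
proof -
  show "cis (pi / 3) * cis (pi / 3) = \<omega>" by (simp add: \<omega>_def cis_mult)
  show c: "cis (- pi / 3) ^ 3 = -1" by (simp add: Complex.DeMoivre complex_eq_iff)
  then show "cis (- pi / 3) * cis (- pi / 3) * cis (- pi / 3) = -1" by (simp only: power3_eq_cube)
qed

text \<open>Below the axis the principal roots of \<open>1 - m\<close> and \<open>m - 1\<close>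
  differ by another \<open>cis (pi / 3)\<close>. The two factors combine to \<open>\<omega>\<close>,
  which raises the index by one: the monodromy around 0.\<close>

lemma roots_neg_lower:
  assumes "w \<in> lower_half" and i: "i \<in> {1, 2, 3}"
  shows "roots_neg i w = roots_mid (next_index i) w"
proof -
  have "Im (msqrt w) < 0" using msqrt_props(4)[of w] assms(1) by (auto simp: lower_half_def slit_defs)
  then have "nrt 3 (- (msqrt w - 1)) = cis (pi / 3) * nrt 3 (msqrt w - 1)"
    by (intro nrt_minus(2)) auto
  then have a: "cis (pi / 3) * nrt 3 (1 - msqrt w) = \<omega> * nrt 3 (msqrt w - 1)"
    by (simp add: mult.assoc[symmetric] cis_third_turns)
  have "cardano (\<omega> * a) b i = cardano a b (next_index i)" for a b
  proof -
    have 1: "\<omega> * (\<omega> * a) = \<omega>\<^sup>2 * a" by (simp add: power2_eq_square)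
    have "\<omega>\<^sup>2 * (\<omega> * a) = \<omega> ^ 3 * a" by (simp add: power2_eq_square power3_eq_cube)
    then have 2: "\<omega>\<^sup>2 * (\<omega> * a) = a" by (simp add: omega_cube)
    have "cardano (\<omega> * a) b 1 = cardano a b 2" "cardano (\<omega> * a) b 2 = cardano a b 3"
      "cardano (\<omega> * a) b 3 = cardano a b 1"
      by (simp_all only: cardano_simps 1 2)
    moreover have "next_index 1 = 2" "next_index 2 = 3" "next_index 3 = 1" by (simp_all add: next_index_def)
    ultimately show ?thesis using i by (elim insertE emptyE) (simp_all only:)
  qed
  then show ?thesis unfolding roots_neg_def roots_mid_def a .
qed

lemma roots_pos_upper: "w \<in> upper_half \<Longrightarrow> roots_pos i w = roots_mid i w"
  using msqrt_pos_eq(1)[of w] by (simp add: roots_pos_def roots_mid_def upper_half_def)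

text \<open>Changing the sign of \<open>m\<close> exchanges \<open>a\<close> and \<open>b\<close> up
  to a factor \<open>u\<close> with \<open>u ^ 3 = -1\<close>. A twist of the exchanged argument by
  a root of unity acts as a twist of the original one by its square, so index 1 stays and 2, 3 are
  exchanged.\<close>

lemma roots_pos_lower:
  assumes w: "w \<in> lower_half" and i: "i \<in> {1, 2, 3}"
  shows "roots_pos i w = roots_mid (flip_index i) w"
proof -
  have ne: "Im w < 0" "Im w \<noteq> 0" using w by (auto simp: lower_half_def)
  then have m: "msqrt w = - msqrt_pos w" using msqrt_pos_eq(2)[of w] by simp
  have I: "Im (msqrt_pos w) > 0" using msqrt_pos_props(2)[of w] ne by (simp add: slit_defs)
  define u where "u = cis (- pi / 3)"
  define a where "a = nrt 3 (msqrt_pos w - 1)"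
  define b where "b = nrt 3 (msqrt_pos w + 1)"
  have 1: "nrt 3 (- (msqrt_pos w + 1)) = u * b"
    unfolding u_def b_def using I by (intro nrt_minus(1)) auto
  have 2: "nrt 3 (- (msqrt_pos w - 1)) = u * a"
    unfolding u_def a_def using I by (intro nrt_minus(1)) auto
  have "msqrt w - 1 = - (msqrt_pos w + 1)" "msqrt w + 1 = - (msqrt_pos w - 1)" by (simp_all add: m)
  then have mid: "roots_mid k w = cardano (u * b) (u * a) k" for k
    unfolding roots_mid_def using 1 2 by simp
  have pos: "roots_pos k w = cardano a b k" for k by (simp add: roots_pos_def a_def b_def)
  have u3: "u * u * u = -1" unfolding u_def by (rule cis_third_turns)
  have key: "3 / 2 * (c * a) * b * (c * a - b) = 3 / 2 * (d * (u * b)) * (u * a) * (d * (u * b) - u * a)"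
    if c: "c * c = d" "d * d = c" for c d
  proof -
    have "3 / 2 * (d * (u * b)) * (u * a) * (d * (u * b) - u * a) = 3 / 2 * (u * u * u) * (a * b) * (d * d * b - d * a)"
      by (simp add: algebra_simps)
    also have "\<dots> = 3 / 2 * (a * b) * (d * a - c * b)" unfolding u3 c by (simp add: field_simps)
    also have "\<dots> = 3 / 2 * (c * a) * b * (c * a - b)" unfolding c(1)[symmetric] by (simp add: algebra_simps)
    finally show ?thesis by (rule sym)
  qed
  have o: "\<omega> * \<omega> = \<omega>\<^sup>2" "\<omega>\<^sup>2 * \<omega>\<^sup>2 = \<omega>"
    using omega_cube by (simp_all add: power2_eq_square power3_eq_cube mult.assoc)
  have "cardano a b 1 = cardano (u * b) (u * a) 1"
    unfolding cardano_simps by (rule key[of 1 1, OF mult_1_left mult_1_left, unfolded mult_1_left])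
  moreover have "cardano a b 2 = cardano (u * b) (u * a) 3" unfolding cardano_simps by (rule key[OF o])
  moreover have "cardano a b 3 = cardano (u * b) (u * a) 2" unfolding cardano_simps by (rule key[OF o(2,1)])
  ultimately show ?thesis unfolding mid pos using i by (auto simp: flip_index_def)
qed

section \<open>From a root to a labelling\<close>

lemma root_branchesD:
  assumes "root_branches \<Omega> F"
  shows "i \<in> {1, 2, 3} \<Longrightarrow> F i holomorphic_on \<Omega>"
    "w \<in> \<Omega> \<Longrightarrow> cubic_rel w y \<longleftrightarrow> (\<exists>i\<in>{1, 2, 3}. y = F i w)"
    "w \<in> \<Omega> \<Longrightarrow> i \<in> {1, 2, 3} \<Longrightarrow> k \<in> {1, 2, 3} \<Longrightarrow> F i w = F k w \<Longrightarrow> i = k"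
proof -
  show "i \<in> {1, 2, 3} \<Longrightarrow> F i holomorphic_on \<Omega>" using assms unfolding root_branches_def by blast
  show "w \<in> \<Omega> \<Longrightarrow> cubic_rel w y \<longleftrightarrow> (\<exists>i\<in>{1, 2, 3}. y = F i w)"
    using assms unfolding root_branches_def by blast
  assume a: "w \<in> \<Omega>" "i \<in> {1, 2, 3}" "k \<in> {1, 2, 3}" "F i w = F k w"
  have "inj_on (\<lambda>i. F i w) {1, 2, 3}" using assms a(1) unfolding root_branches_def by blast
  from inj_onD[OF this a(4) a(2,3)] show "i = k" .
qed

text \<open>The sets of agreement with the three branches are closed, disjoint and cover the
  connected domain, so one of them is everything.\<close>

lemma continuous_root_is_branch:
  assumes F: "root_branches \<Omega> F" and \<Omega>: "connected \<Omega>'" "\<Omega>' \<subseteq> \<Omega>" "\<Omega>' \<noteq> {}"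
    and f: "continuous_on \<Omega>' f" "\<And>w. w \<in> \<Omega>' \<Longrightarrow> cubic_rel w (f w)"
  shows "\<exists>i\<in>{1, 2, 3}. \<forall>w\<in>\<Omega>'. f w = F i w"
proof -
  define A where "A i = {w \<in> \<Omega>'. f w - F i w = 0}" for i
  have cl: "closedin (top_of_set \<Omega>') (A i)" if "i \<in> {1, 2, 3}" for i
  proof -
    have "continuous_on \<Omega>' (F i)"
      using root_branchesD(1)[OF F that] \<Omega>(2) holomorphic_on_imp_continuous_on continuous_on_subset by blast
    then show ?thesis
      unfolding A_def by (intro continuous_closedin_preimage_constant continuous_intros f(1))
  qed
  have cover: "\<exists>i\<in>{1, 2, 3}. w \<in> A i" if "w \<in> \<Omega>'" for w
  proof -
    have "w \<in> \<Omega>" using that \<Omega>(2) by blast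
    then have "\<exists>i\<in>{1, 2, 3}. f w = F i w" using f(2)[OF that] root_branchesD(2)[OF F] by blast
    then show ?thesis using that by (auto simp: A_def)
  qed
  have disj: "i = k" if "w \<in> A i" "w \<in> A k" "i \<in> {1, 2, 3}" "k \<in> {1, 2, 3}" for w i k
  proof -
    have "w \<in> \<Omega>" "F i w = F k w" using that \<Omega>(2) by (auto simp: A_def)
    then show ?thesis using root_branchesD(3)[OF F _ that(3,4)] by blast
  qed
  obtain w0 where w0: "w0 \<in> \<Omega>'" using \<Omega>(3) by blast
  obtain i where i: "i \<in> {1, 2, 3}" "w0 \<in> A i" using cover[OF w0] by blast
  have "\<Omega>' - A i = (\<Union>k\<in>{1, 2, 3} - {i}. A k)"
  proof (intro set_eqI iffI)
    fix w assume "w \<in> \<Omega>' - A i"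
    then show "w \<in> (\<Union>k\<in>{1, 2, 3} - {i}. A k)" using cover[of w] by blast
  next
    fix w assume "w \<in> (\<Union>k\<in>{1, 2, 3} - {i}. A k)"
    then obtain k where k: "k \<in> {1, 2, 3}" "k \<noteq> i" "w \<in> A k" by blast
    then have "w \<notin> A i" using disj[OF _ k(3) i(1) k(1)] by blast
    then show "w \<in> \<Omega>' - A i" using k(3) by (auto simp: A_def)
  qed
  moreover have "closedin (top_of_set \<Omega>') (\<Union>k\<in>{1, 2, 3} - {i}. A k)"
    using cl by (intro closedin_Union) auto
  ultimately have "closedin (top_of_set \<Omega>') (\<Omega>' - A i)" by simp
  moreover have "A i \<subseteq> \<Omega>'" by (auto simp: A_def)
  ultimately have "openin (top_of_set \<Omega>') (A i)" by (simp add: openin_closedin_eq)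
  then have "A i = {} \<or> A i = \<Omega>'" using cl[OF i(1)] \<Omega>(1) connected_clopen by blast
  then have "A i = \<Omega>'" using i(2) by blast
  then have "f w = F i w" if "w \<in> \<Omega>'" for w using that by (auto simp: A_def set_eq_iff)
  then show ?thesis by (intro bexI[OF _ i(1)] ballI)
qed

context dessin
begin

text \<open>A section is injective, since \<open>j\<close> recovers its argument.\<close>

lemma finite_bad_values:
  assumes S: "is_section j \<Omega> S" and Z: "finite Z"
  shows "finite {w \<in> \<Omega>. S w \<in> insert None (Some ` Z)}"
proof (rule finite_imageD)
  show "finite (S ` {w \<in> \<Omega>. S w \<in> insert None (Some ` Z)})"
  proof (rule finite_subset)
    show "S ` {w \<in> \<Omega>. S w \<in> insert None (Some ` Z)} \<subseteq> insert None (Some ` Z)" by auto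
  qed (use Z in simp)
  show "inj_on S {w \<in> \<Omega>. S w \<in> insert None (Some ` Z)}"
  proof (rule inj_onI)
    fix x y assume x: "x \<in> {w \<in> \<Omega>. S w \<in> insert None (Some ` Z)}"
      and y: "y \<in> {w \<in> \<Omega>. S w \<in> insert None (Some ` Z)}" and eq: "S x = S y"
    have "Some x = j (S x)" using section_j[OF S, of x] x by simp
    also have "j (S x) = Some y" unfolding eq using section_j[OF S, of y] y by simp
    finally show "x = y" by simp
  qed
qed

lemma section_affine_continuous:
  assumes S: "is_section j \<Omega> S" and A: "\<Omega>' \<subseteq> \<Omega>" "\<And>w. w \<in> \<Omega>' \<Longrightarrow> S w \<noteq> None"
  shows "continuous_on \<Omega>' (\<lambda>w. the (S w))"
proof -
  have c: "continuous_map (top_of_set \<Omega>') P1_top S"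
    using is_section_subset[OF S A(1)] by (simp add: is_section_def)
  show ?thesis
    unfolding continuous_on_open_invariant
  proof (intro allI impI)
    fix B :: "complex set" assume "open B"
    then have "openin P1_top (Some ` B)" by (simp add: P1_top_def)
    then have o: "openin (top_of_set \<Omega>') {w \<in> topspace (top_of_set \<Omega>'). S w \<in> Some ` B}"
      by (rule openin_continuous_map_preimage[OF c])
    then obtain A' where A': "open A'" "{w \<in> \<Omega>'. S w \<in> Some ` B} = \<Omega>' \<inter> A'"
      by (auto simp: openin_open)
    have "(\<lambda>w. the (S w)) -` B \<inter> \<Omega>' = {w \<in> \<Omega>'. S w \<in> Some ` B}"
    proof (intro set_eqI iffI)
      fix w assume w: "w \<in> (\<lambda>w. the (S w)) -` B \<inter> \<Omega>'"
      then have "S w = Some (the (S w))" using A(2)[of w] by simp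
      then show "w \<in> {w \<in> \<Omega>'. S w \<in> Some ` B}" using w by auto
    qed auto
    then show "\<exists>A. open A \<and> A \<inter> \<Omega>' = (\<lambda>w. the (S w)) -` B \<inter> \<Omega>'"
      using A' by (auto simp: Int_commute)
  qed
qed

text \<open>Only finitely many values lead to infinity or into \<open>Z\<close>, where nothing is
  known of \<open>y\<close>; removing them leaves the slit plane connected.\<close>

lemma section_branch:
  assumes \<Omega>: "slit_domain \<Omega>" and F: "root_branches \<Omega> F" and S: "is_section j \<Omega> S"
    and Z: "finite Z" and y: "continuous_on (- Z) y"
    "\<And>t w. t \<notin> Z \<Longrightarrow> j (Some t) = Some w \<Longrightarrow> cubic_rel w (y t)"
  shows "\<exists>i\<in>{1, 2, 3}. \<forall>w\<in>\<Omega>. \<forall>t. S w = Some t \<longrightarrow> t \<notin> Z \<longrightarrow> y t = F i w"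
proof -
  define bad where "bad = {w \<in> \<Omega>. S w \<in> insert None (Some ` Z)}"
  have fb: "finite bad" unfolding bad_def by (rule finite_bad_values[OF S Z])
  have conn: "connected (\<Omega> - bad)"
    by (rule connected_open_delete_finite[OF open_slit[OF \<Omega>] starlike_imp_connected[OF starlike_slit[OF \<Omega>]] _ fb])
      simp
  have ne: "\<Omega> - bad \<noteq> {}"
  proof -
    have "\<i> \<in> \<Omega>" using half_plane_slit(1)[OF \<Omega>] by (auto simp: upper_half_def)
    then have "infinite \<Omega>" using open_slit[OF \<Omega>] finite_imp_not_open by blast
    then show ?thesis using fb by (metis Diff_infinite_finite finite.emptyI)
  qed
  have aff: "S w \<noteq> None \<and> the (S w) \<notin> Z" if "w \<in> \<Omega> - bad" for w
    using that by (cases "S w") (auto simp: bad_def)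
  have c: "continuous_on (\<Omega> - bad) (\<lambda>w. the (S w))"
    by (rule section_affine_continuous[OF S]) (use aff in auto)
  have "continuous_on ((\<lambda>w. the (S w)) ` (\<Omega> - bad)) y"
    by (rule continuous_on_subset[OF y(1)]) (use aff in auto)
  from continuous_on_compose[OF c this] have cy: "continuous_on (\<Omega> - bad) (\<lambda>w. y (the (S w)))"
    by (simp add: comp_def)
  have "cubic_rel w (y (the (S w)))" if w: "w \<in> \<Omega> - bad" for w
  proof (rule y(2))
    show "the (S w) \<notin> Z" using aff[OF w] by blast
    show "j (Some (the (S w))) = Some w" using aff[OF w] section_j[OF S, of w] w by auto
  qed
  from continuous_root_is_branch[OF F conn _ ne cy this]
  obtain i where i: "i \<in> {1, 2, 3}" "\<And>w. w \<in> \<Omega> - bad \<Longrightarrow> y (the (S w)) = F i w" by blast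
  have "y t = F i w" if "w \<in> \<Omega>" "S w = Some t" "t \<notin> Z" for w t
    using i(2)[of w] that by (auto simp: bad_def)
  then show ?thesis by (intro bexI[OF _ i(1)] ballI allI impI)
qed

lemma good_point_in_half_plane:
  assumes \<Omega>: "slit_domain \<Omega>" and S: "is_section j \<Omega> S" and Z: "finite Z" and H: "H \<in> {upper_half, lower_half}"
  shows "\<exists>w\<in>H. \<exists>t. S w = Some t \<and> t \<notin> Z"
proof -
  have HO: "H \<subseteq> \<Omega>" using H half_plane_slit[OF \<Omega>] by blast
  have "\<i> \<in> upper_half" "- \<i> \<in> lower_half" by (simp_all add: upper_half_def lower_half_def)
  then have "H \<noteq> {}" "open H" using H half_plane_props by auto
  then have "infinite H" using finite_imp_not_open by blast
  then have "\<not> H \<subseteq> {w \<in> \<Omega>. S w \<in> insert None (Some ` Z)}"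
    using finite_bad_values[OF S Z] finite_subset by blast
  then obtain w where w: "w \<in> H" "S w \<notin> insert None (Some ` Z)" using HO by blast
  then show ?thesis by (cases "S w") auto
qed

definition branch_of_end :: "complex set \<Rightarrow> (complex \<Rightarrow> complex) \<Rightarrow> P1 set \<Rightarrow> nat \<Rightarrow> bool" where
  "branch_of_end Z y h i \<longleftrightarrow> i \<in> {1, 2, 3} \<and>
     (\<exists>s. is_section j slit_mid s \<and> h = s ` unit_interval \<and>
        (\<forall>w\<in>slit_mid. \<forall>t. s w = Some t \<longrightarrow> t \<notin> Z \<longrightarrow> y t = roots_mid i w))"

text \<open>An end is labelled by the branch of \<open>roots_mid\<close> that \<open>y\<close>
  follows on its sheet. On a section over another slit plane \<open>y\<close> also follows one
  branch, whose indices over the two half planes differ by \<open>next_index\<close> or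
  \<open>flip_index\<close>.\<close>

theorem root_imp_compatible:
  assumes Z: "finite Z" and y: "continuous_on (- Z) y"
    "\<And>t w. t \<notin> Z \<Longrightarrow> j (Some t) = Some w \<Longrightarrow> cubic_rel w (y t)"
  shows "\<exists>lab. compatible lab"
proof -
  let ?P = "branch_of_end Z y"
  have ex: "\<exists>i. ?P h i" if h: "h \<in> sk_ends j" for h
  proof -
    obtain s where s: "is_section j slit_mid s" "h = s ` unit_interval" using sk_endsE[OF h] .
    have "\<exists>i\<in>{1, 2, 3}. \<forall>w\<in>slit_mid. \<forall>t. s w = Some t \<longrightarrow> t \<notin> Z \<longrightarrow> y t = roots_mid i w"
      by (rule section_branch[OF slit_domain_simps(1) root_branches_mid s(1) Z y])
    then show ?thesis using s unfolding branch_of_end_def by blast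
  qed
  \<comment> \<open>The index of an end is determined by any piece of its sheet over a half plane,
    because the branches are distinct at a point where \<open>y\<close> is known.\<close>
  have match: "i = k"
    if P: "?P (end_of (S w0)) i" and \<Omega>: "slit_domain \<Omega>" and S: "is_section j \<Omega> S"
      and H: "H \<in> {upper_half, lower_half}" and w0: "w0 \<in> H" and k: "k \<in> {1, 2, 3}"
      and F: "\<And>w t. w \<in> H \<Longrightarrow> S w = Some t \<Longrightarrow> t \<notin> Z \<Longrightarrow> y t = roots_mid k w" for w0 i k S H \<Omega>
  proof -
    have sub: "H \<subseteq> \<Omega>" "H \<subseteq> slit_mid" using H half_plane_slit[OF \<Omega>] half_plane_slit[of slit_mid] by auto
    obtain s where s: "is_section j slit_mid s" "end_of (S w0) = s ` unit_interval" "i \<in> {1, 2, 3}"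
      "\<And>w t. w \<in> slit_mid \<Longrightarrow> s w = Some t \<Longrightarrow> t \<notin> Z \<Longrightarrow> y t = roots_mid i w"
      using P unfolding branch_of_end_def by blast
    have w0m: "w0 \<in> slit_mid" using w0 sub by blast
    obtain s' where s': "is_section j slit_mid s'" "s' w0 = S w0" "end_of (S w0) = s' ` unit_interval"
      using mid_section[OF section_j[OF S] w0m] w0 sub by blast
    have h: "1 / 2 \<in> slit_mid" "1 / 2 \<in> unit_interval" using half_in_unit_interval unit_interval_slit by auto
    \<comment> \<open>The two sheets have the same end, so they meet over 1/2 and coincide.\<close>
    have "s' (1 / 2) \<in> s ` unit_interval" using s'(3) s(2) h by auto
    then obtain w1 where w1: "w1 \<in> unit_interval" "s' (1 / 2) = s w1" by blast
    then have w1h: "w1 = 1 / 2" using section_j[OF s(1), of w1] section_j[OF s'(1) h(1)] unit_interval_slit by auto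
    have "s (1 / 2) = s' (1 / 2)" using w1(2) unfolding w1h by (rule sym)
    then have "s w = s' w" if "w \<in> slit_mid" for w
      using section_slit_unique[OF slit_domain_simps(1) s(1) s'(1) h(1) _ that] by blast
    then have s0: "s w0 = S w0" using s'(2) w0m by simp
    have "connected H" using H half_plane_props by auto
    then have sS: "s w = S w" if "w \<in> H" for w
      by (rule section_unique[OF is_section_subset[OF s(1) sub(2)] is_section_subset[OF S sub(1)] _ _ _ w0 s0 that])
        (use sub slit_avoids[OF \<Omega>] in auto)
    obtain w t where w: "w \<in> H" "S w = Some t" "t \<notin> Z" using good_point_in_half_plane[OF \<Omega> S Z H] by blast
    have "roots_mid i w = roots_mid k w"
      using s(4)[of w t] F[of w t] w sS[of w] sub by auto
    then show ?thesis
      using root_branchesD(3)[OF root_branches_mid _ s(3) k] w sub by blast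
  qed
  define lab where "lab h = (SOME i. ?P h i)" for h
  have lab: "?P h (lab h)" if "h \<in> sk_ends j" for h
    unfolding lab_def using someI_ex[OF ex[OF that]] .
  have ends: "end_of (S u) \<in> sk_ends j" if "slit_domain \<Omega>" "is_section j \<Omega> S" "u \<in> {\<i>, - \<i>}" for \<Omega> S u
  proof -
    have "u \<in> \<Omega>" "u \<in> slit_mid" using that(3) half_plane_slit[OF that(1)]
      by (auto simp: slit_mid_def upper_half_def lower_half_def)
    then show ?thesis using end_of_in_sk_ends[OF section_j[OF that(2)]] by blast
  qed
  have labs: "lab (end_of (S \<i>)) = i \<and> lab (end_of (S (- \<i>))) = k"
    if \<Omega>: "slit_domain \<Omega>" and S: "is_section j \<Omega> S" and i: "i \<in> {1, 2, 3}" "k \<in> {1, 2, 3}"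
      and F: "\<And>w t. w \<in> upper_half \<Longrightarrow> S w = Some t \<Longrightarrow> t \<notin> Z \<Longrightarrow> y t = roots_mid i w"
      "\<And>w t. w \<in> lower_half \<Longrightarrow> S w = Some t \<Longrightarrow> t \<notin> Z \<Longrightarrow> y t = roots_mid k w" for \<Omega> S i k
  proof
    show "lab (end_of (S \<i>)) = i"
      by (rule match[OF lab[OF ends[OF \<Omega> S]] \<Omega> S, of _ upper_half i]) (use i F in \<open>auto simp: upper_half_def\<close>)
    show "lab (end_of (S (- \<i>))) = k"
      by (rule match[OF lab[OF ends[OF \<Omega> S]] \<Omega> S, of _ lower_half k]) (use i F in \<open>auto simp: lower_half_def\<close>)
  qed
  have "compatible lab"
    unfolding compatible_def
  proof (intro conjI ballI allI impI)
    fix h assume "h \<in> sk_ends j"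
    from lab[OF this] show "lab h \<in> {1, 2, 3}" by (simp add: branch_of_end_def)
  next
    fix S assume S: "is_section j slit_neg S"
    have "\<exists>i\<in>{1, 2, 3}. \<forall>w\<in>slit_neg. \<forall>t. S w = Some t \<longrightarrow> t \<notin> Z \<longrightarrow> y t = roots_neg i w"
      by (rule section_branch[OF slit_domain_simps(2) root_branches_neg S Z y])
    then obtain i where i: "i \<in> {1, 2, 3}" "\<And>w t. w \<in> slit_neg \<Longrightarrow> S w = Some t \<Longrightarrow> t \<notin> Z \<Longrightarrow> y t = roots_neg i w"
      by blast
    have n: "next_index i \<in> {1, 2, 3}" using i(1) by (auto simp: next_index_def)
    have "lab (end_of (S \<i>)) = i \<and> lab (end_of (S (- \<i>))) = next_index i"
    proof (rule labs[OF _ S i(1) n])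
      fix w t assume a: "w \<in> upper_half" "S w = Some t" "t \<notin> Z"
      then show "y t = roots_mid i w"
        using i(2)[of w t] half_plane_slit[of slit_neg] roots_neg_upper[of w i] by auto
    next
      fix w t assume a: "w \<in> lower_half" "S w = Some t" "t \<notin> Z"
      then show "y t = roots_mid (next_index i) w"
        using i(2)[of w t] half_plane_slit[of slit_neg] roots_neg_lower[OF a(1) i(1)] by auto
    qed simp
    then show "lab (end_of (S (- \<i>))) = next_index (lab (end_of (S \<i>)))" by simp
  next
    fix S assume S: "is_section j slit_pos S"
    have "\<exists>i\<in>{1, 2, 3}. \<forall>w\<in>slit_pos. \<forall>t. S w = Some t \<longrightarrow> t \<notin> Z \<longrightarrow> y t = roots_pos i w"
      by (rule section_branch[OF slit_domain_simps(3) root_branches_pos S Z y])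
    then obtain i where i: "i \<in> {1, 2, 3}" "\<And>w t. w \<in> slit_pos \<Longrightarrow> S w = Some t \<Longrightarrow> t \<notin> Z \<Longrightarrow> y t = roots_pos i w"
      by blast
    have n: "flip_index i \<in> {1, 2, 3}" using i(1) by (auto simp: flip_index_def)
    have "lab (end_of (S \<i>)) = i \<and> lab (end_of (S (- \<i>))) = flip_index i"
    proof (rule labs[OF _ S i(1) n])
      fix w t assume a: "w \<in> upper_half" "S w = Some t" "t \<notin> Z"
      then show "y t = roots_mid i w"
        using i(2)[of w t] half_plane_slit[of slit_pos] roots_pos_upper[of w i] by auto
    next
      fix w t assume a: "w \<in> lower_half" "S w = Some t" "t \<notin> Z"
      then show "y t = roots_mid (flip_index i) w"
        using i(2)[of w t] half_plane_slit[of slit_pos] roots_pos_lower[OF a(1) i(1)] by auto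
    qed simp
    then show "lab (end_of (S (- \<i>))) = flip_index (lab (end_of (S \<i>)))" by simp
  qed
  then show ?thesis by blast
qed

section \<open>From a labelling to a root\<close>

text \<open>Every point off the fibres over 0 and 1 is reached by a section over one of the slit domains.\<close>

definition domain_of :: "complex \<Rightarrow> complex set" where
  "domain_of w = (if w \<in> slit_mid then slit_mid else if w \<in> slit_neg then slit_neg else slit_pos)"

definition branches_of :: "complex \<Rightarrow> nat \<Rightarrow> complex \<Rightarrow> complex" where
  "branches_of w = (if w \<in> slit_mid then roots_mid else if w \<in> slit_neg then roots_neg else roots_pos)"

text \<open>The label is read off in the upper half plane because there the branches of all three
  families carry the same numbering.\<close>

definition glued_root :: "(P1 set \<Rightarrow> nat) \<Rightarrow> complex \<Rightarrow> complex" where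
  "glued_root lab t = (let w = the (j (Some t)) in
     branches_of w (lab (end_of (lift (domain_of w) (Some t) \<i>))) w)"

lemma branches_of_eq:
  "branches_of w = (if domain_of w = slit_mid then roots_mid else
     if domain_of w = slit_neg then roots_neg else roots_pos)"
proof -
  have "1 / 2 \<in> slit_mid" "1 / 2 \<notin> slit_neg" "1 / 2 \<notin> slit_pos" "-1 \<in> slit_neg" "-1 \<notin> slit_pos"
    by (auto simp: slit_defs)
  then have "slit_neg \<noteq> slit_mid" "slit_pos \<noteq> slit_mid" "slit_pos \<noteq> slit_neg" by metis+
  then show ?thesis by (simp add: branches_of_def domain_of_def)
qed

lemma domain_of:
  assumes "w \<noteq> 0" "w \<noteq> 1"
  shows "w \<in> domain_of w" "slit_domain (domain_of w)" "root_branches (domain_of w) (branches_of w)"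
proof -
  have "w \<in> slit_pos" if "w \<notin> slit_mid" "w \<notin> slit_neg"
  proof -
    have w: "Im w = 0" "Re w \<ge> 0" "\<not> (0 < Re w \<and> Re w < 1)" using that by (auto simp: slit_defs)
    moreover have "Re w \<noteq> 0" "Re w \<noteq> 1" using assms w(1) by (auto simp: complex_eq_iff)
    ultimately show ?thesis by (auto simp: slit_pos_def)
  qed
  then show "w \<in> domain_of w" by (auto simp: domain_of_def)
  show "slit_domain (domain_of w)" by (auto simp: domain_of_def)
  show "root_branches (domain_of w) (branches_of w)"
    using root_branches_mid root_branches_neg root_branches_pos by (auto simp: domain_of_def branches_of_def)
qed

text \<open>On the sheet through \<open>t0\<close> the glued root is a single branch. The domains
  assigned to \<open>w\<close> and \<open>w0\<close> can differ only if \<open>w\<close> is non-real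
  and \<open>w0\<close> lies outside \<open>slit_mid\<close>. Then the upper half plane is covered
  by the normalization of the branches, the lower one by compatibility.\<close>

lemma glued_root_local:
  assumes lab: "compatible lab" and t0: "j (Some t0) = Some w0" "w0 \<noteq> 0" "w0 \<noteq> 1"
  obtains k N where "k \<in> {1, 2, 3}" "open N" "t0 \<in> N"
    "\<And>t. t \<in> N \<Longrightarrow> \<exists>w\<in>domain_of w0. j (Some t) = Some w \<and> glued_root lab t = branches_of w0 k w"
proof -
  define \<Omega>0 where "\<Omega>0 = domain_of w0"
  note d = domain_of[OF t0(2,3), folded \<Omega>0_def]
  define S0 where "S0 = lift \<Omega>0 (Some t0)"
  have S0: "is_section j \<Omega>0 S0" "S0 w0 = Some t0"
    unfolding S0_def by (rule lift_section[OF d(2) t0(1) d(1)])+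
  define k where "k = lab (end_of (S0 \<i>))"
  have iO: "\<i> \<in> \<Omega>" "- \<i> \<in> \<Omega>" if "slit_domain \<Omega>" for \<Omega>
    using half_plane_slit[OF that] by (auto simp: upper_half_def lower_half_def)
  have "end_of (S0 \<i>) \<in> sk_ends j"
    by (rule end_of_in_sk_ends[OF section_j[OF S0(1) iO(1)[OF d(2)]]]) (simp add: slit_mid_def)
  then have k3: "k \<in> {1, 2, 3}" using lab unfolding compatible_def k_def by blast
  have op: "openin P1_top (S0 ` \<Omega>0)"
    by (rule section_openin[OF S0(1) open_slit[OF d(2)] slit_avoids[OF d(2)]])
  show ?thesis
  proof (rule that[OF k3])
    show "open {t. Some t \<in> S0 ` \<Omega>0}" using op by (simp add: openin_P1)
    show "t0 \<in> {t. Some t \<in> S0 ` \<Omega>0}" using S0(2) d(1) by force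
    fix t assume "t \<in> {t. Some t \<in> S0 ` \<Omega>0}"
    then obtain w where w: "w \<in> \<Omega>0" "Some t = S0 w" by blast
    then have jt: "j (Some t) = Some w" using section_j[OF S0(1)] by simp
    have w01: "w \<noteq> 0" "w \<noteq> 1" using w(1) slit_avoids[OF d(2)] by auto
    define \<Omega> where "\<Omega> = domain_of w"
    note e = domain_of[OF w01, folded \<Omega>_def]
    define S where "S = lift \<Omega> (Some t)"
    have S: "is_section j \<Omega> S" "S w = Some t"
      unfolding S_def by (rule lift_section[OF e(2) jt e(1)])+
    have gr: "glued_root lab t = branches_of w (lab (end_of (S \<i>))) w"
      by (simp add: glued_root_def jt S_def \<Omega>_def Let_def)
    have "glued_root lab t = branches_of w0 k w"
    proof (cases "\<Omega> = \<Omega>0")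
      case True
      have "S \<i> = S0 \<i>"
        using section_slit_unique[OF d(2) S(1)[unfolded True] S0(1) w(1) _ iO(1)[OF d(2)]] S(2) w(2) by simp
      moreover have "branches_of w = branches_of w0"
        using True unfolding \<Omega>_def \<Omega>0_def branches_of_eq by simp
      ultimately show ?thesis using gr by (simp add: k_def)
    next
      case False
      then have nm: "w \<in> slit_mid" "w0 \<notin> slit_mid"
        using w(1) unfolding \<Omega>_def \<Omega>0_def domain_of_def
        by (auto split: if_splits simp: slit_defs)
      then have O: "\<Omega> = slit_mid" and bm: "branches_of w = roots_mid"
        by (auto simp: \<Omega>_def domain_of_def branches_of_def)
      have "Im w \<noteq> 0"
        using nm w(1) unfolding \<Omega>0_def domain_of_def by (auto simp: slit_defs split: if_splits)
      then consider "w \<in> upper_half" | "w \<in> lower_half" by (auto simp: upper_half_def lower_half_def) linarith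
      then show ?thesis
      proof cases
        case 1
        have "S \<i> = S0 \<i>"
          by (rule section_unique[OF is_section_subset[OF S(1) half_plane_slit(1)[OF e(2)]]
                is_section_subset[OF S0(1) half_plane_slit(1)[OF d(2)]] half_plane_props(3) _ _ 1])
            (use S(2) w(2) in \<open>auto simp: upper_half_def\<close>)
        then have "glued_root lab t = roots_mid k w" using gr bm by (simp add: k_def)
        then show ?thesis
          using nm(2) roots_neg_upper[OF 1] roots_pos_upper[OF 1] by (simp add: branches_of_def)
      next
        case 2
        have "S (- \<i>) = S0 (- \<i>)"
          by (rule section_unique[OF is_section_subset[OF S(1) half_plane_slit(2)[OF e(2)]]
                is_section_subset[OF S0(1) half_plane_slit(2)[OF d(2)]] half_plane_props(4) _ _ 2])
            (use S(2) w(2) in \<open>auto simp: lower_half_def\<close>)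
        \<comment> \<open>Here \<open>S\<close> is a sheet over \<open>slit_mid\<close>, which has
          the same end above and below.\<close>
        moreover have "end_of (S \<i>) = end_of (S (- \<i>))"
          using end_of_section[OF S(1)[unfolded O]] iO[of slit_mid] by simp
        ultimately have g: "glued_root lab t = roots_mid (lab (end_of (S0 (- \<i>)))) w"
          using gr bm by simp
        show ?thesis
        proof (cases "w0 \<in> slit_neg")
          case True
          then have "\<Omega>0 = slit_neg" using nm(2) by (simp add: \<Omega>0_def domain_of_def)
          then have "lab (end_of (S0 (- \<i>))) = next_index k"
            using lab S0(1) unfolding compatible_def k_def by blast
          then show ?thesis using g roots_neg_lower[OF 2 k3] True nm(2) by (simp add: branches_of_def)
        next
          case False
          then have "\<Omega>0 = slit_pos" using nm(2) by (simp add: \<Omega>0_def domain_of_def)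
          then have "lab (end_of (S0 (- \<i>))) = flip_index k"
            using lab S0(1) unfolding compatible_def k_def by blast
          then show ?thesis using g roots_pos_lower[OF 2 k3] False nm(2) by (simp add: branches_of_def)
        qed
      qed
    qed
    then show "\<exists>w\<in>domain_of w0. j (Some t) = Some w \<and> glued_root lab t = branches_of w0 k w"
      using w(1) jt unfolding \<Omega>0_def by blast
  qed
qed

end

section \<open>Back to the Weierstrass equation: estimates and extension\<close>

text \<open>After substitution, and multiplication by the denominator of \<open>w\<close>, the
  relation is \<open>108 * p ^ 3 / q\<close> times the Weierstrass equation.\<close>

lemma cubic_rel_weierstrass:
  fixes p q x :: complex
  assumes "p \<noteq> 0" "q \<noteq> 0" "4 * p ^ 3 + 27 * q ^ 2 \<noteq> 0"
  shows "cubic_rel (4 * p ^ 3 / (4 * p ^ 3 + 27 * q ^ 2)) (x * p / q) \<longleftrightarrow> x ^ 3 + p * x + q = 0"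
proof -
  define D where "D = 4 * p ^ 3 + 27 * q ^ 2"
  define w where "w = 4 * p ^ 3 / D"
  define y where "y = x * p / q"
  have D: "D \<noteq> 0" using assms by (simp add: D_def)
  have Dw: "D * w = 4 * p ^ 3" "D * (1 - w) = 27 * q ^ 2"
    using D by (simp_all add: w_def right_diff_distrib) (simp add: D_def)
  have "D * (4 * (1 - w) * y ^ 3 + 27 * w * y + 27 * w) =
      4 * (D * (1 - w)) * y ^ 3 + 27 * (D * w) * y + 27 * (D * w)" by (simp add: algebra_simps)
  also have "\<dots> = 108 * (q ^ 2 * y ^ 3 + p ^ 3 * y + p ^ 3)" unfolding Dw by (simp add: algebra_simps)
  also have "q ^ 2 * y ^ 3 + p ^ 3 * y + p ^ 3 = p ^ 3 / q * (x ^ 3 + p * x + q)"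
    using assms(2) by (simp add: y_def field_simps power2_eq_square power3_eq_cube)
  finally have "D * (4 * (1 - w) * y ^ 3 + 27 * w * y + 27 * w) = 108 * (p ^ 3 / q * (x ^ 3 + p * x + q))" .
  then have "4 * (1 - w) * y ^ 3 + 27 * w * y + 27 * w = 0 \<longleftrightarrow> x ^ 3 + p * x + q = 0"
    using D assms by (metis divide_eq_0_iff mult_eq_0_iff power_eq_0_iff zero_neq_numeral)
  then show ?thesis unfolding cubic_rel_def w_def y_def D_def .
qed

text \<open>For \<open>norm x > 1\<close> the cube of the norm is at most
  \<open>norm x * (norm p + norm q)\<close>. The bound gives both the removable singularities and
  the polynomial growth at infinity.\<close>

lemma depressed_cubic_root_bound:
  fixes x p q :: complex
  assumes "x ^ 3 + p * x + q = 0"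
  shows "norm x \<le> 1 + norm p + norm q"
proof (cases "norm x \<le> 1")
  case True
  then show ?thesis by (smt (verit) norm_ge_zero)
next
  case False
  then have x: "norm x > 1" by simp
  have "x ^ 3 = - (p * x + q)" using assms by (simp add: algebra_simps eq_neg_iff_add_eq_0)
  then have "norm x ^ 3 = norm (p * x + q)" by (metis norm_minus_cancel norm_power)
  also have "\<dots> \<le> norm p * norm x + norm q" by (metis norm_mult norm_triangle_ineq)
  also have "\<dots> \<le> (norm p + norm q) * norm x"
    using x mult_left_mono[of 1 "norm x" "norm q"] by (simp add: algebra_simps)
  finally have "norm x * norm x ^ 2 \<le> norm x * (norm p + norm q)"
    by (simp add: power3_eq_cube power2_eq_square algebra_simps)
  then have "norm x ^ 2 \<le> norm p + norm q" using x by (auto simp: mult_le_cancel_left)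
  moreover have "norm x \<le> norm x ^ 2"
    using mult_left_mono[of 1 "norm x" "norm x"] x by (simp add: power2_eq_square)
  ultimately show ?thesis by simp
qed

lemma eventually_at_notin_finite:
  fixes \<xi> :: complex
  assumes "finite A"
  shows "eventually (\<lambda>z. z \<notin> A) (at \<xi>)"
  unfolding eventually_at_topological
  using open_Compl[OF finite_imp_closed[OF finite_Diff[OF assms]], of "{\<xi>}"]
  by (intro exI[of _ "- (A - {\<xi>})"]) simp

text \<open>Singularities are removed one at a time; near each remaining one the extension still
  agrees with \<open>f\<close>, so boundedness persists.\<close>

lemma removable_finite:
  fixes f :: "complex \<Rightarrow> complex"
  assumes "finite Z" "f holomorphic_on (- Z)"
    "\<And>\<xi>. \<xi> \<in> Z \<Longrightarrow> \<exists>B. eventually (\<lambda>z. norm (f z) \<le> B) (at \<xi>)"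
  shows "\<exists>g. g holomorphic_on UNIV \<and> (\<forall>z. z \<notin> Z \<longrightarrow> g z = f z)"
  using assms
proof (induction Z arbitrary: f rule: finite_induct)
  case empty
  then show ?case by auto
next
  case (insert \<xi> Z)
  have op: "open (- Z)" using insert(1) by (simp add: finite_imp_closed open_Compl)
  have S: "- insert \<xi> Z = - Z - {\<xi>}" by auto
  have int: "\<xi> \<in> interior (- Z)" using op insert(2) by (simp add: interior_open)
  have "f holomorphic_on (- Z - {\<xi>})" using insert.prems(1) S by simp
  from holomorphic_on_extend_bounded[OF this int] insert.prems(2)[of \<xi>]
  obtain g where g: "g holomorphic_on (- Z)" "\<And>z. z \<in> - Z - {\<xi>} \<Longrightarrow> g z = f z" by auto
  have "\<exists>B. eventually (\<lambda>z. norm (g z) \<le> B) (at \<zeta>)" if \<zeta>: "\<zeta> \<in> Z" for \<zeta>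
  proof -
    obtain B where B: "eventually (\<lambda>z. norm (f z) \<le> B) (at \<zeta>)" using insert.prems(2)[of \<zeta>] \<zeta> by auto
    have "eventually (\<lambda>z. z \<notin> insert \<xi> Z) (at \<zeta>)"
      using insert(1) by (intro eventually_at_notin_finite) simp
    then have "eventually (\<lambda>z. norm (g z) \<le> B) (at \<zeta>)"
      using B
    proof eventually_elim
      case (elim z)
      then have "g z = f z" by (intro g(2)) auto
      then show ?case using elim by simp
    qed
    then show ?thesis by blast
  qed
  from insert.IH[OF g(1) this] obtain h where h: "h holomorphic_on UNIV" "\<And>z. z \<notin> Z \<Longrightarrow> h z = g z" by blast
  have "h z = f z" if "z \<notin> insert \<xi> Z" for z using that h(2)[of z] g(2)[of z] by auto
  then show ?case using h(1) by blast
qed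

lemma poly_growth:
  fixes p :: "complex poly"
  assumes "degree p \<le> n"
  shows "\<exists>B. \<forall>z. norm z \<ge> 1 \<longrightarrow> norm (poly p z) \<le> B * norm z ^ n"
proof (intro exI allI impI)
  fix z :: complex assume z: "norm z \<ge> 1"
  have "norm (poly p z) \<le> (\<Sum>i\<le>degree p. norm (coeff p i * z ^ i))"
    unfolding poly_altdef by (rule norm_sum)
  also have "\<dots> \<le> (\<Sum>i\<le>degree p. norm (coeff p i) * norm z ^ n)"
  proof (rule sum_mono)
    fix i assume "i \<in> {..degree p}"
    then have "norm z ^ i \<le> norm z ^ n" using z assms by (intro power_increasing) auto
    then show "norm (coeff p i * z ^ i) \<le> norm (coeff p i) * norm z ^ n"
      by (simp add: norm_mult norm_power mult_left_mono)
  qed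
  finally show "norm (poly p z) \<le> (\<Sum>i\<le>degree p. norm (coeff p i)) * norm z ^ n"
    by (simp add: sum_distrib_right)
qed

context dessin
begin

text \<open>For the converse, \<open>y\<close> is glued from branches and holomorphic off
  \<open>Z\<close>. The extension over \<open>Z\<close> is carried out for \<open>x\<close>, as
  \<open>y\<close> can have poles while \<open>x\<close> is bounded by the coefficients.\<close>

theorem compatible_iff_polynomial_root:
  fixes g2 g3 :: "complex poly"
  assumes Z: "finite Z"
    and ne: "\<And>t. t \<notin> Z \<Longrightarrow> poly g2 t \<noteq> 0 \<and> poly g3 t \<noteq> 0 \<and> 4 * poly g2 t ^ 3 + 27 * poly g3 t ^ 2 \<noteq> 0"
    and j: "\<And>t. t \<notin> Z \<Longrightarrow> j (Some t) = Some (4 * poly g2 t ^ 3 / (4 * poly g2 t ^ 3 + 27 * poly g3 t ^ 2))"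
  shows "(\<exists>lab. compatible lab) \<longleftrightarrow> (\<exists>s. s ^ 3 + g2 * s + g3 = 0)"
proof
  assume "\<exists>s. s ^ 3 + g2 * s + g3 = 0"
  then obtain s where s: "s ^ 3 + g2 * s + g3 = 0" by blast
  have ps: "poly s t ^ 3 + poly g2 t * poly s t + poly g3 t = 0" for t
    using arg_cong[OF s, of "\<lambda>p. poly p t"] by simp
  show "\<exists>lab. compatible lab"
  proof (rule root_imp_compatible[OF Z])
    show "continuous_on (- Z) (\<lambda>t. poly s t * poly g2 t / poly g3 t)"
      using ne by (intro continuous_intros) auto
    fix t w assume "t \<notin> Z" "j (Some t) = Some w"
    then have "w = 4 * poly g2 t ^ 3 / (4 * poly g2 t ^ 3 + 27 * poly g3 t ^ 2)" using j by simp
    then show "cubic_rel w (poly s t * poly g2 t / poly g3 t)"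
      using cubic_rel_weierstrass[of "poly g2 t" "poly g3 t" "poly s t"] ne[OF \<open>t \<notin> Z\<close>] ps by simp
  qed
next
  assume "\<exists>lab. compatible lab"
  then obtain lab where lab: "compatible lab" by blast
  define J where "J t = 4 * poly g2 t ^ 3 / (4 * poly g2 t ^ 3 + 27 * poly g3 t ^ 2)" for t
  have jJ: "j (Some t) = Some (J t)" if "t \<notin> Z" for t using j[OF that] by (simp add: J_def)
  have J01: "J t \<noteq> 0" "J t \<noteq> 1" if "t \<notin> Z" for t
    using ne[OF that] by (auto simp: J_def divide_eq_1_iff)
  have Jh: "J holomorphic_on (- Z)"
    unfolding J_def using ne by (intro holomorphic_intros) auto
  have opZ: "open (- Z)" using Z by (simp add: finite_imp_closed open_Compl)
  define y where "y = glued_root lab"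
  have y: "y field_differentiable (at t0) \<and> cubic_rel (J t0) (y t0)" if t0: "t0 \<notin> Z" for t0
  proof -
    note d = domain_of[OF J01[OF t0]]
    obtain k N where k: "k \<in> {1, 2, 3}" and N: "open N" "t0 \<in> N"
      "\<And>t. t \<in> N \<Longrightarrow> \<exists>w\<in>domain_of (J t0). j (Some t) = Some w \<and> glued_root lab t = branches_of (J t0) k w"
      using glued_root_local[OF lab jJ[OF t0] J01[OF t0]] by metis
    let ?N = "N \<inter> - Z"
    have loc: "J t \<in> domain_of (J t0)" "y t = branches_of (J t0) k (J t)" if "t \<in> ?N" for t
      using N(3)[of t] jJ[of t] that by (auto simp: y_def)
    have "J holomorphic_on ?N" by (rule holomorphic_on_subset[OF Jh]) simp
    moreover have "branches_of (J t0) k holomorphic_on (J ` ?N)"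
      using loc(1) by (intro holomorphic_on_subset[OF root_branchesD(1)[OF d(3) k]]) auto
    ultimately have "(branches_of (J t0) k \<circ> J) holomorphic_on ?N" by (rule holomorphic_on_compose)
    then have "y holomorphic_on ?N"
      by (rule holomorphic_transform) (use loc in auto)
    moreover have "open ?N" "t0 \<in> ?N" using N opZ t0 by auto
    ultimately have "y field_differentiable (at t0)" by (metis holomorphic_on_imp_differentiable_at)
    moreover have "cubic_rel (J t0) (y t0)"
      using root_branchesD(2)[OF d(3) d(1)] k loc(2)[of t0] N(2) t0 by auto
    ultimately show ?thesis ..
  qed
  \<comment> \<open>The inverse of the substitution \<open>y = x * g2 / g3\<close>.\<close>
  define X where "X t = poly g3 t / poly g2 t * y t" for t
  have X: "X t ^ 3 + poly g2 t * X t + poly g3 t = 0" if "t \<notin> Z" for t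
  proof -
    have "X t * poly g2 t / poly g3 t = y t" using ne[OF that] by (simp add: X_def)
    then show ?thesis
      using cubic_rel_weierstrass[of "poly g2 t" "poly g3 t" "X t"] ne[OF that] y[OF that]
      by (simp add: J_def)
  qed
  have "y holomorphic_on (- Z)"
    unfolding holomorphic_on_def using y field_differentiable_at_within by blast
  then have Xh: "X holomorphic_on (- Z)"
    unfolding X_def using ne by (intro holomorphic_intros) auto
  have "\<exists>B. eventually (\<lambda>z. norm (X z) \<le> B) (at \<xi>)" if "\<xi> \<in> Z" for \<xi>
  proof -
    let ?f = "\<lambda>t. 1 + norm (poly g2 t) + norm (poly g3 t)"
    have "(?f \<longlongrightarrow> ?f \<xi>) (at \<xi>)" by (intro tendsto_intros poly_isCont[unfolded isCont_def])
    then have "eventually (\<lambda>t. ?f t < ?f \<xi> + 1) (at \<xi>)" by (rule order_tendstoD) simp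
    moreover have "eventually (\<lambda>t. t \<notin> Z) (at \<xi>)" by (rule eventually_at_notin_finite[OF Z])
    ultimately have "eventually (\<lambda>t. norm (X t) \<le> ?f \<xi> + 1) (at \<xi>)"
    proof eventually_elim
      case (elim t)
      from depressed_cubic_root_bound[OF X[OF elim(2)]] elim(1) show ?case by linarith
    qed
    then show ?thesis by blast
  qed
  from removable_finite[OF Z Xh this] obtain G where
    G: "G holomorphic_on UNIV" "\<And>z. z \<notin> Z \<Longrightarrow> G z = X z" by blast
  define n where "n = max (degree g2) (degree g3)"
  obtain B2 where B2: "\<And>z. norm z \<ge> 1 \<Longrightarrow> norm (poly g2 z) \<le> B2 * norm z ^ n"
    using poly_growth[of g2 n] by (auto simp: n_def)
  obtain B3 where B3: "\<And>z. norm z \<ge> 1 \<Longrightarrow> norm (poly g3 z) \<le> B3 * norm z ^ n"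
    using poly_growth[of g3 n] by (auto simp: n_def)
  obtain R where R: "\<And>z. z \<in> Z \<Longrightarrow> norm z \<le> R"
    using finite_imp_bounded[OF Z] by (auto simp: bounded_iff)
  have "norm (G z) \<le> (1 + B2 + B3) * norm z ^ n" if z: "max 1 (R + 1) \<le> norm z" for z
  proof -
    have zZ: "z \<notin> Z" using R z by fastforce
    have "norm (G z) \<le> 1 + norm (poly g2 z) + norm (poly g3 z)"
      using depressed_cubic_root_bound[OF X[OF zZ]] G(2)[OF zZ] by simp
    moreover have "1 \<le> norm z ^ n" using z by (intro one_le_power) simp
    moreover have "norm (poly g2 z) \<le> B2 * norm z ^ n" "norm (poly g3 z) \<le> B3 * norm z ^ n"
      using B2[of z] B3[of z] z by simp_all
    moreover have "(1 + B2 + B3) * norm z ^ n = norm z ^ n + B2 * norm z ^ n + B3 * norm z ^ n"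
      by (simp add: algebra_simps)
    ultimately show ?thesis by linarith
  qed
  from Liouville_polynomial[OF G(1) this]
  have poly_G: "G z = (\<Sum>i\<le>n. (deriv ^^ i) G 0 / fact i * z ^ i)" for z by blast
  define s where "s = (\<Sum>i\<le>n. monom ((deriv ^^ i) G 0 / fact i) i)"
  have s: "poly s z = G z" for z unfolding poly_G[of z] by (simp add: s_def poly_sum poly_monom)
  have "s ^ 3 + g2 * s + g3 = 0"
  proof (rule ccontr)
    assume "s ^ 3 + g2 * s + g3 \<noteq> 0"
    then have "finite {t. poly (s ^ 3 + g2 * s + g3) t = 0}" by (rule poly_roots_finite)
    moreover have "- Z \<subseteq> {t. poly (s ^ 3 + g2 * s + g3) t = 0}"
      using X G(2) by (auto simp: s)
    ultimately have "finite (- Z)" using finite_subset by blast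
    then have "finite (UNIV :: complex set)" using Z by (metis Compl_partition finite_UnI)
    then show False using infinite_UNIV_char_0 by blast
  qed
  then show "\<exists>s. s ^ 3 + g2 * s + g3 = 0" by blast
qed

end

section \<open>Reducibility\<close>

subsection \<open>Bivariate polynomials\<close>

definition eval2 :: "complex poly poly \<Rightarrow> complex \<Rightarrow> complex \<Rightarrow> complex" where
  "eval2 F a b = poly (poly F [:b:]) a"

definition specialize :: "complex \<Rightarrow> complex poly poly \<Rightarrow> complex poly" where
  "specialize a F = map_poly (\<lambda>p. poly p a) F"

lemma poly_specialize: "poly (specialize a F) b = eval2 F a b"
  unfolding specialize_def eval2_def
  by (induction F) (simp_all add: map_poly_pCons)

lemma coeff_specialize: "coeff (specialize a F) i = poly (coeff F i) a"
  unfolding specialize_def by (simp add: coeff_map_poly)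

lemma degree_specialize: "degree (specialize a F) \<le> degree F"
  by (rule degree_le) (simp add: coeff_specialize coeff_eq_0)

lemma eval2_mult: "eval2 (F * G) a b = eval2 F a b * eval2 G a b"
  and eval2_add: "eval2 (F + G) a b = eval2 F a b + eval2 G a b"
  by (simp_all add: eval2_def)

text \<open>The coefficients are polynomials and form no field; for a monic divisor, pseudo-division
  introduces no extra factor.\<close>

lemma monic_division:
  fixes G :: "complex poly poly"
  assumes G: "lead_coeff G = 1" "degree G > 0"
  obtains Q R where "F = G * Q + R" "degree R < degree G"
proof -
  have G0: "G \<noteq> 0" using G by auto
  obtain Q R where qr: "pseudo_divmod F G = (Q, R)" by (cases "pseudo_divmod F G")
  from pseudo_divmod[OF G0 qr] G show ?thesis by (intro that[of Q R]) auto
qed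

text \<open>On each fibre over \<open>T\<close> the specialized polynomial has three zeros but
  degree below 3, so every coefficient of \<open>R\<close> vanishes at infinitely many
  points.\<close>

lemma vanishing_on_three_roots:
  assumes R: "degree R < 3" and T: "infinite T" "\<And>t. t \<in> T \<Longrightarrow> card {b. eval2 V t b = 0} = 3"
    and z: "\<And>t b. t \<in> T \<Longrightarrow> eval2 V t b = 0 \<Longrightarrow> eval2 R t b = 0"
  shows "R = 0"
proof (rule poly_eqI)
  fix i
  have "poly (coeff R i) t = 0" if t: "t \<in> T" for t
  proof -
    have "specialize t R = 0"
    proof (rule ccontr)
      assume n: "specialize t R \<noteq> 0"
      have "{b. eval2 V t b = 0} \<subseteq> {b. poly (specialize t R) b = 0}"
        using z[OF t] by (auto simp: poly_specialize)
      then have "3 \<le> card {b. poly (specialize t R) b = 0}"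
        using T(2)[OF t] card_mono poly_roots_finite[OF n] by metis
      also have "\<dots> \<le> degree (specialize t R)" by (rule card_poly_roots_bound[OF n])
      also have "\<dots> \<le> degree R" by (rule degree_specialize)
      finally show False using R by simp
    qed
    then show ?thesis by (metis coeff_0 coeff_specialize)
  qed
  then have "T \<subseteq> {t. poly (coeff R i) t = 0}" by blast
  then have "infinite {t. poly (coeff R i) t = 0}" using T(1) finite_subset by blast
  then show "coeff R i = coeff 0 i" using poly_roots_finite by auto
qed

text \<open>The leading coefficients of two factors of a monic polynomial are units. A proper
  factorization of a cubic has a factor of degree 1, and this has a polynomial root.\<close>

lemma irreducible_cubic:
  fixes V :: "complex poly poly"
  assumes V: "lead_coeff V = 1" "degree V = 3" and nr: "\<And>s. poly V s \<noteq> 0"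
  shows "irreducible V"
proof (rule irreducibleI)
  show "V \<noteq> 0" using V by auto
  show "\<not> is_unit V" using V by (auto dest: is_unit_polyE simp: is_unit_poly_iff)
  fix P Q assume PQ: "V = P * Q"
  have ne: "P \<noteq> 0" "Q \<noteq> 0" using PQ V by auto
  have d: "degree P + degree Q = 3" using V(2) ne unfolding PQ by (simp add: degree_mult_eq)
  have l: "lead_coeff P * lead_coeff Q = 1" using V(1) unfolding PQ by (simp add: lead_coeff_mult)
  have const: "is_unit A" if "degree A = 0" "lead_coeff A * c = 1" for A :: "complex poly poly" and c
  proof -
    obtain a where a: "A = [:a:]" using \<open>degree A = 0\<close> by (rule degree_eq_zeroE)
    then have "a * c = 1" using that by simp
    then have "is_unit a" by (metis dvd_triv_left)
    then show ?thesis by (simp add: a is_unit_const_poly_iff)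
  qed
  have lin: False if "degree A = 1" "lead_coeff A * c = 1" "A dvd V" for A :: "complex poly poly" and c
  proof -
    have A: "A = [:coeff A 0, coeff A 1:]"
      by (rule poly_eqI) (use \<open>degree A = 1\<close> in \<open>auto simp: coeff_pCons coeff_eq_0 split: nat.split\<close>)
    \<comment> \<open>As \<open>c\<close> is inverse to the leading coefficient, the root of the
      linear factor involves no division.\<close>
    have "poly A (- (c * coeff A 0)) = coeff A 0 - coeff A 1 * c * coeff A 0"
      by (subst A) (simp add: algebra_simps)
    also have "coeff A 1 * c = 1" using that by simp
    finally have "poly A (- (c * coeff A 0)) = 0" by simp
    moreover obtain B where "V = A * B" using \<open>A dvd V\<close> by blast
    ultimately have "poly V (- (c * coeff A 0)) = 0" by simp
    then show False using nr by blast
  qed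
  have "degree P \<noteq> 1" using lin[of P "lead_coeff Q"] l PQ by auto
  moreover have "degree Q \<noteq> 1" using lin[of Q "lead_coeff P"] l PQ by (auto simp: mult.commute)
  ultimately have "degree P = 0 \<or> degree Q = 0" using d by linarith
  then show "is_unit P \<or> is_unit Q"
    using const[of P "lead_coeff Q"] const[of Q "lead_coeff P"] l by (auto simp: mult.commute)
qed

text \<open>Reduced modulo the cubic, the equations of the two parts have a product that vanishes at the three
  roots over infinitely many points and hence is divisible by the cubic.\<close>

lemma irreducible_cubic_component:
  assumes V: "lead_coeff V = 1" "degree V = 3" "irreducible V"
    and T: "infinite T" "\<And>t. t \<in> T \<Longrightarrow> card {b. eval2 V t b = 0} = 3"
    and un: "\<And>t b. eval2 V t b = 0 \<Longrightarrow> eval2 F1 t b = 0 \<or> eval2 F2 t b = 0"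
  shows "(\<forall>t b. eval2 V t b = 0 \<longrightarrow> eval2 F1 t b = 0) \<or> (\<forall>t b. eval2 V t b = 0 \<longrightarrow> eval2 F2 t b = 0)"
proof -
  have d: "degree V > 0" using V(2) by simp
  obtain Q R where QR: "F1 * F2 = V * Q + R" "degree R < degree V"
    using monic_division[OF V(1) d] by blast
  have "R = 0"
  proof (rule vanishing_on_three_roots[OF _ T])
    show "degree R < 3" using QR V(2) by simp
    fix t b assume v: "eval2 V t b = 0"
    have "eval2 (F1 * F2) t b = 0" using un[OF v] by (auto simp: eval2_mult)
    then show "eval2 R t b = 0" unfolding QR(1) eval2_add eval2_mult v by simp
  qed
  then have "V dvd F1 * F2" using QR by simp
  moreover have "prime_elem V" using V(3) by (rule irreducible_imp_prime_elem)
  ultimately have "V dvd F1 \<or> V dvd F2" by (simp add: prime_elem_dvd_mult_iff)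
  then show ?thesis by (auto simp: eval2_mult elim!: dvdE)
qed

text \<open>The remainder modulo \<open>V\<close> vanishes already by the fibres over
  \<open>T\<close>, so \<open>V\<close> divides \<open>F\<close>. In the chart at infinity this
  extends a containment to the fibre over infinity.\<close>

lemma contained_on_generic_fibres:
  assumes V: "lead_coeff V = 1" "degree V = 3"
    and T: "infinite T" "\<And>t. t \<in> T \<Longrightarrow> card {b. eval2 V t b = 0} = 3"
    and F: "\<And>t b. t \<in> T \<Longrightarrow> eval2 V t b = 0 \<Longrightarrow> eval2 F t b = 0"
  shows "eval2 V t b = 0 \<Longrightarrow> eval2 F t b = 0"
proof -
  have d: "degree V > 0" using V(2) by simp
  obtain Q R where QR: "F = V * Q + R" "degree R < degree V" using monic_division[OF V(1) d] by blast
  have "R = 0"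
  proof (rule vanishing_on_three_roots[OF _ T])
    show "degree R < 3" using QR V(2) by simp
    fix t b assume t: "t \<in> T" and v: "eval2 V t b = 0"
    then show "eval2 R t b = 0" using F[OF t v] unfolding QR(1) eval2_add eval2_mult v by simp
  qed
  then show "eval2 V t b = 0 \<Longrightarrow> eval2 F t b = 0" using QR by (simp add: eval2_mult)
qed

subsection \<open>Sections at infinity\<close>

abbreviation reflect :: "nat \<Rightarrow> complex poly \<Rightarrow> complex poly" where
  "reflect n p \<equiv> section_at n p None"

lemma poly_section_Some: "poly (section_at n p (Some a)) u = poly p (a + u)"
  by (simp add: section_at_def poly_pcompose algebra_simps)

lemma poly_reflect:
  assumes "degree p \<le> n" "u \<noteq> 0"
  shows "poly (reflect n p) u = u ^ n * poly p (1 / u)"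
proof -
  have "poly (reflect n p) u = (\<Sum>i\<le>n. coeff p (n - i) * u ^ i)"
    by (simp add: section_at_def poly_sum poly_monom)
  also have "\<dots> = (\<Sum>i\<le>n. coeff p i * u ^ (n - i))"
    by (rule sum.reindex_bij_witness[of _ "\<lambda>i. n - i" "\<lambda>i. n - i"]) auto
  also have "\<dots> = (\<Sum>i\<le>n. u ^ n * (coeff p i * (1 / u) ^ i))"
  proof (rule sum.cong)
    fix i assume "i \<in> {..n}"
    then have "u ^ n = u ^ (n - i) * u ^ i" by (simp flip: power_add)
    then show "coeff p i * u ^ (n - i) = u ^ n * (coeff p i * (1 / u) ^ i)"
      using assms(2) by (simp add: power_divide)
  qed simp
  also have "\<dots> = u ^ n * (\<Sum>i\<le>n. coeff p i * (1 / u) ^ i)" by (simp add: sum_distrib_left)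
  also have "(\<Sum>i\<le>n. coeff p i * (1 / u) ^ i) = poly p (1 / u)"
    unfolding poly_altdef using assms(1)
    by (intro sum.mono_neutral_right) (auto simp: coeff_eq_0)
  finally show ?thesis .
qed

lemma poly_eq_cofinite:
  fixes p q :: "complex poly"
  assumes "\<And>u. u \<noteq> 0 \<Longrightarrow> poly p u = poly q u"
  shows "p = q"
proof (rule ccontr)
  assume "p \<noteq> q"
  then have "finite {u. poly (p - q) u = 0}" by (intro poly_roots_finite) simp
  moreover have "UNIV - {0} \<subseteq> {u. poly (p - q) u = 0}" using assms by auto
  ultimately have "finite (UNIV - {0::complex})" using finite_subset by blast
  then show False using infinite_UNIV_char_0[where ?'a = complex] by simp
qed

lemma reflect_mult:
  assumes "degree p \<le> m" "degree q \<le> n"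
  shows "reflect (m + n) (p * q) = reflect m p * reflect n q"
proof (rule poly_eq_cofinite)
  fix u :: complex assume u: "u \<noteq> 0"
  have "degree (p * q) \<le> m + n" using degree_mult_le[of p q] assms by linarith
  then show "poly (reflect (m + n) (p * q)) u = poly (reflect m p * reflect n q) u"
    using assms u by (simp add: poly_reflect power_add)
qed

lemma reflect_add: "reflect n (p + q) = reflect n p + reflect n q"
  by (simp add: section_at_def sum.distrib flip: add_monom)

lemma section_add: "section_at n (p + q) z = section_at n p z + section_at n q z"
  by (cases z) (simp_all add: reflect_add section_at_def[of _ _ "Some _"] pcompose_add)

lemma section_mult:
  assumes "degree p \<le> m" "degree q \<le> n"
  shows "section_at (m + n) (p * q) z = section_at m p z * section_at n q z"
  by (cases z) (simp_all add: reflect_mult[OF assms] section_at_def[of _ _ "Some _"] pcompose_mult)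

lemma section_smult: "section_at n (smult c p) z = smult c (section_at n p z)"
proof (cases z)
  case None
  have "reflect n (smult c p) = smult c (reflect n p)"
    by (rule poly_eqI) (simp add: section_at_def coeff_sum sum_distrib_left coeff_monom if_distrib)
  then show ?thesis using None by simp
qed (simp add: section_at_def pcompose_smult)

subsection \<open>Curves given by monic equations\<close>

text \<open>The coefficient of \<open>x ^ i\<close> is regarded as a section of O((d - i) k), the
  weight that makes the equation homogeneous under \<open>y = x / t ^ k\<close>.\<close>

definition monic_curve :: "nat \<Rightarrow> nat \<Rightarrow> (nat \<Rightarrow> complex poly) \<Rightarrow> hirzebruch_point set" where
  "monic_curve k d c = {(z, Some x) | z x. (\<Sum>i\<le>d. poly (section_at ((d - i) * k) (c i) z) 0 * x ^ i) = 0}"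

lemma monic_curve_None [simp]: "(z, None) \<notin> monic_curve k d c"
  by (simp add: monic_curve_def)

lemma monic_curve_Some:
  "(z, Some x) \<in> monic_curve k d c \<longleftrightarrow> (\<Sum>i\<le>d. poly (section_at ((d - i) * k) (c i) z) 0 * x ^ i) = 0"
  by (simp add: monic_curve_def)

lemma monic_curve_affine: "(Some t, Some x) \<in> monic_curve k d c \<longleftrightarrow> (\<Sum>i\<le>d. poly (c i) t * x ^ i) = 0"
  by (simp add: monic_curve_Some poly_section_Some)

lemma monic_curve_infinity:
  assumes c: "\<And>i. i \<le> d \<Longrightarrow> degree (c i) \<le> (d - i) * k"
  shows "(P1_inverse s, Some (if s = 0 then y else y / s ^ k)) \<in> monic_curve k d c \<longleftrightarrow>
    (\<Sum>i\<le>d. poly (reflect ((d - i) * k) (c i)) s * y ^ i) = 0"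
proof (cases "s = 0")
  case True
  then show ?thesis by (simp add: P1_inverse_def monic_curve_Some)
next
  case False
  have "(\<Sum>i\<le>d. poly (reflect ((d - i) * k) (c i)) s * y ^ i) =
      (\<Sum>i\<le>d. s ^ (d * k) * (poly (c i) (1 / s) * (y / s ^ k) ^ i))"
  proof (rule sum.cong)
    fix i assume "i \<in> {..d}"
    then have i: "i \<le> d" by simp
    then have "d * k = (d - i) * k + k * i" by (metis add_mult_distrib le_add_diff_inverse2 mult.commute)
    then have "s ^ (d * k) = s ^ ((d - i) * k) * (s ^ k) ^ i" by (simp add: power_add power_mult)
    then show "poly (reflect ((d - i) * k) (c i)) s * y ^ i =
        s ^ (d * k) * (poly (c i) (1 / s) * (y / s ^ k) ^ i)"
      using False c[OF i] by (simp add: poly_reflect power_divide)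
  qed simp
  also have "\<dots> = s ^ (d * k) * (\<Sum>i\<le>d. poly (c i) (1 / s) * (y / s ^ k) ^ i)"
    by (simp add: sum_distrib_left)
  finally show ?thesis using False by (simp add: P1_inverse_def monic_curve_affine)
qed

lemma eval2_sum_monom: "eval2 (\<Sum>i\<le>d. monom (c i) (e i)) a b = (\<Sum>i\<le>d. poly (c i) a * b ^ e i)"
  by (simp add: eval2_def poly_sum poly_monom)

lemma sum_monom_nonzero:
  fixes c :: "nat \<Rightarrow> complex poly"
  assumes "c d = 1"
  shows "(\<Sum>i\<le>d. monom (c i) i) \<noteq> 0" "(\<Sum>i\<le>d. monom (c i) (d - i)) \<noteq> 0"
proof -
  have "coeff (\<Sum>i\<le>d. monom (c i) i) d = 1" using assms by (simp add: coeff_sum)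
  then show "(\<Sum>i\<le>d. monom (c i) i) \<noteq> 0" by auto
  have "coeff (\<Sum>i\<le>d. monom (c i) (d - i)) 0 = (\<Sum>i\<le>d. if i = d then c i else 0)"
    unfolding coeff_sum by (rule sum.cong) auto
  also have "\<dots> = 1" using assms by simp
  finally show "(\<Sum>i\<le>d. monom (c i) (d - i)) \<noteq> 0" by auto
qed

lemma reverse_sum:
  assumes "v \<noteq> (0::complex)"
  shows "(\<Sum>i\<le>d. f i * v ^ (d - i)) = 0 \<longleftrightarrow> (\<Sum>i\<le>d. f i * (1 / v) ^ i) = 0"
proof -
  have "(\<Sum>i\<le>d. f i * v ^ (d - i)) = (\<Sum>i\<le>d. v ^ d * (f i * (1 / v) ^ i))"
  proof (rule sum.cong)
    fix i assume "i \<in> {..d}"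
    then have "v ^ d = v ^ (d - i) * v ^ i" by (simp flip: power_add)
    then show "f i * v ^ (d - i) = v ^ d * (f i * (1 / v) ^ i)" using assms by (simp add: power_divide)
  qed simp
  also have "\<dots> = v ^ d * (\<Sum>i\<le>d. f i * (1 / v) ^ i)" by (simp add: sum_distrib_left)
  finally show ?thesis using assms by simp
qed

lemma sum_at_0: "(\<Sum>i\<le>d. f i * (0::complex) ^ (d - i)) = f d"
proof -
  have "(\<Sum>i\<le>d. f i * (0::complex) ^ (d - i)) = (\<Sum>i\<in>{d}. f i * 0 ^ (d - i))"
    by (rule sum.mono_neutral_right) (auto simp: power_0_left)
  then show ?thesis by simp
qed

text \<open>In the charts around the exceptional section the equation is the reversed polynomial; at
  fibre coordinate 0 it takes the value of the leading coefficient 1, so no point is added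
  there.\<close>

lemma algebraic_monic_curve:
  assumes c: "\<And>i. i \<le> d \<Longrightarrow> degree (c i) \<le> (d - i) * k" and m: "c d = 1"
  shows "algebraic_curve k (monic_curve k d c)"
proof -
  let ?C = "monic_curve k d c"
  define r where "r i = reflect ((d - i) * k) (c i)" for i
  have rd: "r d = 1" by (simp add: r_def m section_at_def)
  have 1: "(Some a, Some b) \<in> ?C \<longleftrightarrow> eval2 (\<Sum>i\<le>d. monom (c i) i) a b = 0" for a b
    by (simp add: monic_curve_affine eval2_sum_monom)
  have 2: "(Some a, P1_inverse b) \<in> ?C \<longleftrightarrow> eval2 (\<Sum>i\<le>d. monom (c i) (d - i)) a b = 0" for a b
    by (cases "b = 0") (simp_all add: P1_inverse_def eval2_sum_monom sum_at_0 m reverse_sum monic_curve_affine)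
  have 3: "(P1_inverse a, Some (if a = 0 then b else b / a ^ k)) \<in> ?C \<longleftrightarrow>
      eval2 (\<Sum>i\<le>d. monom (r i) i) a b = 0" for a b
    by (simp only: monic_curve_infinity[OF c] eval2_sum_monom r_def)
  have 4: "(P1_inverse a, P1_inverse (if a = 0 then b else b * a ^ k)) \<in> ?C \<longleftrightarrow>
      eval2 (\<Sum>i\<le>d. monom (r i) (d - i)) a b = 0" for a b
  proof (cases "b = 0")
    case True
    then show ?thesis by (simp add: P1_inverse_def eval2_sum_monom sum_at_0 rd)
  next
    case False
    then have "P1_inverse (if a = 0 then b else b * a ^ k) = Some (if a = 0 then 1 / b else (1 / b) / a ^ k)"
      by (simp add: P1_inverse_def)
    then show ?thesis
      using False 3[of a "1 / b"] by (simp only: eval2_sum_monom reverse_sum[OF False])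
  qed
  show ?thesis
    unfolding algebraic_curve_def hirzebruch_charts_def
    using 1 2 3 4 sum_monom_nonzero[of c d, OF m] sum_monom_nonzero[of r d, OF rd]
    unfolding eval2_def by (simp del: not_None_eq) blast
qed

lemma monic_curve_fibre:
  assumes "c d = 1"
  shows "card {x. (Some t, x) \<in> monic_curve k d c} \<le> d"
proof -
  define p where "p = (\<Sum>i\<le>d. monom (poly (c i) t) i)"
  have p0: "p \<noteq> 0"
  proof -
    have "coeff p d = 1" using assms by (simp add: p_def coeff_sum)
    then show ?thesis by auto
  qed
  have dp: "degree p \<le> d" unfolding p_def by (intro degree_sum_le) (auto intro: order.trans[OF degree_monom_le])
  have "{x. (Some t, x) \<in> monic_curve k d c} = Some ` {x. poly p x = 0}"
  proof (intro set_eqI)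
    fix x show "x \<in> {x. (Some t, x) \<in> monic_curve k d c} \<longleftrightarrow> x \<in> Some ` {x. poly p x = 0}"
      by (cases x) (auto simp: monic_curve_affine p_def poly_sum poly_monom)
  qed
  then have "card {x. (Some t, x) \<in> monic_curve k d c} = card {x. poly p x = 0}"
    by (simp add: card_image)
  then show ?thesis using card_poly_roots_bound[OF p0] dp by simp
qed

subsection \<open>Splitting off a root\<close>

definition section_value :: "nat \<Rightarrow> complex poly \<Rightarrow> P1 \<Rightarrow> complex" where
  "section_value n p z = poly (section_at n p z) 0"

lemma section_value_add: "section_value n (p + q) z = section_value n p z + section_value n q z"
  by (simp add: section_value_def section_add)

lemma section_value_smult: "section_value n (smult c p) z = c * section_value n p z"
  by (simp add: section_value_def section_smult)

lemma section_value_minus: "section_value n (- p) z = - section_value n p z"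
  using section_value_smult[of n "-1" p z] by simp

lemma section_value_mult:
  "degree p \<le> m \<Longrightarrow> degree q \<le> n \<Longrightarrow> section_value (m + n) (p * q) z = section_value m p z * section_value n q z"
  by (simp add: section_value_def section_mult)

lemma section_value_1: "section_value 0 1 z = 1"
  by (cases z) (simp_all add: section_value_def section_at_def poly_pcompose)

text \<open>If the degree of \<open>s\<close> exceeded \<open>k\<close>, the term
  \<open>s ^ 3\<close> would have larger degree than the other two.\<close>

lemma degree_root_bound:
  fixes s g2 g3 :: "complex poly"
  assumes "s ^ 3 + g2 * s + g3 = 0" "degree g2 \<le> 2 * k" "degree g3 \<le> 3 * k"
  shows "degree s \<le> k"
proof (rule ccontr)
  assume n: "\<not> degree s \<le> k"
  have "s ^ 3 = - (g2 * s + g3)" using assms(1) by (metis add.assoc eq_neg_iff_add_eq_0)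
  then have "degree (s ^ 3) = degree (g2 * s + g3)" by (simp only: degree_minus)
  also have "\<dots> \<le> max (degree (g2 * s)) (degree g3)" by (rule degree_add_le_max)
  also have "\<dots> < 3 * degree s"
    using degree_mult_le[of g2 s] assms(2,3) n by auto
  finally have "degree (s ^ 3) < 3 * degree s" .
  moreover have "s \<noteq> 0" using n by auto
  ultimately show False by (simp add: degree_power_eq)
qed

text \<open>A root splits off the section \<open>x = a + s\<close>; what remains meets the fibres in
  at most two points, so both parts are proper. Without a root the affine equation is irreducible,
  so one of the parts contains the affine part of \<open>B\<close>, and then all of
  \<open>B\<close>.\<close>

theorem reducible_iff_polynomial_root:
  assumes trig: "trigonal_curve k B" and we: "weierstrass_equation k B g2 g3"
  shows "reducible_curve k B \<longleftrightarrow> (\<exists>s. s ^ 3 + g2 * s + g3 = 0)"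
proof -
  have dg: "degree g2 \<le> 2 * k" "degree g3 \<le> 3 * k" using we by (auto simp: weierstrass_equation_def)
  obtain a where a: "degree a \<le> k" and B: "B = {(z, Some (b + poly (section_at k a z) 0)) | z b.
      poly (poly (weierstrass_at k g2 g3 z) [:b:]) 0 = 0}"
    using we by (auto simp: weierstrass_equation_def)
  let ?A = "section_value k a" and ?G2 = "section_value (2 * k) g2" and ?G3 = "section_value (3 * k) g3"
  have k23: "2 * k = k + k" "3 * k = k + k + k" by simp_all
  have daa: "degree (a * a) \<le> k + k" using degree_mult_le[of a a] a by linarith
  have BS: "(z, Some x) \<in> B \<longleftrightarrow> (x - ?A z) ^ 3 + ?G2 z * (x - ?A z) + ?G3 z = 0" for z x
  proof -
    have "(z, Some x) \<in> B \<longleftrightarrow> (\<exists>b. x = b + ?A z \<and> b ^ 3 + ?G2 z * b + ?G3 z = 0)"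
      unfolding B weierstrass_at_def section_value_def
      by (auto simp: algebra_simps power3_eq_cube)
    also have "\<dots> \<longleftrightarrow> (x - ?A z) ^ 3 + ?G2 z * (x - ?A z) + ?G3 z = 0"
      by (metis add_diff_cancel_right' diff_add_cancel)
    finally show ?thesis .
  qed
  have BN: "(z, None) \<notin> B" for z unfolding B by auto
  have fin: "finite {z. card {x. (z, x) \<in> B} \<noteq> 3}" using trig by (simp add: trigonal_curve_def)
  show ?thesis
  proof
    assume "\<exists>s. s ^ 3 + g2 * s + g3 = 0"
    then obtain s where s: "s ^ 3 + g2 * s + g3 = 0" by blast
    have ds: "degree s \<le> k" by (rule degree_root_bound[OF s dg])
    let ?S = "section_value k s"
    have dss: "degree (s * s) \<le> k + k" using degree_mult_le[of s s] ds by linarith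
    have das: "degree (s * a) \<le> k + k" using degree_mult_le[of s a] ds a by linarith
    have Sz: "?S z ^ 3 + ?G2 z * ?S z + ?G3 z = 0" for z
    proof -
      have "section_value (3 * k) (s * s * s + g2 * s + g3) z = 0"
        using s by (simp add: power3_eq_cube) (simp add: section_value_def section_at_def split: option.split)
      moreover have "section_value (3 * k) (s * s * s) z = ?S z ^ 3"
        unfolding k23 section_value_mult[OF dss ds] section_value_mult[OF ds ds] by (simp add: power3_eq_cube)
      moreover have "section_value (3 * k) (g2 * s) z = ?G2 z * ?S z"
        using section_value_mult[OF dg(1) ds, of z] by (simp add: k23)
      ultimately show ?thesis by (simp add: section_value_add)
    qed
    \<comment> \<open>The factors \<open>b - s\<close> and
      \<open>b\<^sup>2 + s * b + s\<^sup>2 + g2\<close> of the Weierstrass polynomial, expanded with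
      \<open>b = x - a\<close>.\<close>
    define c1 where "c1 i = (if i = 0 then - (a + s) else 1)" for i :: nat
    define c2 where "c2 i = (if i = 0 then a * a + - (s * a) + s * s + g2 else if i = 1 then s + smult (-2) a else 1)" for i :: nat
    define C1 where "C1 = monic_curve k 1 c1"
    define C2 where "C2 = monic_curve k 2 c2"
    have d1: "degree (c1 i) \<le> (1 - i) * k" if "i \<le> 1" for i
    proof -
      have "degree (- (a + s)) \<le> k" unfolding degree_minus using a ds by (intro degree_add_le)
      then show ?thesis using that by (cases "i = 0") (simp_all only: c1_def, simp_all)
    qed
    have d2: "degree (c2 i) \<le> (2 - i) * k" if "i \<le> 2" for i
    proof -
      have "degree (a * a + - (s * a) + s * s + g2) \<le> 2 * k"
        using daa das dss dg by (intro degree_add_le) auto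
      moreover have "degree (s + smult (-2) a) \<le> k" using a ds by (intro degree_add_le) auto
      ultimately show ?thesis using that by (auto simp: c2_def)
    qed
    have C1S: "(z, Some x) \<in> C1 \<longleftrightarrow> x - ?A z = ?S z" for z x
    proof -
      have "(z, Some x) \<in> C1 \<longleftrightarrow> section_value k (- (a + s)) z + section_value 0 1 z * x = 0"
        by (simp add: C1_def monic_curve_Some c1_def section_value_def)
      also have "\<dots> \<longleftrightarrow> x - ?A z = ?S z"
        unfolding section_value_minus section_value_add section_value_1 by (simp add: algebra_simps)
      finally show ?thesis .
    qed
    have C2S: "(z, Some x) \<in> C2 \<longleftrightarrow> (x - ?A z)\<^sup>2 + ?S z * (x - ?A z) + (?S z)\<^sup>2 + ?G2 z = 0" for z x
    proof -
      have "(z, Some x) \<in> C2 \<longleftrightarrow> section_value (2 * k) (a * a + - (s * a) + s * s + g2) z +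
          section_value k (s + smult (-2) a) z * x + section_value 0 1 z * x\<^sup>2 = 0"
        by (simp add: C2_def monic_curve_Some c2_def section_value_def numeral_2_eq_2)
      also have "section_value (2 * k) (a * a + - (s * a) + s * s + g2) z =
          ?A z * ?A z - ?S z * ?A z + ?S z * ?S z + ?G2 z"
        unfolding section_value_add section_value_minus
        using section_value_mult[OF a a, of z] section_value_mult[OF ds a, of z] section_value_mult[OF ds ds, of z]
        by (simp add: k23(1))
      also have "section_value k (s + smult (-2) a) z = ?S z - 2 * ?A z"
        unfolding section_value_add section_value_smult by simp
      finally show ?thesis
        unfolding section_value_1 by (simp add: algebra_simps power2_eq_square)
    qed
    have "p \<in> B \<longleftrightarrow> p \<in> C1 \<union> C2" for p
    proof (cases p)
      case (Pair z y)
      show ?thesis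
      proof (cases y)
        case None
        then show ?thesis using BN Pair by (simp add: C1_def C2_def)
      next
        case (Some x)
        let ?b = "x - ?A z"
        have "?b ^ 3 + ?G2 z * ?b + ?G3 z =
            (?b - ?S z) * (?b\<^sup>2 + ?S z * ?b + (?S z)\<^sup>2 + ?G2 z) + (?S z ^ 3 + ?G2 z * ?S z + ?G3 z)"
          by (simp add: algebra_simps power2_eq_square power3_eq_cube)
        then have "?b ^ 3 + ?G2 z * ?b + ?G3 z = (?b - ?S z) * (?b\<^sup>2 + ?S z * ?b + (?S z)\<^sup>2 + ?G2 z)"
          using Sz by simp
        then have "(z, Some x) \<in> B \<longleftrightarrow> ?b - ?S z = 0 \<or> ?b\<^sup>2 + ?S z * ?b + (?S z)\<^sup>2 + ?G2 z = 0"
          unfolding BS by (metis mult_eq_0_iff)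
        then show ?thesis using C1S C2S Pair Some by simp
      qed
    qed
    then have un: "B = C1 \<union> C2" by blast
    \<comment> \<open>A finite point whose fibre in \<open>B\<close> has exactly three points; at
      most one of them lies on \<open>C1\<close> and at most two on \<open>C2\<close>.\<close>
    have "finite {t. card {x. (Some t, x) \<in> B} \<noteq> 3}"
      using finite_vimageI[OF fin, of Some] by (simp add: vimage_def)
    then have "{t. card {x. (Some t, x) \<in> B} \<noteq> 3} \<noteq> UNIV"
      using infinite_UNIV_char_0[where ?'a = complex] by metis
    then obtain t where t: "card {x. (Some t, x) \<in> B} = 3" by blast
    have "card {x. (Some t, x) \<in> C1} \<le> 1" "card {x. (Some t, x) \<in> C2} \<le> 2"
      unfolding C1_def C2_def by (rule monic_curve_fibre; simp add: c1_def c2_def)+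
    then have "C1 \<noteq> B" "C2 \<noteq> B" using t by auto
    moreover have "algebraic_curve k C1" "algebraic_curve k C2"
      unfolding C1_def C2_def using d1 d2
      by (auto intro!: algebraic_monic_curve simp: c1_def c2_def)
    ultimately show "reducible_curve k B" using un unfolding reducible_curve_def by blast
  next
    assume "reducible_curve k B"
    then obtain C1 C2 where C: "algebraic_curve k C1" "algebraic_curve k C2" "B = C1 \<union> C2" "C1 \<noteq> B" "C2 \<noteq> B"
      unfolding reducible_curve_def by blast
    show "\<exists>s. s ^ 3 + g2 * s + g3 = 0"
    proof (rule ccontr)
      assume no: "\<nexists>s. s ^ 3 + g2 * s + g3 = 0"
      \<comment> \<open>Expansion of \<open>(x - a) ^ 3 + g2 * (x - a) + g3\<close> in powers of
        \<open>x\<close>.\<close>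
      define c where "c i = (if i = 0 then - (a * a * a) + - (g2 * a) + g3 else if i = 1 then smult 3 (a * a) + g2
          else if i = 2 then smult (-3) a else 1)" for i :: nat
      have daaa: "degree (a * a * a) \<le> k + k + k" using degree_mult_le[of "a * a" a] daa a by linarith
      have dga: "degree (g2 * a) \<le> 2 * k + k" using degree_mult_le[of g2 a] dg a by linarith
      have dc: "degree (c i) \<le> (3 - i) * k" if "i \<le> 3" for i
      proof -
        have "degree (- (a * a * a) + - (g2 * a) + g3) \<le> 3 * k"
          using daaa dga dg by (intro degree_add_le) auto
        moreover have "degree (smult 3 (a * a) + g2) \<le> 2 * k" using daa dg by (intro degree_add_le) auto
        ultimately show ?thesis using that a by (auto simp: c_def)
      qed
      have c3: "c 3 = 1" by (simp add: c_def)
      have sum3: "(\<Sum>i\<le>3. f i) = f 0 + f 1 + f 2 + f 3" for f :: "nat \<Rightarrow> 'c :: comm_monoid_add"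
        by (simp add: eval_nat_numeral add.assoc)
      have BC: "p \<in> B \<longleftrightarrow> p \<in> monic_curve k 3 c" for p
      proof (cases p)
        case (Pair z y)
        show ?thesis
        proof (cases y)
          case None
          then show ?thesis using BN Pair by simp
        next
          case (Some x)
          have "(z, Some x) \<in> monic_curve k 3 c \<longleftrightarrow>
              section_value (3 * k) (- (a * a * a) + - (g2 * a) + g3) z + section_value (2 * k) (smult 3 (a * a) + g2) z * x +
              section_value k (smult (-3) a) z * x\<^sup>2 + section_value 0 1 z * x ^ 3 = 0"
            by (simp add: monic_curve_Some sum3 section_value_def c_def)
          also have "section_value (3 * k) (- (a * a * a) + - (g2 * a) + g3) z = - (?A z ^ 3) - ?G2 z * ?A z + ?G3 z"
            unfolding section_value_add section_value_minus
            using section_value_mult[OF daa a, of z] section_value_mult[OF a a, of z] section_value_mult[OF dg(1) a, of z]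
            by (simp add: k23 power3_eq_cube)
          also have "section_value (2 * k) (smult 3 (a * a) + g2) z = 3 * (?A z * ?A z) + ?G2 z"
            unfolding section_value_add section_value_smult
            using section_value_mult[OF a a, of z] by (simp add: k23(1))
          also have "section_value k (smult (-3) a) z = - 3 * ?A z" by (simp only: section_value_smult)
          finally have "(z, Some x) \<in> monic_curve k 3 c \<longleftrightarrow> (z, Some x) \<in> B"
            unfolding section_value_1 BS by (simp add: algebra_simps power2_eq_square power3_eq_cube)
          then show ?thesis using Pair Some by simp
        qed
      qed
      define V where "V = (\<Sum>i\<le>3. monom (c i) i)"
      define r where "r i = reflect ((3 - i) * k) (c i)" for i
      define W where "W = (\<Sum>i\<le>3. monom (r i) i)"
      have r3: "r 3 = 1" by (simp add: r_def c3 section_at_def)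
      have BV: "(Some t, Some x) \<in> B \<longleftrightarrow> eval2 V t x = 0" for t x
        by (simp add: BC monic_curve_affine V_def eval2_sum_monom)
      have BW: "(P1_inverse s, Some (if s = 0 then y else y / s ^ k)) \<in> B \<longleftrightarrow> eval2 W s y = 0" for s y
        by (simp only: BC monic_curve_infinity[OF dc] W_def eval2_sum_monom r_def)
      have monic: "lead_coeff (\<Sum>i\<le>3. monom (h i) i) = 1 \<and> degree (\<Sum>i\<le>3. monom (h i) i) = 3"
        if "h 3 = 1" for h :: "nat \<Rightarrow> complex poly"
      proof -
        let ?p = "\<Sum>i\<le>3. monom (h i) i"
        have c: "coeff ?p 3 = 1" using that by (simp add: coeff_sum)
        have "degree ?p \<le> 3" by (intro degree_sum_le) (auto intro: order.trans[OF degree_monom_le])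
        moreover have "3 \<le> degree ?p" using c by (intro le_degree) simp
        ultimately show ?thesis using c by simp
      qed
      note mV = monic[of c, OF c3, folded V_def] and mW = monic[of r, OF r3, folded W_def]
      have "poly V s \<noteq> 0" for s
      proof
        assume "poly V s = 0"
        moreover have "smult 3 p = 3 * p" for p :: "complex poly" by (simp add: numeral_poly)
        ultimately have "(s - a) ^ 3 + g2 * (s - a) + g3 = 0"
          by (simp add: V_def sum3 c_def poly_monom algebra_simps power2_eq_square power3_eq_cube)
        then show False using no by blast
      qed
      then have irr: "irreducible V" using irreducible_cubic mV by blast
      define T where "T = {t. card {b. eval2 V t b = 0} = 3}"
      have cardV: "card {b. eval2 V t b = 0} = card {x. (Some t, x) \<in> B}" for t
      proof -
        have "{x. (Some t, x) \<in> B} = Some ` {b. eval2 V t b = 0}"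
        proof (intro set_eqI)
          fix x show "x \<in> {x. (Some t, x) \<in> B} \<longleftrightarrow> x \<in> Some ` {b. eval2 V t b = 0}"
            by (cases x) (auto simp: BN BV)
        qed
        then show ?thesis by (simp add: card_image)
      qed
      have fT: "finite (- T)"
        using finite_vimageI[OF fin, of Some] by (simp add: vimage_def T_def cardV Collect_neg_eq)
      have iT: "infinite T"
        using fT infinite_UNIV_char_0[where ?'a = complex] by (metis Compl_partition finite_UnI)
      \<comment> \<open>For nonzero \<open>s\<close> the fibre of \<open>W\<close> is a rescaled
        fibre of \<open>B\<close> over \<open>1 / s\<close>, so three points are generic in this
        chart as well.\<close>
      define T' where "T' = {s. s \<noteq> 0 \<and> card {b. eval2 W s b = 0} = 3}"
      have cardW: "card {b. eval2 W s b = 0} = card {x. (Some (1 / s), x) \<in> B}" if s: "s \<noteq> 0" for s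
      proof -
        have sub: "{x. (Some (1 / s), x) \<in> B} = (\<lambda>y. Some (y / s ^ k)) ` {b. eval2 W s b = 0}"
        proof (intro set_eqI iffI)
          fix x assume x: "x \<in> {x. (Some (1 / s), x) \<in> B}"
          then obtain x' where x': "x = Some x'" using BN by (cases x) auto
          have "eval2 W s (x' * s ^ k) = 0" using BW[of s "x' * s ^ k"] x x' s by (simp add: P1_inverse_def)
          then show "x \<in> (\<lambda>y. Some (y / s ^ k)) ` {b. eval2 W s b = 0}"
            using s x' by (intro image_eqI[of _ _ "x' * s ^ k"]) auto
        next
          fix x assume "x \<in> (\<lambda>y. Some (y / s ^ k)) ` {b. eval2 W s b = 0}"
          then show "x \<in> {x. (Some (1 / s), x) \<in> B}" using BW[of s] s by (auto simp: P1_inverse_def)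
        qed
        have "inj_on (\<lambda>y. Some (y / s ^ k)) {b. eval2 W s b = 0}" using s by (auto simp: inj_on_def)
        then show ?thesis unfolding sub by (simp add: card_image)
      qed
      have iT': "infinite T'"
      proof
        assume "finite T'"
        have "inj (\<lambda>s::complex. Some (1 / s))" by (auto simp: inj_on_def)
        from finite_vimageI[OF fin this] have "finite {s. card {x. (Some (1 / s), x) \<in> B} \<noteq> 3}"
          by (simp add: vimage_def)
        moreover have "UNIV \<subseteq> insert 0 (T' \<union> {s. card {x. (Some (1 / s), x) \<in> B} \<noteq> 3})"
          using cardW by (auto simp: T'_def)
        ultimately show False
          using \<open>finite T'\<close> infinite_UNIV_char_0[where ?'a = complex] by (metis finite_UnI finite_insert finite_subset)
      qed
      \<comment> \<open>A part containing every finite point of \<open>B\<close> satisfies its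
        equation near infinity on the generic fibres, hence also over infinity.\<close>
      have full: "D = B"
        if D: "algebraic_curve k D" "D \<subseteq> B" and aff: "\<And>t x. (Some t, Some x) \<in> B \<Longrightarrow> (Some t, Some x) \<in> D" for D
      proof
        have "(\<lambda>(s, y). (P1_inverse s, Some (if s = 0 then y else y / s ^ k))) \<in> hirzebruch_charts k"
          by (simp add: hirzebruch_charts_def)
        with D(1) obtain G where "G \<noteq> 0" "\<forall>a b. (\<lambda>(s, y). (P1_inverse s, Some (if s = 0 then y else y / s ^ k))) (a, b) \<in> D
            \<longleftrightarrow> poly (poly G [:b:]) a = 0"
          unfolding algebraic_curve_def by blast
        then have G: "(P1_inverse s, Some (if s = 0 then y else y / s ^ k)) \<in> D \<longleftrightarrow> eval2 G s y = 0" for s y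
          by (simp add: eval2_def)
        have gen: "eval2 G s y = 0" if "s \<in> T'" "eval2 W s y = 0" for s y
        proof -
          have s: "s \<noteq> 0" using that by (simp add: T'_def)
          then have "(Some (1 / s), Some (y / s ^ k)) \<in> B" using BW[of s y] that by (simp add: P1_inverse_def)
          from aff[OF this] show ?thesis using G[of s y] s by (simp add: P1_inverse_def)
        qed
        have WG: "eval2 G s y = 0" if "eval2 W s y = 0" for s y
          by (rule contained_on_generic_fibres[OF _ _ iT' _ gen that]) (use mW in \<open>auto simp: T'_def\<close>)
        show "B \<subseteq> D"
        proof
          fix p assume p: "p \<in> B"
          obtain z x where zx: "p = (z, Some x)" using p BN by (cases p; cases "snd p") auto
          show "p \<in> D"
          proof (cases z)
            case None
            have "(P1_inverse 0, Some (if (0::complex) = 0 then x else x / 0 ^ k)) \<in> B"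
              using p zx None by (simp add: P1_inverse_def)
            then have "eval2 G 0 x = 0" using BW WG by blast
            then show ?thesis using G[of 0 x] zx None by (simp add: P1_inverse_def)
          next
            case (Some t)
            then show ?thesis using aff p zx by simp
          qed
        qed
        show "D \<subseteq> B" by (rule D(2))
      qed
      have ch1: "\<exists>F. \<forall>t x. (Some t, Some x) \<in> D \<longleftrightarrow> eval2 F t x = 0" if "algebraic_curve k D" for D
      proof -
        have "(\<lambda>(t, x). (Some t, Some x)) \<in> hirzebruch_charts k" by (simp add: hirzebruch_charts_def)
        with that obtain F where "\<forall>a b. (\<lambda>(t, x). (Some t, Some x)) (a, b) \<in> D \<longleftrightarrow> poly (poly F [:b:]) a = 0"
          unfolding algebraic_curve_def by blast
        then show ?thesis by (auto simp: eval2_def)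
      qed
      obtain F1 where F1: "\<And>t x. (Some t, Some x) \<in> C1 \<longleftrightarrow> eval2 F1 t x = 0" using ch1[OF C(1)] by blast
      obtain F2 where F2: "\<And>t x. (Some t, Some x) \<in> C2 \<longleftrightarrow> eval2 F2 t x = 0" using ch1[OF C(2)] by blast
      have "(\<forall>t b. eval2 V t b = 0 \<longrightarrow> eval2 F1 t b = 0) \<or> (\<forall>t b. eval2 V t b = 0 \<longrightarrow> eval2 F2 t b = 0)"
      proof (rule irreducible_cubic_component[OF _ _ irr iT])
        fix t b assume "eval2 V t b = 0"
        then have "(Some t, Some b) \<in> C1 \<union> C2" using BV C(3) by blast
        then show "eval2 F1 t b = 0 \<or> eval2 F2 t b = 0" using F1 F2 by blast
      qed (use mV in \<open>auto simp: T_def\<close>)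
      then show False
      proof
        assume "\<forall>t b. eval2 V t b = 0 \<longrightarrow> eval2 F1 t b = 0"
        then show False using full[OF C(1)] C(3,4) BV F1 by blast
      next
        assume "\<forall>t b. eval2 V t b = 0 \<longrightarrow> eval2 F2 t b = 0"
        then show False using full[OF C(2)] C(3,5) BV F2 by blast
      qed
    qed
  qed
qed

section \<open>Rational functions on the projective line\<close>

lemma continuous_from_P1:
  assumes "\<And>z U. openin P1_top U \<Longrightarrow> f z \<in> U \<Longrightarrow> \<exists>\<epsilon>>0. \<forall>u\<in>ball 0 \<epsilon>. f (P1_chart z u) \<in> U"
  shows "continuous_map P1_top P1_top f"
  unfolding continuous_map_def
proof (intro conjI allI impI)
  fix U assume U: "openin P1_top U"
  show "openin P1_top {x \<in> topspace P1_top. f x \<in> U}"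
  proof (subst openin_subopen, intro ballI)
    fix z assume "z \<in> {x \<in> topspace P1_top. f x \<in> U}"
    then obtain \<epsilon> where e: "\<epsilon> > 0" "\<forall>u\<in>ball 0 \<epsilon>. f (P1_chart z u) \<in> U" using assms[OF U] by auto
    show "\<exists>T. openin P1_top T \<and> z \<in> T \<and> T \<subseteq> {x \<in> topspace P1_top. f x \<in> U}"
    proof (intro exI conjI)
      show "openin P1_top (P1_chart z ` ball 0 \<epsilon>)" by (rule openin_P1_chart_image) simp
      show "z \<in> P1_chart z ` ball 0 \<epsilon>" by (rule image_eqI[of _ _ 0]) (use e in auto)
      show "P1_chart z ` ball 0 \<epsilon> \<subseteq> {x \<in> topspace P1_top. f x \<in> U}" using e by auto
    qed
  qed
qed simp

lemma tendsto_imp_not_pole: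
  fixes f :: "complex \<Rightarrow> complex"
  assumes "(f \<longlongrightarrow> c) (at z)"
  shows "\<not> is_pole f z"
  using not_tendsto_and_filterlim_at_infinity[OF at_neq_bot assms] by (auto simp: is_pole_def)

lemma section_nonzero:
  assumes "degree p \<le> n" "p \<noteq> 0"
  shows "section_at n p z \<noteq> 0"
proof
  assume z: "section_at n p z = 0"
  show False
  proof (cases z)
    case None
    have "poly p u = poly 0 u" if "u \<noteq> 0" for u
      using poly_reflect[of p n "1 / u"] assms(1) z None that by simp
    then have "p = 0" by (rule poly_eq_cofinite)
    then show False using assms(2) by simp
  next
    case (Some a)
    have "poly p u = poly 0 u" for u
      using poly_section_Some[of n p a "u - a"] z Some by simp
    then have "p = 0" by (intro poly_eq_cofinite) simp
    then show False using assms(2) by simp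
  qed
qed

text \<open>A quotient of two sections of the same O(n) that may have common zeros, with values and
  ramification defined by limits as for the j-invariant.\<close>

locale P1_rational =
  fixes n :: nat and N D :: "complex poly" and f :: "P1 \<Rightarrow> complex \<Rightarrow> complex" and j :: "P1 \<Rightarrow> P1"
    and ram :: "P1 \<Rightarrow> int"
  assumes deg: "degree N \<le> n" "degree D \<le> n"
    and D0: "D \<noteq> 0"
    and f: "\<And>z u. f z u = poly (section_at n N z) u / poly (section_at n D z) u"
    and j: "\<And>z. j z = (if is_pole (f z) 0 then None else Some (Lim (at 0) (f z)))"
    and ram: "\<And>z. ram z = (if is_pole (f z) 0 then - zorder (f z) 0 else zorder (\<lambda>u. f z u - Lim (at 0) (f z)) 0)"
    and nonconst: "\<exists>z w. j z \<noteq> j w"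
begin

lemma j_Some:
  assumes "poly D t \<noteq> 0"
  shows "j (Some t) = Some (poly N t / poly D t)"
proof -
  have "(f (Some t) \<longlongrightarrow> poly N (t + 0) / poly D (t + 0)) (at 0)"
    unfolding f poly_section_Some using assms by (intro tendsto_intros) auto
  then have l: "(f (Some t) \<longlongrightarrow> poly N t / poly D t) (at 0)" by simp
  then have "\<not> is_pole (f (Some t)) 0"
    by (rule tendsto_imp_not_pole)
  moreover have "Lim (at 0) (f (Some t)) = poly N t / poly D t" using l by (intro tendsto_Lim) auto
  ultimately show ?thesis by (simp add: j)
qed

lemma j_near:
  assumes "u \<noteq> 0" "poly (section_at n D z) u \<noteq> 0"
  shows "j (P1_chart z u) = Some (f z u)"
proof (cases z)
  case None
  have "poly D (1 / u) \<noteq> 0" using assms poly_reflect[OF deg(2) assms(1)] None by auto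
  from j_Some[OF this] show ?thesis
    using assms(1) by (simp add: None f poly_reflect[OF deg(1)] poly_reflect[OF deg(2)] P1_chart_None shifted_inverse_def)
next
  case (Some a)
  have "poly D (a + u) \<noteq> 0" using assms Some by (simp add: poly_section_Some)
  from j_Some[OF this] show ?thesis by (simp add: Some f poly_section_Some P1_chart_Some)
qed

text \<open>Dividing the local expressions by their greatest common divisor leaves no common zero at
  the centre, and changes the fraction at no point where the denominator is nonzero.\<close>

lemma reduced_form:
  obtains p q where "\<not> (poly p 0 = 0 \<and> poly q 0 = 0)" "q \<noteq> 0"
    "eventually (\<lambda>u. poly q u \<noteq> 0 \<and> f z u = poly p u / poly q u \<and> j (P1_chart z u) = Some (poly p u / poly q u)) (at 0)"
proof -
  let ?A = "section_at n N z" and ?B = "section_at n D z"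
  have B: "?B \<noteq> 0" by (rule section_nonzero[OF deg(2) D0])
  then have g0: "gcd ?A ?B \<noteq> 0" by simp
  obtain p q where pq: "?A = p * gcd ?A ?B" "?B = q * gcd ?A ?B" "coprime p q"
    using gcd_coprime_exists[OF g0] by blast
  show ?thesis
  proof (rule that)
    show "\<not> (poly p 0 = 0 \<and> poly q 0 = 0)"
    proof
      assume "poly p 0 = 0 \<and> poly q 0 = 0"
      then have "[:0, 1:] dvd p" "[:0, 1:] dvd q" by (simp_all add: poly_eq_0_iff_dvd)
      with pq(3) have "is_unit [:0, 1::complex:]" by (rule coprime_common_divisor)
      then show False by (simp add: is_unit_poly_iff)
    qed
    show "q \<noteq> 0" using pq(2) B by auto
    have "finite {u. poly ?B u = 0}" by (rule poly_roots_finite[OF B])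
    then have "eventually (\<lambda>u. u \<notin> {u. poly ?B u = 0}) (at 0)" by (rule eventually_at_notin_finite)
    moreover have "eventually (\<lambda>u::complex. u \<noteq> 0) (at 0)" by (simp add: eventually_at_filter)
    ultimately show "eventually (\<lambda>u. poly q u \<noteq> 0 \<and> f z u = poly p u / poly q u \<and>
        j (P1_chart z u) = Some (poly p u / poly q u)) (at 0)"
    proof eventually_elim
      case (elim u)
      then have nz: "poly ?B u \<noteq> 0" by simp
      have e: "poly ?A u = poly p u * poly (gcd ?A ?B) u" "poly ?B u = poly q u * poly (gcd ?A ?B) u"
        using arg_cong[OF pq(1), of "\<lambda>p. poly p u"] arg_cong[OF pq(2), of "\<lambda>p. poly p u"] by simp_all
      then have "poly q u \<noteq> 0" "poly (gcd ?A ?B) u \<noteq> 0" using nz by auto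
      then have "f z u = poly p u / poly q u" unfolding f e by simp
      then show ?case using j_near[OF elim(2) nz] \<open>poly q u \<noteq> 0\<close> by simp
    qed
  qed
qed

lemma local_cases:
  obtains (finite) F r where "r > 0" "F holomorphic_on ball 0 r" "j z = Some (F 0)"
      "\<And>u. u \<in> ball 0 r \<Longrightarrow> j (P1_chart z u) = Some (F u)"
      "ram z = zorder (\<lambda>u. F u - F 0) 0"
  | (pole) F where "j z = None" "filterlim F at_infinity (at 0)"
      "eventually (\<lambda>u. j (P1_chart z u) = Some (F u)) (at 0)"
proof -
  obtain p q where pq: "\<not> (poly p 0 = 0 \<and> poly q 0 = 0)" "q \<noteq> 0"
    "eventually (\<lambda>u. poly q u \<noteq> 0 \<and> f z u = poly p u / poly q u \<and> j (P1_chart z u) = Some (poly p u / poly q u)) (at 0)"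
    by (rule reduced_form)
  let ?F = "\<lambda>u. poly p u / poly q u"
  have ev: "eventually (\<lambda>u. f z u = ?F u) (at 0)" using pq(3) by eventually_elim simp
  show ?thesis
  proof (cases "poly q 0 = 0")
    case False
    have "(?F \<longlongrightarrow> ?F 0) (at 0)" using False by (intro tendsto_intros) auto
    then have lim: "(f z \<longlongrightarrow> ?F 0) (at 0)" using tendsto_cong[OF ev] by simp
    then have np: "\<not> is_pole (f z) 0" by (rule tendsto_imp_not_pole)
    have L: "Lim (at 0) (f z) = ?F 0" using lim by (intro tendsto_Lim) auto
    obtain r1 where r1: "r1 > 0" "\<And>u. u \<noteq> 0 \<Longrightarrow> dist u 0 < r1 \<Longrightarrow> poly q u \<noteq> 0 \<and> j (P1_chart z u) = Some (?F u)"
      using pq(3) unfolding eventually_at by auto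
    have jz: "j z = Some (?F 0)" using np L by (simp add: j)
    have q0: "poly q u \<noteq> 0" if "u \<in> ball 0 r1" for u using r1(2)[of u] that False by (cases "u = 0") auto
    show ?thesis
    proof (rule finite[of r1 ?F])
      show "?F holomorphic_on ball 0 r1" using q0 by (intro holomorphic_intros) auto
      show "j (P1_chart z u) = Some (?F u)" if "u \<in> ball 0 r1" for u
        using r1(2)[of u] that jz by (cases "u = 0") auto
      have "eventually (\<lambda>u. f z u - Lim (at 0) (f z) = ?F u - ?F 0) (at 0)"
        using ev by eventually_elim (simp add: L)
      then show "ram z = zorder (\<lambda>u. ?F u - ?F 0) 0"
        using np by (simp add: ram zorder_cong)
    qed (use r1 jz in auto)
  next
    case True
    then have p0: "poly p 0 \<noteq> 0" using pq(1) by simp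
    have ev0: "eventually (\<lambda>u. poly q u \<noteq> 0) (at 0)" using pq(3) by eventually_elim simp
    have "(poly q \<longlongrightarrow> 0) (at 0)"
      using poly_isCont[of 0 q] True by (simp add: isCont_def)
    then have "filterlim (poly q) (at 0) (at 0)" using ev0 by (simp add: filterlim_at)
    moreover have "(poly p \<longlongrightarrow> poly p 0) (at 0)" using poly_isCont[of 0 p] by (simp add: isCont_def)
    ultimately have F: "filterlim ?F at_infinity (at 0)"
      using p0 by (intro filterlim_divide_at_infinity) auto
    then have "filterlim (f z) at_infinity (at 0)" using filterlim_cong[OF refl refl ev] by simp
    then have "is_pole (f z) 0" by (simp add: is_pole_def)
    then have "j z = None" by (simp add: j)
    moreover have "eventually (\<lambda>u. j (P1_chart z u) = Some (?F u)) (at 0)" using pq(3) by eventually_elim simp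
    ultimately show ?thesis using pole F by blast
  qed
qed

lemma continuous_j: "continuous_map P1_top P1_top j"
proof (rule continuous_from_P1)
  fix z U assume U: "openin P1_top U" "j z \<in> U"
  show "\<exists>\<epsilon>>0. \<forall>u\<in>ball 0 \<epsilon>. j (P1_chart z u) \<in> U"
  proof (cases rule: local_cases[of z])
    case (finite F r)
    have op: "open {t. Some t \<in> U}" using U by (simp add: openin_P1)
    have "continuous_on (ball 0 r) F" by (rule holomorphic_on_imp_continuous_on[OF finite(2)])
    then have "open (F -` {t. Some t \<in> U} \<inter> ball 0 r)"
      using iffD1[OF continuous_on_open_vimage[OF open_ball]] op by blast
    moreover have "0 \<in> F -` {t. Some t \<in> U} \<inter> ball 0 r" using finite U by simp
    ultimately obtain \<epsilon> where e: "\<epsilon> > 0" "ball 0 \<epsilon> \<subseteq> F -` {t. Some t \<in> U} \<inter> ball 0 r"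
      using open_contains_ball by blast
    show ?thesis
    proof (intro exI conjI ballI)
      fix u assume "u \<in> ball (0::complex) \<epsilon>"
      then have "u \<in> F -` {t. Some t \<in> U} \<inter> ball 0 r" using e(2) by blast
      then show "j (P1_chart z u) \<in> U" using finite(4)[of u] by simp
    qed (rule e(1))
  next
    case (pole F)
    obtain R where R: "\<And>t. norm t > R \<Longrightarrow> Some t \<in> U" using U pole(1) by (auto simp: openin_P1)
    have "eventually (\<lambda>u. norm (F u) \<ge> R + 1) (at 0)"
      using pole(2) by (simp add: filterlim_at_infinity_conv_norm_at_top filterlim_at_top)
    with pole(3) have "eventually (\<lambda>u. j (P1_chart z u) \<in> U) (at 0)"
    proof eventually_elim
      case (elim u)
      then show ?case using R[of "F u"] by simp
    qed
    then obtain \<epsilon> where "\<epsilon> > 0" "\<And>u. u \<noteq> 0 \<Longrightarrow> dist u 0 < \<epsilon> \<Longrightarrow> j (P1_chart z u) \<in> U"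
      unfolding eventually_at by auto
    then show ?thesis using U(2) by (intro exI[of _ \<epsilon>]) (metis P1_chart_0 dist_commute mem_ball)
  qed
qed

text \<open>As a limit, \<open>j\<close> would be constant even at common zeros. The values 0 and 1
  of \<open>v\<close> later show that neither \<open>g2\<close> nor \<open>g3\<close> is
  zero.\<close>

lemma not_constant_fraction: "N \<noteq> smult v D"
proof
  assume NvD: "N = smult v D"
  have "j z = Some v" for z
  proof -
    have "eventually (\<lambda>u. u \<notin> {u. poly (section_at n D z) u = 0}) (at 0)"
      by (intro eventually_at_notin_finite poly_roots_finite section_nonzero deg D0)
    then have ev: "eventually (\<lambda>u. f z u = v) (at 0)"
      by eventually_elim (simp add: f NvD section_smult)
    then have l: "(f z \<longlongrightarrow> v) (at 0)" by (rule tendsto_eventually)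
    then have "\<not> is_pole (f z) 0" by (rule tendsto_imp_not_pole)
    moreover have "Lim (at 0) (f z) = v" using l by (intro tendsto_Lim) auto
    ultimately show ?thesis by (simp add: j)
  qed
  then show False using nonconst by auto
qed

lemma finite_fibre: "finite {z. j z = Some v}"
proof -
  have "N - smult v D \<noteq> 0" using not_constant_fraction by simp
  then have fin: "finite {t. poly (N - smult v D) t = 0}" "finite {t. poly D t = 0}"
    using poly_roots_finite D0 by blast+
  have "{z. j z = Some v} \<subseteq> insert None (Some ` ({t. poly (N - smult v D) t = 0} \<union> {t. poly D t = 0}))"
  proof
    fix z assume z: "z \<in> {z. j z = Some v}"
    show "z \<in> insert None (Some ` ({t. poly (N - smult v D) t = 0} \<union> {t. poly D t = 0}))"
    proof (cases z)
      case (Some t)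
      then show ?thesis using j_Some[of t] z by (cases "poly D t = 0") (auto simp: field_simps)
    qed simp
  qed
  then show ?thesis using fin finite_subset by blast
qed

text \<open>In the factorization \<open>F u - v = u ^ m * g u\<close> with
  \<open>g 0 \<noteq> 0\<close>, an \<open>m\<close>-th root \<open>h\<close> of \<open>g\<close>
  gives the coordinate \<open>u * h u\<close>, whose \<open>m\<close>-th power is
  \<open>F u - v\<close>; \<open>\<eta>\<close> is its local inverse.\<close>

lemma param_exists:
  assumes jz: "j z = Some v"
  shows "ram z \<ge> 1" "\<exists>\<rho> \<eta>. local_param j z v (nat (ram z)) \<rho> \<eta>"
proof -
  obtain F r where F: "r > 0" "F holomorphic_on ball 0 r" "j z = Some (F 0)"
      "\<And>u. u \<in> ball 0 r \<Longrightarrow> j (P1_chart z u) = Some (F u)" "ram z = zorder (\<lambda>u. F u - F 0) 0"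
    by (cases rule: local_cases[of z]) (use jz in auto)
  have v: "v = F 0" using F(3) jz by simp
  let ?G = "\<lambda>u. F u - v"
  have nc: "\<not> ?G constant_on ball 0 r"
  proof
    assume "?G constant_on ball 0 r"
    then have "F u = F 0" if "u \<in> ball 0 r" for u
      using that F(1) unfolding constant_on_def by (metis centre_in_ball eq_iff_diff_eq_0 v)
    then have "P1_chart z ` ball 0 r \<subseteq> {z. j z = Some v}" using F(4) v by auto
    then have "finite (P1_chart z ` ball 0 r)" using finite_fibre finite_subset by blast
    then have "finite (ball (0::complex) r)"
      by (rule finite_imageD) (rule inj_on_subset[OF inj_P1_chart], simp)
    then show False using F(1) finite_imp_not_open[of "ball (0::complex) r"] by auto
  qed
  have hG: "?G holomorphic_on ball 0 r" using F(2) by (intro holomorphic_intros)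
  have zb: "0 \<in> ball (0::complex) r" and z0: "F 0 - v = 0" using F(1) v by simp_all
  obtain g r1 m where g: "0 < m" "0 < r1" "ball 0 r1 \<subseteq> ball (0::complex) r" "g holomorphic_on ball 0 r1"
    "\<And>w. w \<in> ball 0 r1 \<Longrightarrow> F w - v = (w - 0) ^ m * g w" "\<And>w. w \<in> ball 0 r1 \<Longrightarrow> g w \<noteq> 0"
    by (rule holomorphic_factor_zero_nonconstant[OF hG open_ball connected_ball zb z0 nc]) (rule that)
  have rm: "ram z = int m"
    unfolding F(5)
  proof (rule zorder_eqI[of "ball 0 r1" 0 g])
    fix w assume "w \<in> ball 0 r1" "w \<noteq> (0::complex)"
    then show "F w - F 0 = g w * (w - 0) powi int m" using g(5)[of w] v by simp
  qed (use g in auto)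
  then show "ram z \<ge> 1" using g(1) by simp
  \<comment> \<open>Normalized by \<open>g 0\<close>, the function is 1 at the centre and stays off
    the cut of the root nearby; \<open>c\<close> restores the constant.\<close>
  obtain c where c: "g 0 = c ^ m" using exists_complex_root[of m "g 0"] g(1) by auto
  have "continuous_on (ball 0 r1) (\<lambda>u. g u / g 0)"
    using g(2,4,6) by (intro continuous_intros holomorphic_on_imp_continuous_on) auto
  then have "open ((\<lambda>u. g u / g 0) -` (- \<real>\<^sub>\<le>\<^sub>0) \<inter> ball 0 r1)"
    by (simp add: continuous_on_open_vimage open_Compl)
  moreover have "0 \<in> (\<lambda>u. g u / g 0) -` (- \<real>\<^sub>\<le>\<^sub>0) \<inter> ball 0 r1" using g(2,6) by auto
  ultimately obtain r2 where r2: "r2 > 0" "ball 0 r2 \<subseteq> (\<lambda>u. g u / g 0) -` (- \<real>\<^sub>\<le>\<^sub>0) \<inter> ball 0 r1"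
    using open_contains_ball by blast
  define h where "h u = c * nrt m (g u / g 0)" for u
  have hh: "h holomorphic_on ball 0 r2"
    unfolding h_def using r2 g(1,2,6) by (intro holomorphic_intros holomorphic_on_subset[OF g(4)]) auto
  have g0: "g 0 \<noteq> 0" using g(2,6) by auto
  have hm: "h u ^ m = g u" if u: "u \<in> ball 0 r2" for u
  proof -
    have "g u / g 0 \<noteq> 0" using u r2(2) g(6)[of u] g0 by auto
    then show ?thesis
      using nrt_power[of m "g u / g 0"] g(1) g0 by (simp add: h_def power_mult_distrib c)
  qed
  define \<psi> where "\<psi> u = u * h u" for u
  have h\<psi>: "\<psi> holomorphic_on ball 0 r2" unfolding \<psi>_def using hh by (intro holomorphic_intros)
  have F\<psi>: "F u = v + \<psi> u ^ m" if u: "u \<in> ball 0 r2" for u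
  proof -
    have "F u - v = u ^ m * g u" using g(5)[of u] r2(2) u by auto
    then show ?thesis using hm[OF u] by (simp add: \<psi>_def power_mult_distrib algebra_simps)
  qed
  have h0: "h 0 \<noteq> 0"
  proof
    assume "h 0 = 0"
    then have "h 0 ^ m = 0" using g(1) by simp
    then show False using hm[of 0] r2(1) g0 by simp
  qed
  have z2: "0 \<in> ball (0::complex) r2" using r2(1) by simp
  have "(\<psi> has_field_derivative 1 * h 0 + deriv h 0 * 0) (at 0)"
    unfolding \<psi>_def by (intro derivative_intros holomorphic_derivI[OF hh open_ball z2])
  then have "deriv \<psi> 0 = h 0" by (simp add: DERIV_imp_deriv)
  then have "deriv \<psi> 0 \<noteq> 0" using h0 by simp
  from has_complex_derivative_locally_invertible[OF h\<psi> z2 open_ball this]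
  obtain r3 where r3: "r3 > 0" "ball 0 r3 \<subseteq> ball (0::complex) r2" "open (\<psi> ` ball 0 r3)" "inj_on \<psi> (ball 0 r3)" .
  have h3: "\<psi> holomorphic_on ball 0 r3" using h\<psi> r3(2) by (rule holomorphic_on_subset)
  obtain \<eta> where \<eta>: "\<eta> holomorphic_on (\<psi> ` ball 0 r3)" "\<And>u. u \<in> ball 0 r3 \<Longrightarrow> \<eta> (\<psi> u) = u"
    using holomorphic_has_inverse[OF h3 open_ball r3(4)] by blast
  have "\<psi> 0 = 0" by (simp add: \<psi>_def)
  then have "0 \<in> \<psi> ` ball 0 r3" using r3(1) by (metis centre_in_ball imageI)
  then obtain \<rho> where \<rho>: "\<rho> > 0" "ball 0 \<rho> \<subseteq> \<psi> ` ball 0 r3" using r3(3) open_contains_ball by blast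
  have "local_param j z v (nat (ram z)) \<rho> \<eta>"
    unfolding local_param_def
  proof (intro conjI ballI)
    show "\<rho> > 0" by (rule \<rho>(1))
    show "\<eta> holomorphic_on ball 0 \<rho>" using \<eta>(1) \<rho>(2) by (rule holomorphic_on_subset)
    show "inj_on \<eta> (ball 0 \<rho>)"
    proof (rule inj_onI)
      fix x y :: complex assume xy: "x \<in> ball 0 \<rho>" "y \<in> ball 0 \<rho>" "\<eta> x = \<eta> y"
      then obtain a b where "a \<in> ball 0 r3" "x = \<psi> a" "b \<in> ball 0 r3" "y = \<psi> b" using \<rho>(2) by blast
      then show "x = y" using xy(3) \<eta>(2) by simp
    qed
    show "\<eta> 0 = 0" using \<eta>(2)[of 0] r3(1) \<open>\<psi> 0 = 0\<close> by simp
    fix x :: complex assume "x \<in> ball 0 \<rho>"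
    then obtain u where u: "u \<in> ball 0 r3" "x = \<psi> u" using \<rho>(2) by blast
    then have u2: "u \<in> ball 0 r2" using r3(2) by blast
    have "j (P1_chart z u) = Some (F u)" using F(4)[of u] u2 r2(2) g(3) by blast
    then show "j (P1_chart z (\<eta> x)) = Some (v + x ^ nat (ram z))"
      using u \<eta>(2)[OF u(1)] F\<psi>[OF u2] by (simp add: rm)
  qed
  then show "\<exists>\<rho> \<eta>. local_param j z v (nat (ram z)) \<rho> \<eta>" by blast
qed

end

section \<open>The j-invariant\<close>

lemma j_invariant_rational:
  assumes "degree g2 \<le> 2 * k" "degree g3 \<le> 3 * k"
    and nc: "\<exists>z w. j_invariant k g2 g3 z \<noteq> j_invariant k g2 g3 w"
  shows "P1_rational (2 * k + 2 * k + 2 * k) (smult 4 (g2 * g2 * g2)) (smult 4 (g2 * g2 * g2) + smult 27 (g3 * g3))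
    (j_local k g2 g3) (j_invariant k g2 g3) (j_ramification k g2 g3)"
proof -
  \<comment> \<open>The degree \<open>6 * k\<close> is written as a sum to fit
    \<open>section_mult\<close> for a triple product; for the square of \<open>g3\<close> it is
    regrouped as \<open>3 * k + 3 * k\<close>.\<close>
  let ?n = "2 * k + 2 * k + 2 * k" and ?N = "smult 4 (g2 * g2 * g2)"
  let ?D = "?N + smult 27 (g3 * g3)"
  have d22: "degree (g2 * g2) \<le> 2 * k + 2 * k" using degree_mult_le[of g2 g2] assms(1) by linarith
  have d222: "degree (g2 * g2 * g2) \<le> ?n" using degree_mult_le[of "g2 * g2" g2] d22 assms(1) by linarith
  have d33: "degree (g3 * g3) \<le> 3 * k + 3 * k" using degree_mult_le[of g3 g3] assms(2) by linarith
  have n33: "?n = 3 * k + 3 * k" by simp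
  have dN: "degree ?N \<le> ?n" using d222 by simp
  have dD: "degree ?D \<le> ?n" using dN d33 by (intro degree_add_le) auto
  have s222: "section_at ?n (g2 * g2 * g2) z = section_at (2 * k) g2 z ^ 3" for z
    unfolding section_mult[OF d22 assms(1)] section_mult[OF assms(1) assms(1)] by (simp add: power3_eq_cube)
  have s33: "section_at ?n (g3 * g3) z = section_at (3 * k) g3 z ^ 2" for z
    unfolding n33 section_mult[OF assms(2) assms(2)] by (simp add: power2_eq_square)
  have f: "j_local k g2 g3 z u = poly (section_at ?n ?N z) u / poly (section_at ?n ?D z) u" for z u
    unfolding j_local_def Let_def section_add section_smult s222 s33 poly_add poly_smult poly_power ..
  show ?thesis
  proof
    show "?D \<noteq> 0"
    proof
      assume "?D = 0"
      then have "section_at ?n ?D z = 0" for z by (simp add: section_at_def split: option.split)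
      \<comment> \<open>With denominator zero, division by zero makes the j-invariant 0 everywhere,
        against non-constancy.\<close>
      then have j0: "j_local k g2 g3 z = (\<lambda>u. 0)" for z using f[of z] by (simp add: fun_eq_iff)
      then have "j_invariant k g2 g3 z = j_invariant k g2 g3 w" for z w
        by (simp add: j_invariant_def)
      then show False using nc by blast
    qed
  qed (use dN dD f nc in \<open>auto simp: j_invariant_def j_ramification_def Let_def\<close>)
qed

theorem j_invariant_dessin:
  assumes M: "maximal_trigonal_curve k B g2 g3"
  shows "dessin (j_invariant k g2 g3) (\<lambda>z. nat (j_ramification k g2 g3 z))"
    "\<forall>z. j_invariant k g2 g3 z = Some 0 \<longrightarrow> nat (j_ramification k g2 g3 z) \<le> 3"
    "\<forall>z. j_invariant k g2 g3 z = Some 1 \<longrightarrow> nat (j_ramification k g2 g3 z) \<le> 2"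
    "\<exists>Z. finite Z \<and> (\<forall>t. t \<notin> Z \<longrightarrow> (poly g2 t \<noteq> 0 \<and> poly g3 t \<noteq> 0 \<and> 4 * poly g2 t ^ 3 + 27 * poly g3 t ^ 2 \<noteq> 0) \<and>
       j_invariant k g2 g3 (Some t) = Some (4 * poly g2 t ^ 3 / (4 * poly g2 t ^ 3 + 27 * poly g3 t ^ 2)))"
proof -
  let ?j = "j_invariant k g2 g3" and ?r = "j_ramification k g2 g3"
  have dg: "degree g2 \<le> 2 * k" "degree g3 \<le> 3 * k"
    using M by (auto simp: maximal_trigonal_curve_def weierstrass_equation_def)
  have nc: "\<exists>z w. ?j z \<noteq> ?j w" using M by (simp add: maximal_trigonal_curve_def)
  interpret R: P1_rational "2 * k + 2 * k + 2 * k" "smult 4 (g2 * g2 * g2)"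
    "smult 4 (g2 * g2 * g2) + smult 27 (g3 * g3)" "j_local k g2 g3" ?j ?r
    by (rule j_invariant_rational[OF dg nc])
  have crit: "\<And>z. ?r z > 1 \<Longrightarrow> ?j z \<in> {Some 0, Some 1, None}"
    using M by (simp add: maximal_trigonal_curve_def)
  show "dessin ?j (\<lambda>z. nat (?r z))"
  proof
    show "continuous_map P1_top P1_top ?j" by (rule R.continuous_j)
    fix z v
    show "finite {z. ?j z = Some v}" by (rule R.finite_fibre)
    assume jz: "?j z = Some v"
    show "nat (?r z) \<ge> 1" using R.param_exists(1)[OF jz] by simp
    show "\<exists>\<rho> \<eta>. local_param ?j z v (nat (?r z)) \<rho> \<eta>" by (rule R.param_exists(2)[OF jz])
    show "nat (?r z) = 1" if "v \<notin> {0, 1}"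
    proof -
      have "\<not> ?r z > 1" using crit[of z] jz that by auto
      then show ?thesis using R.param_exists(1)[OF jz] by simp
    qed
  qed
  show "\<forall>z. ?j z = Some 0 \<longrightarrow> nat (?r z) \<le> 3" "\<forall>z. ?j z = Some 1 \<longrightarrow> nat (?r z) \<le> 2"
    using M by (auto simp: maximal_trigonal_curve_def nat_le_iff)
  \<comment> \<open>If \<open>g2\<close> vanished identically, the fraction would be the constant 0;
    if \<open>g3\<close> did, the constant 1.\<close>
  have g2: "g2 \<noteq> 0" using R.not_constant_fraction[of 0] by auto
  have g3: "g3 \<noteq> 0" using R.not_constant_fraction[of 1] by auto
  let ?D = "smult 4 (g2 * g2 * g2) + smult 27 (g3 * g3)"
  define Z where "Z = {t. poly g2 t = 0} \<union> {t. poly g3 t = 0} \<union> {t. poly ?D t = 0}"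
  have pD: "poly ?D t = 4 * poly g2 t ^ 3 + 27 * poly g3 t ^ 2" for t
    by (simp add: power2_eq_square power3_eq_cube)
  have "finite Z" unfolding Z_def using g2 g3 R.D0 by (intro finite_UnI poly_roots_finite)
  moreover have "?j (Some t) = Some (4 * poly g2 t ^ 3 / (4 * poly g2 t ^ 3 + 27 * poly g3 t ^ 2))" if "t \<notin> Z" for t
  proof -
    have "poly ?D t \<noteq> 0" using that by (simp add: Z_def)
    from R.j_Some[OF this] show ?thesis unfolding pD by (simp add: power3_eq_cube)
  qed
  ultimately show "\<exists>Z. finite Z \<and> (\<forall>t. t \<notin> Z \<longrightarrow> (poly g2 t \<noteq> 0 \<and> poly g3 t \<noteq> 0 \<and> 4 * poly g2 t ^ 3 + 27 * poly g3 t ^ 2 \<noteq> 0) \<and>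
       ?j (Some t) = Some (4 * poly g2 t ^ 3 / (4 * poly g2 t ^ 3 + 27 * poly g3 t ^ 2)))"
    using pD by (intro exI[of _ Z]) (auto simp: Z_def)
qed

theorem corollary6p6p1:
  fixes k :: nat and B :: "hirzebruch_point set" and g2 g3 :: "complex poly"
    and j :: "P1 \<Rightarrow> P1"
  assumes "maximal_trigonal_curve k B g2 g3"
    and "j = j_invariant k g2 g3"
  shows "reducible_curve k B \<longleftrightarrow>
    (\<forall>z \<in> sk_vertices j. valency j z = 3) \<and>
    (\<exists>m. marking j m \<and>
       (\<forall>e \<in> sk_edges j. hanging_edge j e \<longrightarrow> hanging_edge_has_index j m e 1) \<and>
       (\<forall>e \<in> sk_edges j. \<not> hanging_edge j e \<longrightarrow>
          (\<exists>p \<in> {(1, 1), (2, 3), (3, 2)}. edge_has_indices j m e p)))"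
proof -
  note d = j_invariant_dessin[OF assms(1), folded assms(2)]
  interpret dessin j "\<lambda>z. nat (j_ramification k g2 g3 z)" by (rule d(1))
  obtain Z where Z: "finite Z"
    "\<And>t. t \<notin> Z \<Longrightarrow> poly g2 t \<noteq> 0 \<and> poly g3 t \<noteq> 0 \<and> 4 * poly g2 t ^ 3 + 27 * poly g3 t ^ 2 \<noteq> 0"
    "\<And>t. t \<notin> Z \<Longrightarrow> j (Some t) = Some (4 * poly g2 t ^ 3 / (4 * poly g2 t ^ 3 + 27 * poly g3 t ^ 2))"
    using d(4) by blast
  have "reducible_curve k B \<longleftrightarrow> (\<exists>s. s ^ 3 + g2 * s + g3 = 0)"
    using assms(1) by (intro reducible_iff_polynomial_root) (auto simp: maximal_trigonal_curve_def)
  also have "\<dots> \<longleftrightarrow> (\<exists>lab. compatible lab)"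
    by (rule compatible_iff_polynomial_root[OF Z(1), symmetric]) (rule Z(2,3); assumption)+
  finally show ?thesis
    unfolding marking_iff_compatible[OF d(2,3)] .
qed

end
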